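(* Let $s\in(0,1)$, let $n$ be a positive integer with $n>2s$, and let $p+1>\frac{2n}{n-2s}$. Then there exists a radially symmetric entire solution $\bar w=\bar w(|x|)$, decreasing in the radial variable $r=|x|$, of $$(-\Delta)^s \bar w=\bar w^p\ \text{ in }\mathbb{R}^n,\qquad \bar w>0,$$ such that, for some constant $C>0$, $$\bar w(r)\le C r^{-\frac{2s}{p-1}}\quad\text{as } r\to+\infty.$$
   Context: $(-\Delta)^s$ denotes the fractional Laplacian on $\mathbb{R}^n$, i.e. $(-\Delta)^s u(x)=c_{n,s}\,\mathrm{P.V.}\int_{\mathbb{R}^n}\frac{u(x)-u(y)}{|x-y|^{n+2s}}\,dy$, with $c_{n,s}>0$ normalized so that its Fourier symbol is $|\xi|^{2s}$. "Entire" means defined and non-singular on all of $\mathbb{R}^n$, including the origin. *)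

theory Defs
  imports "HOL-Analysis.Analysis"
begin

(* The constant c_{n,s}, with n = DIM('a). The principal value operator without the constant
   maps x |-> cos (xi . x) to m(xi) cos (xi . x), where
     m(xi) = integral of (1 - cos (xi . y)) / |y|^(n+2s) dy.
   By rotation invariance and scaling, m(xi) = |xi|^(2s) m(e) for any unit vector e, so the
   Fourier symbol is |xi|^(2s) exactly when c_{n,s} = 1 / m(e). *)
definition frac_laplacian_const :: "'a::euclidean_space itself \<Rightarrow> real \<Rightarrow> real" where
  "frac_laplacian_const _ s =
     1 / (LINT y|lborel. (1 - cos ((SOME e::'a. e \<in> Basis) \<bullet> y)) / norm y powr (real DIM('a) + 2 * s))"

(* (-Delta)^s u is defined at x and equals v there: the integral converges absolutely off every
   ball around x, and the principal value limit exists and yields v. A relation is used, as in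
   has_integral, so that existence of the principal value is part of the claim. *)
definition has_frac_laplacian ::
  "real \<Rightarrow> ('a::euclidean_space \<Rightarrow> real) \<Rightarrow> 'a \<Rightarrow> real \<Rightarrow> bool" where
  "has_frac_laplacian s u x v \<longleftrightarrow>
     (\<forall>\<epsilon>>0. set_integrable lborel (- ball x \<epsilon>)
        (\<lambda>y. (u x - u y) / norm (x - y) powr (real DIM('a) + 2 * s))) \<and>
     ((\<lambda>\<epsilon>. frac_laplacian_const TYPE('a) s *
          (LINT y:(- ball x \<epsilon>)|lborel. (u x - u y) / norm (x - y) powr (real DIM('a) + 2 * s)))
        \<longlongrightarrow> v) (at_right 0)"

end

(* Write a = n - 2s. It suffices to solve u = I(u^p), where I is convolution with |x|^(-a).

   On the unit ball the nonlinear eigenvalue problem u = (eps + T u)/(eps + T u (0)), with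
   T u = I(u^p 1_B), has a radially decreasing solution with u(0) = 1 for every eps > 0, by
   Brouwer's theorem and Helly selection. As eps tends to 0 the denominator tends to 0: otherwise
   a limit solves u = c T u, and a Pohozaev identity, obtained by differentiating the integral of
   u^p(x) u(tx) over B at t = 1, forces a <= 2n/(p+1), which fails in the supercritical range.
   Rescaling yields solutions v = eta + I(v^p 1_{B_R}), v(0) = 1, on balls with R tending to
   infinity. Monotonicity gives v(x) >= c |x|^(2s) v(x)^p, hence the decay rate uniformly in R,
   and the limit is an entire solution (eta vanishes because of the decay).

   To invert I pointwise, note that the truncated singular integral of I(f) is the average of f
   against a dilate of a fixed radial function Psi. The integral of Psi over B_R equals the integral
   of |z|^(-n-2s) (h(0) - h(z)) over |z| > 1/R, with h = I(1_B), which is increasing and bounded in R;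
   so Psi is nonnegative and integrable, and the principal value at x is f(x) times its integral.
   Only positivity of that integral matters, since w = c u absorbs the constant. *)
theory Submission
  imports Defs "HOL-Probability.Helly_Selection"
begin

section \<open>Affine changes of variables\<close>

text \<open>The zero function solves the integral equation, so approximate solutions may collapse.
  Dividing by the value at the origin excludes this and keeps everything among decreasing profiles
  with values in [0,1], a class closed under pointwise limits. Brouwer's theorem acts on finitely
  many shell values; since their number must grow, coordinates are indexed by natural numbers and
  not by a type. Only continuity of solutions is available, so Pohozaev's identity is read off from
  dilations: its boundary term has a sign, and that sign is exactly what survives when a dilated
  ball is compared with the ball itself. Dilation by R multiplies T by R^(n-a), and R is chosen to
  turn the eigenvalue into 1. Symmetry and monotonicity of potentials come from hyperplane
  reflections, and integrability of powers from dyadic shells, so no polar coordinates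
  enter.\<close>

lemma nn_integral_lborel_affine:
  fixes f :: "'a::euclidean_space \<Rightarrow> ennreal"
  assumes [measurable]: "f \<in> borel_measurable borel" and c: "c \<noteq> 0"
  shows "(\<integral>\<^sup>+x. f x \<partial>lborel) = ennreal (\<bar>c\<bar> ^ DIM('a)) * (\<integral>\<^sup>+x. f (t + c *\<^sub>R x) \<partial>lborel)"
  by (subst lborel_affine[OF c, of t])
     (simp add: nn_integral_density nn_integral_distr nn_integral_cmult)

lemma integrable_lborel_affine:
  fixes f :: "'a::euclidean_space \<Rightarrow> real"
  assumes "integrable lborel f" and c: "c \<noteq> 0"
  shows "integrable lborel (\<lambda>x. f (t + c *\<^sub>R x))"
proof -
  have [measurable]: "f \<in> borel_measurable borel" using assms by auto
  show ?thesis
    using assms(1) unfolding integrable_iff_bounded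
    by (subst (asm) nn_integral_lborel_affine[OF _ c, of _ t])
       (auto simp: c ennreal_mult_less_top)
qed

lemma integral_lborel_affine:
  fixes f :: "'a::euclidean_space \<Rightarrow> real"
  assumes c: "c \<noteq> 0"
  shows "(\<integral>x. f x \<partial>lborel) = \<bar>c\<bar> ^ DIM('a) * (\<integral>x. f (t + c *\<^sub>R x) \<partial>lborel)"
proof (cases "integrable lborel f")
  case True
  then have [measurable]: "f \<in> borel_measurable borel" by auto
  show ?thesis
    by (subst lborel_affine[OF c, of t])
       (simp add: integral_density integral_distr)
next
  case False
  have "\<not> integrable lborel (\<lambda>x. f (t + c *\<^sub>R x))"
  proof
    assume "integrable lborel (\<lambda>x. f (t + c *\<^sub>R x))"
    from integrable_lborel_affine[OF this, of "1/c" "- ((1/c) *\<^sub>R t)"] c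
    have "integrable lborel f" by (simp add: scaleR_right_diff_distrib)
    with False show False by simp
  qed
  with False show ?thesis by (simp add: not_integrable_integral_eq)
qed

lemma integral_lborel_reflect_at:
  fixes f :: "'a::euclidean_space \<Rightarrow> real"
  shows "(\<integral>y. f (x - y) \<partial>lborel) = (\<integral>z. f z \<partial>lborel)"
  using integral_lborel_affine[of "-1" f x] by simp

lemma integrable_lborel_reflect_at:
  fixes f :: "'a::euclidean_space \<Rightarrow> real"
  assumes "integrable lborel f"
  shows "integrable lborel (\<lambda>y. f (x - y))"
  using integrable_lborel_affine[OF assms, of "-1" x] by simp

text \<open>The usual Fubini argument for the uniqueness of an invariant measure, comparing the image
  measure with \<^term>\<open>lborel\<close> on the unit ball.\<close>

lemma distr_lborel_isometric_involution:
  fixes T :: "'a::euclidean_space \<Rightarrow> 'a"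
  assumes lin: "linear T" and inv: "\<And>x. T (T x) = x" and iso: "\<And>x. norm (T x) = norm x"
  shows "distr lborel borel T = lborel"
proof -
  have [measurable]: "T \<in> borel_measurable borel"
    using lin by (intro borel_measurable_continuous_onI linear_continuous_on linear_conv_bounded_linear[THEN iffD1])
  define M where "M = distr lborel borel T"
  have setsM [measurable_cong]: "sets M = sets borel" by (simp add: M_def)
  have inv_shift: "(\<integral>\<^sup>+x. f (x + c) \<partial>M) = (\<integral>\<^sup>+x. f x \<partial>M)"
    if [measurable]: "f \<in> borel_measurable borel" for f :: "'a \<Rightarrow> ennreal" and c
  proof -
    have "(\<integral>\<^sup>+x. f (x + c) \<partial>M) = (\<integral>\<^sup>+x. f (T (T c + 1 *\<^sub>R x)) \<partial>lborel)"
      unfolding M_def by (subst nn_integral_distr) (auto simp: linear_add[OF lin] inv add.commute)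
    also have "\<dots> = (\<integral>\<^sup>+x. f (T x) \<partial>lborel)"
      by (subst (2) nn_integral_lborel_affine[of _ 1 "T c"]) auto
    finally show ?thesis unfolding M_def by (simp add: nn_integral_distr)
  qed
  have emM: "emeasure M (ball 0 r) = emeasure lborel (ball 0 r :: 'a set)" for r
    unfolding M_def by (subst emeasure_distr) (auto simp: iso intro!: arg_cong2[where f=emeasure])
  interpret M: sigma_finite_measure M
  proof
    show "\<exists>A. countable A \<and> A \<subseteq> sets M \<and> \<Union> A = space M \<and> (\<forall>a\<in>A. emeasure M a \<noteq> \<infinity>)"
    proof (intro exI[of _ "range (\<lambda>n::nat. ball 0 (real n))"] conjI ballI)
      show "\<Union> (range (\<lambda>n::nat. ball 0 (real n))) = space M"
        by (auto simp: M_def intro: reals_Archimedean2)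
    next
      fix A assume "A \<in> range (\<lambda>n::nat. ball (0::'a) (real n))"
      then obtain n :: nat where "A = ball 0 (real n)" by auto
      then show "emeasure M A \<noteq> \<infinity>" by (simp add: emM emeasure_ball)
    qed (auto simp: setsM)
  qed
  interpret P: pair_sigma_finite M lborel ..
  define B where "B = ball (0::'a) 1"
  have [measurable]: "B \<in> sets borel" by (simp add: B_def)
  let ?g = "\<lambda>x. indicator B x :: ennreal"
  have *: "emeasure M A * emeasure lborel B = emeasure lborel A * emeasure M B"
    if [measurable]: "A \<in> sets borel" for A
  proof -
    let ?f = "\<lambda>x. indicator A x :: ennreal"
    have "emeasure M A * emeasure lborel B
        = (\<integral>\<^sup>+y. (\<integral>\<^sup>+x. ?f (x + y) \<partial>M) * ?g y \<partial>lborel)"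
      by (subst inv_shift) (auto simp: nn_integral_cmult_indicator setsM)
    also have "\<dots> = (\<integral>\<^sup>+y. (\<integral>\<^sup>+x. ?f (x + y) * ?g y \<partial>M) \<partial>lborel)"
      by (subst nn_integral_multc) (auto)
    also have "\<dots> = (\<integral>\<^sup>+x. (\<integral>\<^sup>+y. ?f (x + y) * ?g y \<partial>lborel) \<partial>M)"
      by (rule P.Fubini') measurable
    also have "\<dots> = (\<integral>\<^sup>+x. (\<integral>\<^sup>+y. ?f y * ?g (y - x) \<partial>lborel) \<partial>M)"
    proof (rule nn_integral_cong)
      fix x
      show "(\<integral>\<^sup>+y. ?f (x + y) * ?g y \<partial>lborel) = (\<integral>\<^sup>+y. ?f y * ?g (y - x) \<partial>lborel)"
        using nn_integral_lborel_affine[of "\<lambda>y. ?f y * ?g (y - x)" 1 x] by simp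
    qed
    also have "\<dots> = (\<integral>\<^sup>+y. (\<integral>\<^sup>+x. ?f y * ?g (y - x) \<partial>M) \<partial>lborel)"
      by (rule P.Fubini'[symmetric]) measurable
    also have "\<dots> = (\<integral>\<^sup>+y. ?f y * (\<integral>\<^sup>+x. ?g (x + - y) \<partial>M) \<partial>lborel)"
    proof -
      \<comment> \<open>Symmetry of the ball turns the difference into a translate in x, to which
        \<open>inv_shift\<close> applies.\<close>
      have "?g (y - x) = ?g (x + - y)" for x y :: 'a
        by (auto simp: B_def indicator_def norm_minus_commute)
      then show ?thesis by (simp add: nn_integral_cmult)
    qed
    also have "\<dots> = emeasure lborel A * emeasure M B"
      by (subst inv_shift) (auto simp: nn_integral_multc)
    finally show ?thesis .
  qed
  have pos: "emeasure lborel (ball 0 1 :: 'a set) \<noteq> 0" "emeasure lborel (ball 0 1 :: 'a set) \<noteq> \<infinity>"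
    using unit_ball_vol_pos[of "real DIM('a)"] by (auto simp: emeasure_ball simp del: unit_ball_vol_pos)
  show ?thesis
  proof (rule measure_eqI)
    fix A assume "A \<in> sets (distr lborel borel T)"
    then have "A \<in> sets borel" by simp
    from *[OF this] have "emeasure lborel B * emeasure M A = emeasure lborel B * emeasure lborel A"
      unfolding B_def emM by (simp only: mult.commute)
    with pos show "emeasure (distr lborel borel T) A = emeasure lborel A"
      unfolding ennreal_mult_cancel_left B_def M_def[symmetric] by simp
  qed simp
qed

section \<open>Integrability of powers of the norm\<close>

text \<open>The sets may overlap, since only an upper bound is wanted: |f| is at most the sum of the
  step functions \<open>c k\<close> on \<open>S k\<close>. With dyadic shells this replaces polar
  coordinates.\<close>

lemma integrable_cover:
  fixes f :: "'a \<Rightarrow> real" and S :: "nat \<Rightarrow> 'a set" and c m :: "nat \<Rightarrow> real"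
  assumes [measurable]: "f \<in> borel_measurable M" "\<And>k. S k \<in> sets M"
    and cov: "AE x in M. f x \<noteq> 0 \<longrightarrow> (\<exists>k. x \<in> S k)"
    and bound: "\<And>k x. x \<in> S k \<Longrightarrow> \<bar>f x\<bar> \<le> c k"
    and meas: "\<And>k. emeasure M (S k) \<le> ennreal (m k)"
    and nn: "\<And>k. 0 \<le> c k" "\<And>k. 0 \<le> m k"
    and summ: "summable (\<lambda>k. c k * m k)"
  shows "integrable M f"
proof -
  have "(\<integral>\<^sup>+x. ennreal (norm (f x)) \<partial>M) \<le> (\<integral>\<^sup>+x. (\<Sum>k. ennreal (c k) * indicator (S k) x) \<partial>M)"
  proof (rule nn_integral_mono_AE, use cov in eventually_elim)
    fix x assume *: "f x \<noteq> 0 \<longrightarrow> (\<exists>k. x \<in> S k)"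
    show "ennreal (norm (f x)) \<le> (\<Sum>k. ennreal (c k) * indicator (S k) x)"
    proof (cases "f x = 0")
      case False
      with * obtain k where k: "x \<in> S k" by blast
      have "ennreal (norm (f x)) \<le> (\<Sum>j\<in>{k}. ennreal (c j) * indicator (S j) x)"
        using bound[OF k] k by (simp add: ennreal_leI)
      also have "\<dots> \<le> (\<Sum>k. ennreal (c k) * indicator (S k) x)"
        by (rule sum_le_suminf) auto
      finally show ?thesis .
    qed simp
  qed
  also have "\<dots> = (\<Sum>k. ennreal (c k) * emeasure M (S k))"
    by (subst nn_integral_suminf) (auto simp: nn_integral_cmult)
  also have "\<dots> \<le> (\<Sum>k. ennreal (c k * m k))"
    by (intro suminf_le) (auto simp: ennreal_mult nn meas intro!: mult_left_mono)
  also have "\<dots> < \<infinity>"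
    using summ nn by (simp add: suminf_ennreal_eq[OF _ summable_sums])
  finally show ?thesis by (intro integrableI_bounded) auto
qed

text \<open>On the shell between 2^-(k+1) and 2^-k the bound 2^(a(k+1)) meets a volume of order
  2^(-kn), a geometric series of ratio 2^-(n-a). The shells miss the origin, where
  \<open>0 powr (-a)\<close> is 0.\<close>

lemma integrable_powr_near_0:
  fixes a :: real
  assumes "0 \<le> a" "a < DIM('a::euclidean_space)"
  shows "integrable lborel (\<lambda>z::'a. indicator (cball 0 1) z * norm z powr (-a))"
proof (rule integrable_cover[where S="\<lambda>k. cball 0 ((1/2)^k) - cball 0 ((1/2)^Suc k)"
      and c="\<lambda>k. ((1/2)^Suc k) powr (-a)" and m="\<lambda>k. unit_ball_vol DIM('a) * ((1/2)^k)^DIM('a)"])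
  show "AE x::'a in lborel. indicator (cball 0 1) x * norm x powr (-a) \<noteq> 0 \<longrightarrow>
      (\<exists>k. x \<in> cball 0 ((1/2)^k) - cball 0 ((1/2)^Suc k))"
  proof (intro AE_I2 impI)
    fix x :: 'a assume "indicator (cball 0 1) x * norm x powr (-a) \<noteq> 0"
    then have x: "norm x \<le> 1" "x \<noteq> 0" by (auto simp: indicator_def split: if_splits)
    obtain N where N: "(1/2)^N < norm x" using x real_arch_pow_inv[of "norm x" "1/2"] by auto
    have ex: "\<exists>k. (1/2)^Suc k < norm x"
    proof (intro exI[of _ N])
      have "(1/2::real)^Suc N \<le> (1/2)^N" by simp
      with N show "(1/2)^Suc N < norm x" by linarith
    qed
    define k where "k = (LEAST k. (1/2)^Suc k < norm x)"
    have "(1/2)^Suc k < norm x" unfolding k_def using ex by (rule LeastI_ex)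
    moreover have "norm x \<le> (1/2)^k"
    proof (cases k)
      case (Suc j)
      then have "j < k" by simp
      then have "\<not> (1/2)^Suc j < norm x" unfolding k_def by (rule not_less_Least)
      with Suc show ?thesis by simp
    qed (use x in simp)
    ultimately show "\<exists>k. x \<in> cball 0 ((1/2)^k) - cball 0 ((1/2)^Suc k)" by auto
  qed
next
  fix k and x :: 'a assume "x \<in> cball 0 ((1/2)^k) - cball 0 ((1/2)^Suc k)"
  then have "(1/2)^Suc k < norm x" by auto
  moreover have "(0::real) < (1/2)^Suc k" by simp
  ultimately have "norm x powr (-a) \<le> ((1/2)^Suc k) powr (-a)"
    using assms by (intro powr_mono2') auto
  then show "\<bar>indicator (cball 0 1) x * norm x powr (-a)\<bar> \<le> ((1/2)^Suc k) powr (-a)"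
    by (auto simp: indicator_def)
next
  fix k
  have "emeasure lborel (cball 0 ((1/2)^k) - cball (0::'a) ((1/2)^Suc k)) \<le> emeasure lborel (cball (0::'a) ((1/2)^k))"
    by (intro emeasure_mono) auto
  then show "emeasure lborel (cball 0 ((1/2)^k) - cball (0::'a) ((1/2)^Suc k))
      \<le> ennreal (unit_ball_vol DIM('a) * ((1/2)^k)^DIM('a))"
    by (simp add: emeasure_cball)
next
  have eq: "((1/2)^Suc k) powr (-a) * (unit_ball_vol DIM('a) * ((1/2)^k)^DIM('a))
      = unit_ball_vol DIM('a) * 2 powr a * ((1/2) powr (DIM('a) - a))^k" for k
  proof -
    have "((1/2)^Suc k) powr (-a) = (1/2) powr (- a * real (Suc k))"
      by (simp add: powr_realpow[symmetric] powr_powr mult.commute del: power_Suc)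
    also have "\<dots> = 2 powr a * (1/2) powr (- a * real k)"
    proof -
      have "(1/2::real) powr t = 2 powr (-t)" for t by (simp add: powr_divide powr_minus_divide)
      then show ?thesis by (simp add: distrib_left powr_add[symmetric] add.commute)
    qed
    finally have 1: "((1/2)^Suc k) powr (-a) = 2 powr a * (1/2) powr (- a * real k)" .
    have 2: "((1/2::real)^k)^DIM('a) = (1/2) powr (DIM('a) * real k)"
      by (simp add: powr_realpow[symmetric] powr_powr mult.commute flip: power_mult)
    have "((1/2::real) powr (DIM('a) - a))^k = (1/2) powr ((DIM('a) - a) * real k)"
      by (simp add: powr_realpow[symmetric] powr_powr)
    also have "\<dots> = (1/2) powr (DIM('a) * real k) * (1/2) powr (- a * real k)"
      by (simp add: powr_add[symmetric] algebra_simps)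
    finally show ?thesis unfolding 1 2 by simp
  qed
  moreover have "(1/2::real) powr (DIM('a) - a) < 1"
    using powr_less_mono2_neg[of "-(DIM('a) - a)" 1 2] assms by (simp add: powr_divide powr_minus field_simps)
  ultimately show "summable (\<lambda>k. ((1/2)^Suc k) powr (-a) * (unit_ball_vol DIM('a) * ((1/2)^k)^DIM('a)))"
    unfolding eq by (intro summable_mult summable_geometric) simp
qed (auto intro!: borel_measurable_times borel_measurable_indicator)

lemma integrable_powr_outside:
  fixes a :: real
  assumes "a > DIM('a::euclidean_space)"
  shows "integrable lborel (\<lambda>z::'a. indicator (- cball 0 1) z * norm z powr (-a))"
proof (rule integrable_cover[where S="\<lambda>k. cball 0 (2^Suc k) - cball 0 (2^k)"
      and c="\<lambda>k. (2^k) powr (-a)" and m="\<lambda>k. unit_ball_vol DIM('a) * (2^Suc k)^DIM('a)"])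
  show "AE x::'a in lborel. indicator (- cball 0 1) x * norm x powr (-a) \<noteq> 0 \<longrightarrow>
      (\<exists>k. x \<in> cball 0 (2^Suc k) - cball 0 (2^k))"
  proof (intro AE_I2 impI)
    fix x :: 'a assume "indicator (- cball 0 1) x * norm x powr (-a) \<noteq> 0"
    then have x: "norm x > 1" by (auto simp: indicator_def split: if_splits)
    obtain N where N: "norm x < 2^N" using real_arch_pow[of 2 "norm x"] by auto
    have ex: "\<exists>k. norm x \<le> 2^Suc k"
    proof (intro exI[of _ N])
      have "(2::real)^N \<le> 2^Suc N" by simp
      with N show "norm x \<le> 2^Suc N" by linarith
    qed
    define k where "k = (LEAST k. norm x \<le> 2^Suc k)"
    have "norm x \<le> 2^Suc k" unfolding k_def using ex by (rule LeastI_ex)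
    moreover have "norm x > 2^k"
    proof (cases k)
      case (Suc j)
      then have "j < k" by simp
      then have "\<not> norm x \<le> 2^Suc j" unfolding k_def by (rule not_less_Least)
      with Suc show ?thesis by simp
    qed (use x in simp)
    ultimately show "\<exists>k. x \<in> cball 0 (2^Suc k) - cball 0 (2^k)" by auto
  qed
next
  fix k and x :: 'a assume "x \<in> cball 0 (2^Suc k) - cball 0 (2^k)"
  then have "2^k < norm x" by auto
  moreover have "(0::real) < 2^k" by simp
  ultimately have "norm x powr (-a) \<le> (2^k) powr (-a)"
    using assms by (intro powr_mono2') auto
  then show "\<bar>indicator (- cball 0 1) x * norm x powr (-a)\<bar> \<le> (2^k) powr (-a)"
    by (auto simp: indicator_def)
next
  fix k :: nat
  have "emeasure lborel (cball 0 (2^Suc k) - cball (0::'a) (2^k)) \<le> emeasure lborel (cball (0::'a) (2^Suc k))"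
    by (intro emeasure_mono) auto
  then show "emeasure lborel (cball 0 (2^Suc k) - cball (0::'a) (2^k))
      \<le> ennreal (unit_ball_vol DIM('a) * (2^Suc k)^DIM('a))"
    by (simp add: emeasure_cball)
next
  have eq: "(2^k) powr (-a) * (unit_ball_vol DIM('a) * (2^Suc k)^DIM('a))
      = unit_ball_vol DIM('a) * 2 ^ DIM('a) * (2 powr (DIM('a) - a))^k" for k
  proof -
    have 1: "(2^k) powr (-a) = 2 powr (- a * real k)"
      by (simp add: powr_realpow[symmetric] powr_powr mult.commute del: power_Suc)
    have 2: "(2^Suc k)^DIM('a) = 2 ^ DIM('a) * 2 powr (DIM('a) * real k)"
      by (simp add: powr_realpow[symmetric] powr_powr power_mult_distrib mult.commute)
    have "(2 powr (DIM('a) - a))^k = 2 powr ((DIM('a) - a) * real k)"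
      by (simp add: powr_realpow[symmetric] powr_powr)
    also have "\<dots> = 2 powr (DIM('a) * real k) * 2 powr (- a * real k)"
      by (simp add: powr_add[symmetric] algebra_simps)
    finally show ?thesis unfolding 1 2 by simp
  qed
  moreover have "2 powr (DIM('a) - a) < 1"
    using powr_less_mono[of "DIM('a) - a" 0 2] assms by simp
  ultimately show "summable (\<lambda>k. (2^k) powr (-a) * (unit_ball_vol DIM('a) * (2^Suc k)^DIM('a)))"
    unfolding eq by (intro summable_mult summable_geometric) simp
qed (auto intro!: borel_measurable_times borel_measurable_indicator)

text \<open>The condition a < n serves the origin and n < a + b serves infinity. The same conditions
  return as standing hypotheses on a kernel exponent a and a decay exponent b of the
  density.\<close>

lemma integrable_powr_weight:
  fixes a b :: real
  assumes "0 \<le> a" "a < DIM('a::euclidean_space)" "DIM('a) < a + b"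
  shows "integrable lborel (\<lambda>z::'a. norm z powr (-a) * (1 + norm z) powr (-b))"
proof -
  have b: "b \<ge> 0" using assms by simp
  have "integrable lborel (\<lambda>z::'a. indicator (cball 0 1) z * norm z powr (-a)
      + indicator (- cball 0 1) z * norm z powr (-(a+b)))"
    using assms by (intro Bochner_Integration.integrable_add integrable_powr_near_0 integrable_powr_outside) auto
  then show ?thesis
  proof (rule Bochner_Integration.integrable_bound)
    show "AE z::'a in lborel. norm (norm z powr (-a) * (1 + norm z) powr (-b))
       \<le> norm (indicator (cball 0 1) z * norm z powr (-a) + indicator (- cball 0 1) z * norm z powr (-(a+b)))"
    proof (rule AE_I2)
      fix z :: 'a
      show "norm (norm z powr (-a) * (1 + norm z) powr (-b))
       \<le> norm (indicator (cball 0 1) z * norm z powr (-a) + indicator (- cball 0 1) z * norm z powr (-(a+b)))"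
      proof (cases "norm z \<le> 1")
        case True
        have "(1 + norm z) powr (-b) \<le> 1 powr (-b)" using b by (intro powr_mono2') auto
        then have "norm z powr (-a) * (1 + norm z) powr (-b) \<le> norm z powr (-a) * 1"
          by (intro mult_left_mono) auto
        with True show ?thesis by (simp add: indicator_def)
      next
        case False
        then have "(1 + norm z) powr (-b) \<le> norm z powr (-b)" using b by (intro powr_mono2') auto
        then have "norm z powr (-a) * (1 + norm z) powr (-b) \<le> norm z powr (-a) * norm z powr (-b)"
          by (intro mult_left_mono) auto
        also have "\<dots> = norm z powr (-(a+b))" by (simp add: powr_add[symmetric])
        finally show ?thesis using False by (simp add: indicator_def)
      qed
    qed
  qed auto
qed

section \<open>Riesz potentials of radially decreasing densities\<close>

text \<open>Comparing norms instead of radii encodes symmetry as well: for equal norms the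
  inequality holds both ways. Being non-strict, it passes to pointwise limits.\<close>

definition radially_decreasing :: "('a::euclidean_space \<Rightarrow> real) \<Rightarrow> bool" where
  "radially_decreasing f \<longleftrightarrow> (\<forall>x y. norm x \<le> norm y \<longrightarrow> f y \<le> f x)"

lemma radially_decreasingD: "radially_decreasing f \<Longrightarrow> norm x \<le> norm y \<Longrightarrow> f y \<le> f x"
  by (simp add: radially_decreasing_def)

lemma radially_decreasing_eq: "radially_decreasing f \<Longrightarrow> norm x = norm y \<Longrightarrow> f x = f y"
  by (simp add: radially_decreasing_def order_antisym)

lemma radially_decreasing_profile:
  fixes f :: "'a::euclidean_space \<Rightarrow> real"
  assumes "radially_decreasing f"
  obtains g :: "real \<Rightarrow> real" where "antimono g" "\<And>x. f x = g (norm x)"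
proof -
  obtain e :: 'a where e: "norm e = 1" using vector_choose_size[of 1] by auto
  show ?thesis
  \<comment> \<open>The constant extension to negative radii makes the profile antimonotone on the
    whole line, as results on monotone real functions require.\<close>
  proof (rule that[of "\<lambda>r. f (max 0 r *\<^sub>R e)"])
    show "antimono (\<lambda>r. f (max 0 r *\<^sub>R e))"
      by (rule antimonoI, rule radially_decreasingD[OF assms]) (simp add: e)
    show "f x = f (max 0 (norm x) *\<^sub>R e)" for x
      by (rule radially_decreasing_eq[OF assms]) (simp add: e)
  qed
qed

lemma antimono_ctble_discont:
  fixes g :: "real \<Rightarrow> real"
  assumes "antimono g"
  shows "countable {r. \<not> isCont g r}"
proof -
  have "mono (\<lambda>r. - g r)" using assms by (auto simp: mono_def antimono_def)
  from mono_ctble_discont[OF this] show ?thesis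
    by (rule countable_subset[rotated]) (auto dest: isCont_minus)
qed

lemma radially_decreasing_measurable:
  fixes f :: "'a::euclidean_space \<Rightarrow> real"
  assumes "radially_decreasing f"
  shows "f \<in> borel_measurable borel"
proof -
  obtain g where g: "antimono g" "\<And>x. f x = g (norm x)" by (rule radially_decreasing_profile[OF assms]) (rule that)
  have "mono (\<lambda>r. - g r)" using g by (auto simp: mono_def antimono_def)
  then have "(\<lambda>r. - g r) \<in> borel_measurable borel" by (rule borel_measurable_mono)
  then have [measurable]: "g \<in> borel_measurable borel" by simp
  show ?thesis unfolding g(2) by measurable
qed

lemma radially_decreasing_discont:
  fixes f :: "'a::euclidean_space \<Rightarrow> real"
  assumes "radially_decreasing f"
  obtains D where "countable D" "\<And>x. norm x \<notin> D \<Longrightarrow> isCont f x"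
proof -
  obtain g where g: "antimono g" "\<And>x. f x = g (norm x)" by (rule radially_decreasing_profile[OF assms]) (rule that)
  show ?thesis
  proof (rule that[of "{r. \<not> isCont g r}"])
    show "countable {r. \<not> isCont g r}" using g(1) by (rule antimono_ctble_discont)
    fix x :: 'a assume "norm x \<notin> {r. \<not> isCont g r}"
    then have "isCont (\<lambda>x. g (norm x)) x"
      by (intro continuous_at_compose[of x norm g, unfolded o_def]) auto
    moreover have "f = (\<lambda>x. g (norm x))" using g(2) by auto
    ultimately show "isCont f x" by simp
  qed
qed

text \<open>The discontinuities of a radially decreasing function lie on countably many spheres,
  which are null sets. The arbitrary centre x accommodates the shifted densities of
  potentials.\<close>

lemma AE_norm_notin_countable:
  fixes x :: "'a::euclidean_space"
  assumes "countable D"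
  shows "AE z in lborel. norm (x - z) \<notin> D"
proof -
  have "sphere x d \<in> null_sets lborel" for d
    using negligible_sphere[of x d] by (auto simp: null_sets_completion_iff negligible_iff_null_sets)
  then have "(\<Union>d\<in>D. sphere x d) \<in> null_sets lborel"
    using assms by (intro null_sets_UN') auto
  then show ?thesis
    by (rule AE_I') (auto simp: dist_norm)
qed

text \<open>The kernel is left unnormalised. At y = x it has the value 0, because
  \<open>0 powr (-a)\<close> is 0; pointwise kernel comparisons must exclude that point.\<close>

definition riesz :: "real \<Rightarrow> ('a::euclidean_space \<Rightarrow> real) \<Rightarrow> 'a \<Rightarrow> real" where
  "riesz a f x = (\<integral>y. norm (x - y) powr (-a) * f y \<partial>lborel)"

lemma riesz_translate:
  "riesz a f x = (\<integral>z. norm z powr (-a) * f (x - z) \<partial>lborel)"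
  unfolding riesz_def
  using integral_lborel_reflect_at[of "\<lambda>z. norm z powr (-a) * f (x - z)" x] by simp

lemma riesz_cong_AE:
  fixes f g :: "'a::euclidean_space \<Rightarrow> real"
  assumes [measurable]: "f \<in> borel_measurable borel" "g \<in> borel_measurable borel"
    and "AE y in lborel. f y = g y"
  shows "riesz a f x = riesz a g x"
  unfolding riesz_def using assms(3) by (intro integral_cong_AE) auto

text \<open>Peetre's inequality. It lets a single majorant serve all x in a bounded set once the
  singularity has been moved to the origin.\<close>

lemma weight_shift:
  fixes x z :: "'a::real_normed_vector"
  assumes "b \<ge> 0"
  shows "(1 + norm (x - z)) powr (-b) \<le> (1 + norm x) powr b * (1 + norm z) powr (-b)"
proof -
  have "norm z \<le> norm x + norm (x - z)"
    by (metis add.commute norm_minus_commute norm_triangle_sub)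
  then have "1 + norm z \<le> (1 + norm x) * (1 + norm (x - z))"
    using mult_nonneg_nonneg[OF norm_ge_zero[of x] norm_ge_zero[of "x - z"]] by (simp only: distrib_left distrib_right mult_1_left mult_1_right)
  then have "((1 + norm x) * (1 + norm (x - z))) powr (-b) \<le> (1 + norm z) powr (-b)"
    using assms by (intro powr_mono2') (auto intro: add_pos_nonneg)
  then have "(1 + norm x) powr b * ((1 + norm x) powr (-b) * (1 + norm (x - z)) powr (-b))
      \<le> (1 + norm x) powr b * (1 + norm z) powr (-b)"
    by (intro mult_left_mono) (auto simp: powr_mult)
  then show ?thesis
    using norm_ge_zero[of x] by (simp add: mult.assoc[symmetric] powr_add[symmetric] add_nonneg_eq_0_iff)
qed

context
  fixes a b C :: real
  assumes a: "0 \<le> a" "a < DIM('a::euclidean_space)" "DIM('a) < a + b"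
begin

lemma decay_exponent_pos: "b > 0"
  using a by simp

lemma integrable_riesz_majorant:
  "integrable lborel (\<lambda>z::'a. norm z powr (-a) * (K * (1 + norm z) powr (-b)))"
  using integrable_mult_right[OF integrable_powr_weight[OF a], of K] by (simp add: mult.left_commute)

lemma riesz_integrand_bound:
  assumes f: "\<And>y::'a. \<bar>f y\<bar> \<le> C * (1 + norm y) powr (-b)" and x: "norm x \<le> R"
  shows "norm (norm z powr (-a) * f (x - z)) \<le> norm z powr (-a) * (\<bar>C\<bar> * (1 + R) powr b * (1 + norm z) powr (-b))"
proof -
  have "\<bar>f (x - z)\<bar> \<le> \<bar>C\<bar> * (1 + norm (x - z)) powr (-b)"
    by (rule order_trans[OF f]) (simp add: mult_right_mono)
  also have "\<dots> \<le> \<bar>C\<bar> * ((1 + norm x) powr b * (1 + norm z) powr (-b))"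
    using decay_exponent_pos by (intro mult_left_mono weight_shift) auto
  also have "\<dots> \<le> \<bar>C\<bar> * ((1 + R) powr b * (1 + norm z) powr (-b))"
    using decay_exponent_pos x by (intro mult_left_mono mult_right_mono powr_mono2) auto
  finally show ?thesis by (simp add: abs_mult mult_left_mono mult.assoc)
qed

lemma riesz_integrable_translate:
  assumes [measurable]: "f \<in> borel_measurable borel" and f: "\<And>y::'a. \<bar>f y\<bar> \<le> C * (1 + norm y) powr (-b)"
  shows "integrable lborel (\<lambda>z. norm z powr (-a) * f (x - z))"
  by (rule Bochner_Integration.integrable_bound[OF integrable_riesz_majorant[of "\<bar>C\<bar> * (1 + norm x) powr b"]])
     (use riesz_integrand_bound[OF f order_refl] in \<open>auto simp: abs_mult intro!: AE_I2 order_trans[OF _ abs_ge_self]\<close>)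

lemma riesz_integrable:
  assumes "f \<in> borel_measurable borel" "\<And>y::'a. \<bar>f y\<bar> \<le> C * (1 + norm y) powr (-b)"
  shows "integrable lborel (\<lambda>y. norm (x - y) powr (-a) * f y)"
  using integrable_lborel_reflect_at[OF riesz_integrable_translate[OF assms, of x], of x] by simp

lemma riesz_mono:
  assumes "f \<in> borel_measurable borel" "\<And>y::'a. \<bar>f y\<bar> \<le> C * (1 + norm y) powr (-b)"
   and "g \<in> borel_measurable borel" "\<And>y::'a. \<bar>g y\<bar> \<le> C * (1 + norm y) powr (-b)"
   and "\<And>y. f y \<le> g y"
  shows "riesz a f x \<le> riesz a g x"
  unfolding riesz_def using assms
  by (intro integral_mono riesz_integrable mult_left_mono) auto

lemma riesz_dominated_convergence:
  assumes [measurable]: "\<And>k. f k \<in> borel_measurable borel" "g \<in> borel_measurable borel"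
    and f: "\<And>k y::'a. \<bar>f k y\<bar> \<le> C * (1 + norm y) powr (-b)"
    and lim: "AE y in lborel. (\<lambda>k. f k y) \<longlonglongrightarrow> g y"
  shows "(\<lambda>k. riesz a (f k) x) \<longlonglongrightarrow> riesz a g x"
  unfolding riesz_def
proof (rule integral_dominated_convergence[where w="\<lambda>y. norm (x - y) powr (-a) * (C * (1 + norm y) powr (-b))"])
  have C: "C \<ge> 0" using f[of 0 0] by (simp add: order.trans[OF abs_ge_zero])
  show "integrable lborel (\<lambda>y. norm (x - y) powr (-a) * (C * (1 + norm y) powr (-b)))"
    by (rule riesz_integrable) (auto simp: abs_mult C)
  show "AE y in lborel. norm (norm (x - y) powr (-a) * f k y) \<le> norm (x - y) powr (-a) * (C * (1 + norm y) powr (-b))" for k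
    using f by (auto simp: abs_mult intro!: AE_I2 mult_left_mono)
  show "AE y in lborel. (\<lambda>k. norm (x - y) powr (-a) * f k y) \<longlonglongrightarrow> norm (x - y) powr (-a) * g y"
    using lim by eventually_elim (auto intro: tendsto_mult_left)
qed auto

text \<open>After translation x occurs only in the density, which may jump on the spheres with
  radius in D; for almost every z the point x - z avoids them, and dominated convergence
  applies.\<close>

lemma isCont_riesz:
  assumes [measurable]: "f \<in> borel_measurable borel" and f: "\<And>y::'a. \<bar>f y\<bar> \<le> C * (1 + norm y) powr (-b)"
    and D: "countable D" "\<And>y. norm y \<notin> D \<Longrightarrow> isCont f y"
  shows "isCont (riesz a f) x"
proof (rule continuous_at_sequentiallyI)
  fix u assume u: "u \<longlonglongrightarrow> x"
  obtain R where R: "\<And>n. norm (u n) \<le> R"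
    using convergent_imp_Bseq[OF convergentI[OF u]] by (auto simp: Bseq_def)
  show "(\<lambda>n. riesz a f (u n)) \<longlonglongrightarrow> riesz a f x"
    unfolding riesz_translate
  proof (rule integral_dominated_convergence[where w="\<lambda>z. norm z powr (-a) * (\<bar>C\<bar> * (1 + R) powr b * (1 + norm z) powr (-b))"])
    show "AE z in lborel. (\<lambda>n. norm z powr (-a) * f (u n - z)) \<longlonglongrightarrow> norm z powr (-a) * f (x - z)"
      using AE_norm_notin_countable[OF D(1), of x]
    proof eventually_elim
      fix z assume "norm (x - z) \<notin> D"
      from D(2)[OF this] have "(\<lambda>n. f (u n - z)) \<longlonglongrightarrow> f (x - z)"
        by (rule isCont_tendsto_compose) (intro tendsto_intros u)
      then show "(\<lambda>n. norm z powr (-a) * f (u n - z)) \<longlonglongrightarrow> norm z powr (-a) * f (x - z)"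
        by (rule tendsto_mult_left)
    qed
    show "AE z in lborel. norm (norm z powr (-a) * f (u n - z)) \<le> norm z powr (-a) * (\<bar>C\<bar> * (1 + R) powr b * (1 + norm z) powr (-b))" for n
      using riesz_integrand_bound[OF f R] by auto
  qed (use integrable_riesz_majorant in auto)
qed

end

section \<open>Reflections in the hyperplanes y . e = m\<close>

definition reflect :: "'a::euclidean_space \<Rightarrow> real \<Rightarrow> 'a \<Rightarrow> 'a" where
  "reflect e m y = y + (2 * (m - y \<bullet> e)) *\<^sub>R e"

context
  fixes e :: "'a::euclidean_space"
  assumes e: "norm e = 1"
begin

lemma reflect_inner: "reflect e m y \<bullet> e = 2 * m - y \<bullet> e"
  using e by (simp add: reflect_def inner_add_left norm_eq_1)

lemma reflect_reflect: "reflect e m (reflect e m y) = y"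
  unfolding reflect_def[of e m "reflect e m y"] reflect_inner
  by (simp add: reflect_def scaleR_add_left[symmetric])

text \<open>The sign of the last product tells whether y and z lie on the same side of the
  hyperplane; every distance comparison in the moving-plane argument reads it off.\<close>

lemma norm_reflect_squared: "(norm (reflect e m y - z))\<^sup>2 = (norm (y - z))\<^sup>2 + 4 * (m - y \<bullet> e) * (m - z \<bullet> e)"
proof -
  have "e \<bullet> e = 1" using e by (simp add: norm_eq_1)
  then have *: "(norm (w + c *\<^sub>R e))\<^sup>2 = (norm w)\<^sup>2 + 2 * c * (w \<bullet> e) + c\<^sup>2" for w c
    unfolding power2_norm_eq_inner
    by (simp add: inner_add_left inner_add_right inner_commute power2_eq_square)
  have "reflect e m y - z = (y - z) + (2 * (m - y \<bullet> e)) *\<^sub>R e" by (simp add: reflect_def)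
  then show ?thesis
    by (simp only: *) (simp add: inner_diff_left power2_eq_square algebra_simps)
qed

lemma norm_reflect_diff: "norm (reflect e m x - reflect e m y) = norm (x - y)"
proof -
  have "(norm (reflect e m x - reflect e m y))\<^sup>2 = (norm (x - y))\<^sup>2"
    by (subst norm_reflect_squared, subst norm_minus_commute, subst norm_reflect_squared)
       (simp add: reflect_inner norm_minus_commute algebra_simps)
  then show ?thesis by simp
qed

lemma norm_diff_reflect: "norm (x - reflect e m y) = norm (reflect e m x - y)"
  using norm_reflect_diff[of m "reflect e m x" y] by (simp add: reflect_reflect)

lemma distr_lborel_reflect: "distr lborel borel (reflect e m) = lborel"
proof -
  let ?T = "reflect e 0"
  have [measurable]: "?T \<in> borel_measurable borel"
    by (intro borel_measurable_continuous_onI) (auto simp: reflect_def intro!: continuous_intros)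
  have T: "distr lborel borel ?T = lborel"
  proof (rule distr_lborel_isometric_involution)
    show "linear ?T" by (rule linearI) (auto simp: reflect_def inner_add_left algebra_simps)
    show "?T (?T x) = x" for x by (rule reflect_reflect)
    have "(norm (?T x))\<^sup>2 = (norm x)\<^sup>2" for x
      using norm_reflect_squared[of 0 x 0] by simp
    then show "norm (?T x) = norm x" for x by simp
  qed
  have "distr lborel borel (reflect e m) = distr lborel borel (\<lambda>y. (2 * m) *\<^sub>R e + ?T y)"
    by (rule arg_cong[where f="distr lborel borel"]) (auto simp: reflect_def algebra_simps)
  also have "\<dots> = distr (distr lborel borel ?T) borel ((+) ((2 * m) *\<^sub>R e))"
    by (subst distr_distr) (auto simp: o_def)
  finally show ?thesis by (simp add: T lborel_distr_plus)
qed

lemma reflect_measurable [measurable]: "reflect e m \<in> borel_measurable borel"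
  by (intro borel_measurable_continuous_onI) (auto simp: reflect_def intro!: continuous_intros)

lemma integral_reflect:
  fixes h :: "'a \<Rightarrow> real"
  assumes [measurable]: "h \<in> borel_measurable borel"
  shows "(\<integral>y. h (reflect e m y) \<partial>lborel) = (\<integral>y. h y \<partial>lborel)"
  by (subst (2) distr_lborel_reflect[symmetric]) (simp add: integral_distr)

lemma integrable_reflect:
  fixes h :: "'a \<Rightarrow> real"
  assumes "integrable lborel h"
  shows "integrable lborel (\<lambda>y. h (reflect e m y))"
  by (rule integrable_distr[of _ lborel borel]) (use assms in \<open>auto simp: distr_lborel_reflect\<close>)

end

text \<open>The hyperplane is the perpendicular bisector of x and x'. The formula for m is exported
  because its sign records which of the two points is nearer to the origin.\<close>

lemma obtain_reflection:
  fixes x x' :: "'a::euclidean_space"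
  assumes "x \<noteq> x'"
  obtains e m where "norm e = 1" "x' = reflect e m x" "x \<bullet> e < m" "m = ((norm x')\<^sup>2 - (norm x)\<^sup>2) / (2 * norm (x' - x))"
proof
  let ?d = "norm (x' - x)" and ?e = "(1 / norm (x' - x)) *\<^sub>R (x' - x)"
  have d: "?d > 0" using assms by simp
  show "norm ?e = 1" using d by simp
  define m where "m = ((norm x')\<^sup>2 - (norm x)\<^sup>2) / (2 * norm (x' - x))"
  have dd: "?d * ?d = x' \<bullet> x' + x \<bullet> x - 2 * (x \<bullet> x')"
    by (simp add: power2_eq_square[symmetric] power2_norm_eq_inner inner_diff_left inner_diff_right inner_commute)
  have "m - x \<bullet> ?e = (x' \<bullet> x' + x \<bullet> x - 2 * (x \<bullet> x')) / (2 * ?d)"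
    using d by (simp add: m_def power2_norm_eq_inner inner_diff_right field_simps)
  also have "\<dots> = ?d / 2" using d by (simp add: dd[symmetric])
  finally have *: "m - x \<bullet> ?e = ?d / 2" .
  show "x' = reflect ?e m x" unfolding reflect_def * using d by simp
  show "x \<bullet> ?e < m" using * d by linarith
  show "m = ((norm x')\<^sup>2 - (norm x)\<^sup>2) / (2 * norm (x' - x))" by (rule m_def)
qed

text \<open>Moving-plane comparison: symmetrising the integrand under the reflection that swaps the two
  evaluation points makes it a product of two factors of equal sign.\<close>

context
  fixes a b C m :: real and e x :: "'a::euclidean_space" and f :: "'a \<Rightarrow> real"
  assumes a: "0 \<le> a" "a < DIM('a)" "DIM('a) < a + b"
    and f: "f \<in> borel_measurable borel" "\<And>y. \<bar>f y\<bar> \<le> C * (1 + norm y) powr (-b)"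
    and e: "norm e = 1"
begin

lemma riesz_diff_reflect:
  defines "h \<equiv> \<lambda>y. (norm (x - y) powr (-a) - norm (reflect e m x - y) powr (-a)) * (f y - f (reflect e m y))"
  shows "integrable lborel h" and "2 * (riesz a f x - riesz a f (reflect e m x)) = (\<integral>y. h y \<partial>lborel)"
proof -
  note [measurable] = f(1) reflect_measurable[OF e]
  let ?q = "\<lambda>y. norm (x - y) powr (-a) - norm (reflect e m x - y) powr (-a)"
  have qr: "?q (reflect e m y) = - ?q y" for y
    by (simp only: norm_diff_reflect[OF e, of x m y] norm_reflect_diff[OF e])
  have i1: "integrable lborel (\<lambda>y. ?q y * f y)"
    unfolding left_diff_distrib by (intro Bochner_Integration.integrable_diff riesz_integrable[OF a f])
  have v1: "riesz a f x - riesz a f (reflect e m x) = (\<integral>y. ?q y * f y \<partial>lborel)"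
    unfolding riesz_def left_diff_distrib
    by (intro Bochner_Integration.integral_diff[symmetric] riesz_integrable[OF a f])
  have i2: "integrable lborel (\<lambda>y. - (?q y * f (reflect e m y)))"
    using integrable_reflect[OF e i1, of m] by (simp only: qr mult_minus_left)
  have v2: "(\<integral>y. - (?q y * f (reflect e m y)) \<partial>lborel) = (\<integral>y. ?q y * f y \<partial>lborel)"
    using integral_reflect[OF e, of "\<lambda>y. ?q y * f y" m] by (simp only: qr mult_minus_left) simp
  have h: "h = (\<lambda>y. ?q y * f y + - (?q y * f (reflect e m y)))"
    by (auto simp: h_def algebra_simps)
  show "integrable lborel h" unfolding h by (rule Bochner_Integration.integrable_add[OF i1 i2])
  show "2 * (riesz a f x - riesz a f (reflect e m x)) = (\<integral>y. h y \<partial>lborel)"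
    unfolding h Bochner_Integration.integral_add[OF i1 i2] v2 v1 by (rule mult_2)
qed

text \<open>With m nonnegative, a point on the near side is closer both to x and to the origin than
  its mirror image, so both factors are nonnegative; on the far side both are nonpositive. The two
  poles are excluded because \<open>0 powr (-a)\<close> is 0.\<close>

lemma reflect_integrand_nonneg:
  assumes "radially_decreasing f" "0 \<le> m" "x \<bullet> e < m" "y \<noteq> x" "y \<noteq> reflect e m x"
  shows "0 \<le> (norm (x - y) powr (-a) - norm (reflect e m x - y) powr (-a)) * (f y - f (reflect e m y))"
proof (cases "y \<bullet> e \<le> m")
  case True
  have "(norm (x - y))\<^sup>2 \<le> (norm (reflect e m x - y))\<^sup>2"
    using norm_reflect_squared[OF e, of m x y] True assms by simp
  then have "norm (reflect e m x - y) powr (-a) \<le> norm (x - y) powr (-a)"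
    using assms a by (intro powr_mono2') auto
  moreover have "(norm y)\<^sup>2 \<le> (norm (reflect e m y))\<^sup>2"
    using norm_reflect_squared[OF e, of m y 0] True assms by simp
  then have "f (reflect e m y) \<le> f y" by (intro radially_decreasingD[OF assms(1)]) simp
  ultimately show ?thesis by simp
next
  case False
  have "4 * (m - x \<bullet> e) * (m - y \<bullet> e) \<le> 0" "4 * (m - y \<bullet> e) * m \<le> 0"
    using mult_nonneg_nonpos[of "4 * (m - x \<bullet> e)" "m - y \<bullet> e"] mult_nonpos_nonneg[of "4 * (m - y \<bullet> e)" m]
      False assms by simp_all
  then have "(norm (reflect e m x - y))\<^sup>2 \<le> (norm (x - y))\<^sup>2" "(norm (reflect e m y))\<^sup>2 \<le> (norm y)\<^sup>2"
    using norm_reflect_squared[OF e, of m x y] norm_reflect_squared[OF e, of m y 0] by simp_all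
  then have le: "norm (reflect e m x - y) \<le> norm (x - y)" "norm (reflect e m y) \<le> norm y"
    by simp_all
  from le(1) have "norm (x - y) powr (-a) \<le> norm (reflect e m x - y) powr (-a)"
    using assms a by (intro powr_mono2') auto
  moreover have "f y \<le> f (reflect e m y)" by (rule radially_decreasingD[OF assms(1) le(2)])
  ultimately show ?thesis by (simp add: mult_nonpos_nonpos)
qed

lemma AE_reflect_integrand_nonneg:
  assumes "radially_decreasing f" "0 \<le> m" "x \<bullet> e < m"
  shows "AE y in lborel. 0 \<le> (norm (x - y) powr (-a) - norm (reflect e m x - y) powr (-a)) * (f y - f (reflect e m y))"
  using AE_lborel_singleton[of x] AE_lborel_singleton[of "reflect e m x"]
  by eventually_elim (rule reflect_integrand_nonneg[OF assms])

end

context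
  fixes a b C :: real and f :: "'a::euclidean_space \<Rightarrow> real"
  assumes a: "0 \<le> a" "a < DIM('a)" "DIM('a) < a + b"
    and f: "\<And>y. \<bar>f y\<bar> \<le> C * (1 + norm y) powr (-b)"
    and dec: "radially_decreasing f"
begin

lemma radially_decreasing_riesz: "radially_decreasing (riesz a f)"
  unfolding radially_decreasing_def
proof (intro allI impI)
  fix x x' :: 'a assume le: "norm x \<le> norm x'"
  show "riesz a f x' \<le> riesz a f x"
  proof (cases "x = x'")
    case False
    then obtain e m where em: "norm e = 1" "x' = reflect e m x" "x \<bullet> e < m"
      and m: "m = ((norm x')\<^sup>2 - (norm x)\<^sup>2) / (2 * norm (x' - x))"
      by (rule obtain_reflection)
    have m0: "m \<ge> 0" using le unfolding m by simp
    have "0 \<le> 2 * (riesz a f x - riesz a f x')"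
      unfolding em(2) riesz_diff_reflect(2)[OF a radially_decreasing_measurable[OF dec] f em(1)]
      by (rule integral_nonneg_AE)
         (rule AE_reflect_integrand_nonneg[OF a radially_decreasing_measurable[OF dec] f em(1) dec m0 em(3)])
    then show ?thesis by simp
  qed simp
qed

text \<open>Equality would make f invariant under reflection in a hyperplane at positive distance m
  from the origin. As f is also even, it takes the value \<open>f 0\<close> at all points 2mk e,
  contradicting decay at infinity.\<close>

lemma riesz_strictly_decreasing:
  assumes a0: "0 < a" and cont: "continuous_on UNIV f" and lim: "(f \<longlongrightarrow> 0) at_infinity" and pos: "f 0 > 0"
    and lt: "norm x < norm x'"
  shows "riesz a f x' < riesz a f x"
proof (rule ccontr)
  assume "\<not> riesz a f x' < riesz a f x"
  then have eq: "riesz a f x' = riesz a f x"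
    using radially_decreasingD[OF radially_decreasing_riesz, of x x'] lt by simp
  have "x \<noteq> x'" using lt by auto
  then obtain e m where em: "norm e = 1" "x' = reflect e m x" "x \<bullet> e < m"
    and m: "m = ((norm x')\<^sup>2 - (norm x)\<^sup>2) / (2 * norm (x' - x))"
    by (rule obtain_reflection)
  have m0: "m > 0" using lt \<open>x \<noteq> x'\<close> unfolding m by (simp add: power_strict_mono)
  note fm = radially_decreasing_measurable[OF dec]
  let ?h = "\<lambda>y. (norm (x - y) powr (-a) - norm (reflect e m x - y) powr (-a)) * (f y - f (reflect e m y))"
  have "(\<integral>y. ?h y \<partial>lborel) = 0"
    using riesz_diff_reflect(2)[OF a fm f em(1), of x m] eq em(2) by simp
  then have AE0: "AE y in lborel. ?h y = 0"
    using integral_nonneg_eq_0_iff_AE[OF riesz_diff_reflect(1)[OF a fm f em(1)]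
        AE_reflect_integrand_nonneg[OF a fm f em(1) dec less_imp_le[OF m0] em(3)]] by blast
  \<comment> \<open>The symmetrised integrand vanishes almost everywhere and its kernel factor is
    nonzero on this side, so the bad set is null. By continuity it is open, hence empty.\<close>
  have same: "f y = f (reflect e m y)" if y: "y \<bullet> e < m" for y
  proof (rule ccontr)
    assume ne: "f y \<noteq> f (reflect e m y)"
    let ?U = "{z. f z - f (reflect e m z) \<noteq> 0} \<inter> {z. z \<bullet> e < m}"
    have "continuous_on UNIV (\<lambda>z. f z - f (reflect e m z))"
      by (intro continuous_on_diff cont continuous_on_compose2[OF cont])
         (auto simp: reflect_def intro!: continuous_intros)
    then have "open {z. f z - f (reflect e m z) \<noteq> 0}"
      by (rule open_Collect_neq) (rule continuous_on_const)
    moreover have "open {z. z \<bullet> e < m}"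
      by (intro open_Collect_less continuous_intros)
    ultimately have "open ?U" by blast
    moreover have "y \<in> ?U" using ne y by simp
    ultimately have "\<not> negligible ?U" using open_not_negligible by blast
    moreover have "?U \<in> null_sets lborel"
    proof -
      have "AE z in lborel. z \<notin> ?U"
        using AE0 AE_lborel_singleton[of x] AE_lborel_singleton[of "reflect e m x"]
      proof eventually_elim
        fix z assume h0: "?h z = 0" and z: "z \<noteq> x" "z \<noteq> reflect e m x"
        show "z \<notin> ?U"
        proof
          assume zU: "z \<in> ?U"
          have "0 < 4 * (m - x \<bullet> e) * (m - z \<bullet> e)" using zU em(3) by simp
          then have "(norm (x - z))\<^sup>2 < (norm (reflect e m x - z))\<^sup>2"
            using norm_reflect_squared[OF em(1), of m x z] by simp
          then have "norm (x - z) < norm (reflect e m x - z)" by (rule power_less_imp_less_base) simp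
          then have "norm (reflect e m x - z) powr (-a) < norm (x - z) powr (-a)"
            using z a0 by (intro powr_less_mono2_neg) auto
          with h0 zU show False by simp
        qed
      qed
      then show ?thesis
        using \<open>open ?U\<close> by (subst (asm) AE_iff_null_sets[symmetric]) auto
    qed
    then have "negligible ?U"
      unfolding negligible_iff_null_sets by (rule null_sets_completionI)
    ultimately show False by simp
  qed
  \<comment> \<open>Reflection sends -2mk e to 2m(k+1) e, and radial symmetry identifies -2mk e with
    2mk e.\<close>
  have step: "f ((2 * m * real k) *\<^sub>R e) = f 0" for k
  proof (induction k)
    case (Suc k)
    let ?y = "- ((2 * m * real k) *\<^sub>R e)"
    have ee: "e \<bullet> e = 1" using em(1) by (simp add: norm_eq_1)
    have "0 \<le> 2 * m * real k" using m0 by simp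
    then have "?y \<bullet> e < m" using m0 by (simp only: inner_minus_left inner_scaleR_left ee)
    have "reflect e m ?y = (2 * (m + 2 * m * real k) - 2 * m * real k) *\<^sub>R e"
      by (simp add: reflect_def ee scaleR_left_diff_distrib del: distrib_left_numeral right_diff_distrib_numeral)
    also have "2 * (m + 2 * m * real k) - 2 * m * real k = 2 * m * real (Suc k)"
      by (simp add: algebra_simps)
    finally have "f ?y = f ((2 * m * real (Suc k)) *\<^sub>R e)"
      using same[OF \<open>?y \<bullet> e < m\<close>] by simp
    moreover have "f ?y = f ((2 * m * real k) *\<^sub>R e)"
      by (rule radially_decreasing_eq[OF dec]) simp
    ultimately show ?case using Suc by simp
  qed simp
  have "filterlim (\<lambda>k. (2 * m * real k) *\<^sub>R e) at_infinity sequentially"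
  proof (rule filterlim_norm_at_top_imp_at_infinity)
    have "filterlim (\<lambda>k. 2 * m * real k) at_top sequentially"
      by (rule filterlim_tendsto_pos_mult_at_top[OF tendsto_const _ filterlim_real_sequentially]) (use m0 in simp)
    then show "filterlim (\<lambda>k. norm ((2 * m * real k) *\<^sub>R e)) at_top sequentially"
      using m0 by (simp add: em(1) abs_mult)
  qed
  from filterlim_compose[OF lim this] have "(\<lambda>k. f 0) \<longlonglongrightarrow> 0" by (simp add: step)
  then show False using pos by (simp add: LIMSEQ_const_iff)
qed

end

section \<open>Approximate fixed points and Helly selection\<close>

text \<open>Sperner labelling: a coordinate is labelled by the sign of \<^term>\<open>F x i - x i\<close>.\<close>

lemma cube_approx_fixed_point:
  fixes F :: "(nat \<Rightarrow> real) \<Rightarrow> nat \<Rightarrow> real" and n :: nat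
  defines "Q \<equiv> {x. \<forall>i<n. 0 \<le> x i \<and> x i \<le> 1}"
  assumes range: "\<And>x. x \<in> Q \<Longrightarrow> F x \<in> Q"
    and cont: "\<And>\<epsilon>. \<epsilon> > 0 \<Longrightarrow> \<exists>\<delta>>0. \<forall>x\<in>Q. \<forall>y\<in>Q. (\<forall>j<n. \<bar>x j - y j\<bar> \<le> \<delta>) \<longrightarrow> (\<forall>i<n. \<bar>F x i - F y i\<bar> \<le> \<epsilon>)"
    and "\<epsilon> > 0"
  shows "\<exists>x\<in>Q. \<forall>i<n. \<bar>F x i - x i\<bar> \<le> \<epsilon>"
proof -
  obtain \<delta> where \<delta>: "\<delta> > 0"
    "\<And>x y i. x \<in> Q \<Longrightarrow> y \<in> Q \<Longrightarrow> \<forall>j<n. \<bar>x j - y j\<bar> \<le> \<delta> \<Longrightarrow> i < n \<Longrightarrow> \<bar>F x i - F y i\<bar> \<le> \<epsilon> / 2"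
    using cont[of "\<epsilon> / 2"] \<open>\<epsilon> > 0\<close> by fastforce
  obtain P :: nat where P: "P > 0" "1 / real P < min \<delta> (\<epsilon> / 2)"
    using real_arch_inverse[of "min \<delta> (\<epsilon> / 2)"] \<delta>(1) \<open>\<epsilon> > 0\<close> by (auto simp: inverse_eq_divide)
  define pt :: "(nat \<Rightarrow> nat) \<Rightarrow> nat \<Rightarrow> real" where "pt x = (\<lambda>i. real (x i) / real P)" for x
  \<comment> \<open>Kuhn's lemma prescribes label 0 on the face \<open>x i = 0\<close> and label 1
    on the face \<open>x i = P\<close>. Both agree with the sign rule because F maps the cube into
    itself.\<close>
  define lab :: "(nat \<Rightarrow> nat) \<Rightarrow> nat \<Rightarrow> nat" where
    "lab x i = (if x i = 0 then 0 else if x i = P \<or> F (pt x) i < pt x i then 1 else 0)" for x i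
  have ptQ: "pt x \<in> Q" if "\<forall>i<n. x i \<le> P" for x
    using that P(1) by (auto simp: Q_def pt_def)
  have lab0: "pt x i \<le> F (pt x) i" if "\<forall>i<n. x i \<le> P" "i < n" "lab x i = 0" for x i
    using that(2,3) range[OF ptQ[OF that(1)]] by (auto simp: lab_def Q_def pt_def split: if_splits)
  have lab1: "F (pt x) i \<le> pt x i" if "\<forall>i<n. x i \<le> P" "i < n" "lab x i \<noteq> 0" for x i
    using that(2,3) range[OF ptQ[OF that(1)]] P(1) by (auto simp: lab_def Q_def pt_def split: if_splits)
  obtain q where q: "\<forall>i<n. q i < P"
    "\<forall>i<n. \<exists>r s. (\<forall>j<n. q j \<le> r j \<and> r j \<le> q j + 1) \<and> (\<forall>j<n. q j \<le> s j \<and> s j \<le> q j + 1) \<and> lab r i \<noteq> lab s i"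
    by (rule kuhn_lemma[of P n lab]) (use P(1) in \<open>auto simp: lab_def\<close>)
  \<comment> \<open>The cell has side 1/P, so P controls the displacement directly and the variation
    of F through \<delta>; each is at most half of the allowed error.\<close>
  have near: "\<bar>F (pt q) i - F (pt r) i\<bar> \<le> \<epsilon> / 2 \<and> pt q i \<le> pt r i \<and> pt r i \<le> pt q i + \<epsilon> / 2"
    if r: "\<forall>j<n. q j \<le> r j \<and> r j \<le> q j + 1" and i: "i < n" for r i
  proof -
    have d: "pt q j \<le> pt r j \<and> pt r j \<le> pt q j + 1 / real P" if "j < n" for j
      using r that P(1) by (auto simp: pt_def divide_right_mono add_divide_distrib[symmetric] intro!: divide_right_mono)
    have "r j \<le> P" if "j < n" for j using r q(1) that by fastforce
    then have "pt r \<in> Q" by (intro ptQ) simp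
    moreover have "pt q \<in> Q" using q(1) by (auto intro!: ptQ less_imp_le)
    moreover have "\<forall>j<n. \<bar>pt q j - pt r j\<bar> \<le> \<delta>" using d P(2) by fastforce
    ultimately show ?thesis using \<delta>(2) d[OF i] P(2) i by fastforce
  qed
  have "\<bar>F (pt q) i - pt q i\<bar> \<le> \<epsilon>" if i: "i < n" for i
  proof -
    obtain r' s' where rs': "\<forall>j<n. q j \<le> r' j \<and> r' j \<le> q j + 1" "\<forall>j<n. q j \<le> s' j \<and> s' j \<le> q j + 1"
      "lab r' i \<noteq> lab s' i"
      using q(2) i by blast
    have lab01: "lab x i = 0 \<or> lab x i = 1" for x by (simp add: lab_def)
    obtain r s where rs: "\<forall>j<n. q j \<le> r j \<and> r j \<le> q j + 1" "\<forall>j<n. q j \<le> s j \<and> s j \<le> q j + 1"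
      "lab r i = 0" "lab s i \<noteq> 0"
      using that[of r' s'] that[of s' r'] rs' lab01[of r'] lab01[of s'] by argo
    have "\<forall>j<n. r j \<le> P" "\<forall>j<n. s j \<le> P"
      using rs q(1) by fastforce+
    then have "pt r i \<le> F (pt r) i" "F (pt s) i \<le> pt s i"
      using lab0[of r] lab1[of s] rs i by auto
    with near[OF rs(1) i] near[OF rs(2) i] show ?thesis by (simp only: abs_le_iff) linarith
  qed
  moreover have "pt q \<in> Q" using q(1) by (auto intro!: ptQ less_imp_le)
  ultimately show ?thesis by blast
qed

text \<open>Helly's theorem is stated for right-continuous increasing functions, so it is applied to
  the negated profile along one ray. Convergence can fail only at discontinuities of the limit
  profile, that is on countably many spheres.\<close>

lemma radial_Helly_selection:
  fixes f :: "nat \<Rightarrow> 'a::euclidean_space \<Rightarrow> real"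
  assumes dec: "\<And>k. radially_decreasing (f k)" and bd: "\<And>k x. 0 \<le> f k x" "\<And>k x. f k x \<le> 1"
    and rcont: "\<And>k e r. norm e = 1 \<Longrightarrow> 0 \<le> r \<Longrightarrow> continuous (at_right r) (\<lambda>r. f k (r *\<^sub>R e))"
  obtains s G where "strict_mono s" "radially_decreasing G" "\<And>x. 0 \<le> G x" "\<And>x. G x \<le> 1"
    "AE x in lborel. (\<lambda>k. f (s k) x) \<longlonglongrightarrow> G x"
proof -
  obtain e :: 'a where e: "norm e = 1" using vector_choose_size[of 1] by auto
  define h where "h k r = - f k (max 0 r *\<^sub>R e)" for k r
  have hm: "mono (h k)" for k
    by (rule monoI) (auto simp: h_def e intro!: radially_decreasingD[OF dec])
  have hb: "\<bar>h k r\<bar> \<le> 1" for k r using bd[of k "max 0 r *\<^sub>R e"] by (auto simp: h_def)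
  have hc: "continuous (at_right r) (h k)" for k r
  proof (cases "r < 0")
    case True
    have "\<forall>\<^sub>F r' in at_right r. h k r' = h k r"
      using eventually_at_right_less[of r] eventually_at_right_real[OF True]
      by eventually_elim (auto simp: h_def)
    then show ?thesis unfolding continuous_within by (rule tendsto_eventually)
  next
    case False
    then have "((\<lambda>r'. - f k (r' *\<^sub>R e)) \<longlongrightarrow> - f k (r *\<^sub>R e)) (at_right r)"
      using rcont[OF e, of r k] unfolding continuous_within by (intro tendsto_minus) auto
    moreover have "\<forall>\<^sub>F r' in at_right r. - f k (r' *\<^sub>R e) = h k r'"
      using eventually_at_right_less[of r] by eventually_elim (use False in \<open>auto simp: h_def\<close>)
    ultimately have "(h k \<longlongrightarrow> - f k (r *\<^sub>R e)) (at_right r)"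
      by (rule Lim_transform_eventually)
    with False show ?thesis unfolding continuous_within by (simp add: h_def)
  qed
  have "\<exists>s. strict_mono (s :: nat \<Rightarrow> nat) \<and> (\<exists>F. (\<forall>x. continuous (at_right x) F) \<and> mono F \<and> (\<forall>x. \<bar>F x\<bar> \<le> 1) \<and>
      (\<forall>x. continuous (at x) F \<longrightarrow> (\<lambda>n. h (s n) x) \<longlonglongrightarrow> F x))"
    by (rule Helly_selection[OF hc hm hb])
  then obtain s :: "nat \<Rightarrow> nat" and F :: "real \<Rightarrow> real" where s: "strict_mono s" and F: "mono F"
    and lim: "\<And>r. isCont F r \<Longrightarrow> (\<lambda>n. h (s n) r) \<longlonglongrightarrow> F r"
    by metis
  \<comment> \<open>Clamping secures the bounds at discontinuities of F too, and it does not affect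
    the limits taken elsewhere, which already lie in [0,1].\<close>
  define G :: "'a \<Rightarrow> real" where "G x = max 0 (min 1 (- F (norm x)))" for x
  show ?thesis
  proof (rule that[OF s, of G])
    show "radially_decreasing G"
      unfolding radially_decreasing_def G_def
      by (intro allI impI max.mono min.mono order_refl) (simp add: monoD[OF F])
    show "0 \<le> G x" "G x \<le> 1" for x by (auto simp: G_def)
    show "AE x in lborel. (\<lambda>k. f (s k) x) \<longlonglongrightarrow> G x"
      using AE_norm_notin_countable[OF mono_ctble_discont[OF F], of 0]
    proof eventually_elim
      fix x :: 'a assume "norm (0 - x) \<notin> {r. \<not> isCont F r}"
      then have "(\<lambda>n. h (s n) (norm x)) \<longlonglongrightarrow> F (norm x)" by (intro lim) simp
      then have "(\<lambda>n. max 0 (min 1 (- h (s n) (norm x)))) \<longlonglongrightarrow> G x"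
        unfolding G_def by (intro tendsto_intros)
      moreover have "max 0 (min 1 (- h (s n) (norm x))) = f (s n) x" for n
        using bd[of "s n"] radially_decreasing_eq[OF dec[of "s n"], of "norm x *\<^sub>R e" x]
        by (simp add: h_def e)
      ultimately show "(\<lambda>k. f (s k) x) \<longlonglongrightarrow> G x" by simp
    qed
  qed
qed

lemma continuous_at_right_ray:
  fixes f :: "'a::euclidean_space \<Rightarrow> real"
  assumes "\<And>x. isCont f x"
  shows "continuous (at_right r) (\<lambda>r. f (r *\<^sub>R e))"
  by (rule continuous_at_imp_continuous_at_within)
     (intro continuous_at_compose[of r "\<lambda>r. r *\<^sub>R e" f, unfolded o_def] assms continuous_intros)

text \<open>Brings functions supported in a ball under the general decay hypothesis. The exponent n
  suffices because a + n > n for every positive a.\<close>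

lemma ball_decay: "indicator (ball 0 R) y \<le> (1 + \<bar>R\<bar>) powr DIM('a) * (1 + norm (y::'a::euclidean_space)) powr (- real DIM('a))"
proof (cases "y \<in> ball 0 R")
  case True
  then have "(1 + norm y) powr DIM('a) \<le> (1 + \<bar>R\<bar>) powr DIM('a)" by (intro powr_mono2) auto
  moreover have "(1 + norm y) powr DIM('a) > 0" by (simp add: add_nonneg_eq_0_iff)
  ultimately show ?thesis using True by (simp add: powr_minus_divide field_simps)
qed simp

lemma radially_decreasing_indicator: "radially_decreasing (indicator (ball (0::'a::euclidean_space) R) :: 'a \<Rightarrow> real)"
  by (auto simp: radially_decreasing_def indicator_def)

section \<open>Truncated sources and the class of admissible profiles\<close>

locale lane_emden =
  fixes a p :: real and ty :: "'a::euclidean_space itself"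
  assumes a: "0 < a" "a < DIM('a)" and p: "1 < p"
begin

definition src :: "real \<Rightarrow> ('a \<Rightarrow> real) \<Rightarrow> 'a \<Rightarrow> real" where
  "src R u y = indicator (ball 0 R) y * u y powr p"

definition admissible :: "('a \<Rightarrow> real) \<Rightarrow> bool" where
  "admissible u \<longleftrightarrow> radially_decreasing u \<and> (\<forall>x. 0 \<le> u x \<and> u x \<le> 1)"

lemma exponents: "0 \<le> a" "a < DIM('a)" "DIM('a) < a + DIM('a)"
  using a by auto

lemma src_bounds:
  assumes "admissible u"
  shows "0 \<le> src R u y" "src R u y \<le> indicator (ball 0 R) y"
    "\<bar>src R u y\<bar> \<le> (1 + \<bar>R\<bar>) powr DIM('a) * (1 + norm y) powr (- real DIM('a))"
proof -
  show 1: "0 \<le> src R u y" by (simp add: src_def)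
  have "u y powr p \<le> 1 powr p" using assms p by (intro powr_mono2) (auto simp: admissible_def)
  then show 2: "src R u y \<le> indicator (ball 0 R) y" by (auto simp: src_def indicator_def)
  from 1 order_trans[OF 2 ball_decay]
  show "\<bar>src R u y\<bar> \<le> (1 + \<bar>R\<bar>) powr DIM('a) * (1 + norm y) powr (- real DIM('a))" by simp
qed

lemma radially_decreasing_src:
  assumes "admissible u"
  shows "radially_decreasing (src R u)"
proof (unfold radially_decreasing_def, intro allI impI)
  fix x y :: 'a assume "norm x \<le> norm y"
  then have "u y powr p \<le> u x powr p" using assms p
    by (intro powr_mono2) (auto simp: admissible_def radially_decreasing_def)
  with \<open>norm x \<le> norm y\<close> show "src R u y \<le> src R u x"
    by (auto simp: src_def indicator_def)
qed

lemma src_measurable: "admissible u \<Longrightarrow> src R u \<in> borel_measurable borel"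
  by (rule radially_decreasing_measurable[OF radially_decreasing_src])

lemma radially_decreasing_riesz_src: "admissible u \<Longrightarrow> radially_decreasing (riesz a (src R u))"
  by (rule radially_decreasing_riesz[OF exponents src_bounds(3) radially_decreasing_src])

lemma isCont_riesz_src: "admissible u \<Longrightarrow> isCont (riesz a (src R u)) x"
  by (rule radially_decreasing_discont[OF radially_decreasing_src[of u R]], assumption)
     (rule isCont_riesz[OF exponents src_measurable src_bounds(3)])

lemma riesz_src_nonneg: "0 \<le> riesz a (src R u) x"
  unfolding riesz_def by (intro integral_nonneg_AE AE_I2) (simp add: src_def)

lemma riesz_src_le_origin: "admissible u \<Longrightarrow> riesz a (src R u) x \<le> riesz a (src R u) 0"
  by (rule radially_decreasingD[OF radially_decreasing_riesz_src]) auto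

lemma riesz_src_tendsto:
  assumes "\<And>k. admissible (u k)" "admissible v" and lim: "AE x in lborel. (\<lambda>k. u k x) \<longlonglongrightarrow> v x"
  shows "(\<lambda>k. riesz a (src R (u k)) x) \<longlonglongrightarrow> riesz a (src R v) x"
proof (rule riesz_dominated_convergence[OF exponents src_measurable[OF assms(1)] src_measurable[OF assms(2)] src_bounds(3)[OF assms(1)]])
  show "AE y in lborel. (\<lambda>k. src R (u k) y) \<longlonglongrightarrow> src R v y"
    using lim
  proof eventually_elim
    fix y assume "(\<lambda>k. u k y) \<longlonglongrightarrow> v y"
    then have "(\<lambda>k. u k y powr p) \<longlonglongrightarrow> v y powr p"
      by (rule tendsto_powr'[OF _ tendsto_const]) (use p assms(1) in \<open>auto simp: admissible_def\<close>)
    then show "(\<lambda>k. src R (u k) y) \<longlonglongrightarrow> src R v y"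
      unfolding src_def by (rule tendsto_mult_left)
  qed
qed

lemma riesz_src_cong_AE:
  assumes "admissible u" "admissible v" "AE x in lborel. x \<in> ball 0 R \<longrightarrow> u x = v x"
  shows "riesz a (src R u) x = riesz a (src R v) x"
  by (rule riesz_cong_AE[OF src_measurable[OF assms(1)] src_measurable[OF assms(2)]])
     (use assms(3) in eventually_elim, auto simp: src_def)

end

section \<open>Step profiles and the normalised fixed point\<close>

lemma abs_Min_diff_le:
  fixes c d :: "nat \<Rightarrow> real"
  assumes "\<And>j. j \<le> i \<Longrightarrow> \<bar>c j - d j\<bar> \<le> \<delta>"
  shows "\<bar>Min (c ` {..i}) - Min (d ` {..i})\<bar> \<le> \<delta>"
proof -
  have *: "Min (c ` {..i}) - \<delta> \<le> Min (d ` {..i})" if "\<And>j. j \<le> i \<Longrightarrow> \<bar>c j - d j\<bar> \<le> \<delta>" for c d :: "nat \<Rightarrow> real"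
  proof -
    have "Min (c ` {..i}) - \<delta> \<le> d j" if j: "j \<le> i" for j
    proof -
      have "Min (c ` {..i}) \<le> c j" using j by (intro Min_le) auto
      with \<open>j \<le> i \<Longrightarrow> \<bar>c j - d j\<bar> \<le> \<delta>\<close>[OF j] show ?thesis by linarith
    qed
    then show ?thesis by (subst Min_ge_iff) auto
  qed
  have "Min (c ` {..i}) - \<delta> \<le> Min (d ` {..i})" by (rule *[OF assms])
  moreover have "Min (d ` {..i}) - \<delta> \<le> Min (c ` {..i})"
    by (rule *) (use assms in \<open>simp add: abs_minus_commute\<close>)
  ultimately show ?thesis by (simp only: abs_le_iff) linarith
qed

text \<open>The running minimum makes the profile decreasing for every coefficient vector, so the
  fixed-point theorem can use the whole cube instead of the set of monotone vectors. It is
  nonexpansive in the maximum norm, which keeps the dependence on c continuous.\<close>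

definition step_profile :: "nat \<Rightarrow> (nat \<Rightarrow> real) \<Rightarrow> 'a::euclidean_space \<Rightarrow> real" where
  "step_profile N c x = (if norm x < 1 then Min (c ` {..nat \<lfloor>real N * norm x\<rfloor>}) else 0)"

lemma step_index:
  assumes "N > 0" "0 \<le> r" "r < 1"
  shows "nat \<lfloor>real N * r\<rfloor> < N" "real (nat \<lfloor>real N * r\<rfloor>) \<le> real N * r" "real N * r < real (nat \<lfloor>real N * r\<rfloor>) + 1"
proof -
  have "real N * r < real N" using assms by simp
  then show "nat \<lfloor>real N * r\<rfloor> < N" using assms by (simp add: nat_less_iff floor_less_iff)
  have "0 \<le> real N * r" using assms by simp
  then have "real (nat \<lfloor>real N * r\<rfloor>) = of_int \<lfloor>real N * r\<rfloor>" by simp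
  then show "real (nat \<lfloor>real N * r\<rfloor>) \<le> real N * r" "real N * r < real (nat \<lfloor>real N * r\<rfloor>) + 1"
    using floor_correct[of "real N * r"] by auto
qed

text \<open>Supplies the right continuity that Helly selection demands; the floor function and the
  strict test \<open>norm x < 1\<close> are both right-continuous in the radius.\<close>

lemma step_profile_rcont:
  fixes e :: "'a::euclidean_space"
  assumes e: "norm e = 1" and r: "0 \<le> r"
  shows "continuous (at_right r) (\<lambda>r. step_profile N c (r *\<^sub>R e))"
proof -
  have "\<forall>\<^sub>F r' in at_right r. step_profile N c (r' *\<^sub>R e) = step_profile N c (r *\<^sub>R e)"
  proof (cases "N > 0 \<and> r < 1")
    case True
    define i where "i = \<lfloor>real N * r\<rfloor>"
    have "real N * r < of_int i + 1" "of_int i \<le> real N * r" unfolding i_def by linarith+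
    then have "r < (of_int i + 1) / real N" using True by (simp add: field_simps)
    with True have "r < min 1 ((of_int i + 1) / real N)" by simp
    from eventually_at_right_real[OF this] show ?thesis
    proof eventually_elim
      fix r' assume r': "r' \<in> {r<..<min 1 ((of_int i + 1) / real N)}"
      then have "real N * r' < of_int i + 1" "real N * r \<le> real N * r'" using True by (auto simp: field_simps)
      with \<open>of_int i \<le> real N * r\<close> have "\<lfloor>real N * r'\<rfloor> = i" by (intro floor_unique) auto
      then show "step_profile N c (r' *\<^sub>R e) = step_profile N c (r *\<^sub>R e)"
        using r r' True by (simp add: step_profile_def e i_def)
    qed
  next
    case False
    have lt: "r < (if N > 0 then r + 1 else if r < 1 then 1 else r + 1)" by auto
    from eventually_at_right_real[OF this] show ?thesis
      by eventually_elim (use False r in \<open>auto simp: step_profile_def e split: if_splits\<close>)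
  qed
  then show ?thesis unfolding continuous_within by (rule tendsto_eventually)
qed

context lane_emden
begin

lemma admissible_step_profile:
  assumes N: "N > 0" and c: "\<And>i. i < N \<Longrightarrow> 0 \<le> c i \<and> c i \<le> 1"
  shows "admissible (step_profile N c)"
  unfolding admissible_def radially_decreasing_def
proof (intro conjI allI impI)
  have bd: "0 \<le> Min (c ` {..nat \<lfloor>real N * norm x\<rfloor>}) \<and> Min (c ` {..nat \<lfloor>real N * norm x\<rfloor>}) \<le> 1"
    if "norm x < 1" for x :: 'a
  proof -
    have "Min (c ` {..nat \<lfloor>real N * norm x\<rfloor>}) \<in> c ` {..nat \<lfloor>real N * norm x\<rfloor>}" by (rule Min_in) auto
    then show ?thesis using step_index(1)[OF N norm_ge_zero that] c by fastforce
  qed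
  then show "0 \<le> step_profile N c x" "step_profile N c x \<le> 1" for x :: 'a
    by (auto simp: step_profile_def)
  fix x y :: 'a assume le: "norm x \<le> norm y"
  have "Min (c ` {..nat \<lfloor>real N * norm y\<rfloor>}) \<le> Min (c ` {..nat \<lfloor>real N * norm x\<rfloor>})"
    using le by (intro Min_antimono image_mono) (auto simp: intro!: nat_mono floor_mono mult_left_mono)
  with bd[of x] bd[of y] le show "step_profile N c y \<le> step_profile N c x"
    by (auto simp: step_profile_def)
qed

context
  fixes \<epsilon> :: real
  assumes \<epsilon>: "\<epsilon> > 0"
begin

text \<open>The positive shift keeps the divisor away from 0 even for the zero profile, so the map
  is defined and continuous on all admissible functions.\<close>

definition Phi :: "('a \<Rightarrow> real) \<Rightarrow> 'a \<Rightarrow> real" where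
  "Phi u x = (\<epsilon> + riesz a (src 1 u) x) / (\<epsilon> + riesz a (src 1 u) 0)"

lemma denominator_pos: "\<epsilon> + riesz a (src 1 u) x > 0"
  using \<epsilon> riesz_src_nonneg[of 1 u x] by linarith

lemma Phi_origin: "Phi u 0 = 1"
  using denominator_pos[of u 0] by (simp add: Phi_def)

lemma Phi_pos: "Phi u x > 0"
  using denominator_pos by (simp add: Phi_def)

lemma Phi_radially_decreasing:
  assumes "admissible u" shows "radially_decreasing (Phi u)"
  using radially_decreasingD[OF radially_decreasing_riesz_src[OF assms]] denominator_pos[of u 0]
  by (auto simp: radially_decreasing_def Phi_def intro!: divide_right_mono)

lemma Phi_admissible:
  assumes "admissible u" shows "admissible (Phi u)"
  using Phi_radially_decreasing[OF assms] radially_decreasingD[OF Phi_radially_decreasing[OF assms], of 0]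
    Phi_pos[of u] by (auto simp: admissible_def Phi_origin intro: less_imp_le)

lemma isCont_Phi: "admissible u \<Longrightarrow> isCont (Phi u) x"
  unfolding Phi_def using denominator_pos[of u 0]
  by (intro continuous_intros isCont_riesz_src) auto

lemma Phi_tendsto:
  assumes "\<And>k. admissible (u k)" "admissible v" "AE x in lborel. (\<lambda>k. u k x) \<longlonglongrightarrow> v x"
  shows "(\<lambda>k. Phi (u k) x) \<longlonglongrightarrow> Phi v x"
  unfolding Phi_def using denominator_pos[of v 0]
  by (intro tendsto_intros riesz_src_tendsto assms) auto

text \<open>If \<open>u powr p\<close> and \<open>v powr p\<close> differ by at most \<omega> on the
  ball, their potentials differ by at most \<omega> K, where K is the largest value of the potential
  of the ball. Normalising at most doubles the resulting relative error \<omega> K /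
  \<epsilon>.\<close>

lemma Phi_uniformly_continuous:
  assumes "\<eta> > 0"
  obtains \<delta> where "\<delta> > 0" "\<forall>u v x. admissible u \<longrightarrow> admissible v \<longrightarrow>
     (\<forall>y. norm y < 1 \<longrightarrow> \<bar>u y - v y\<bar> \<le> \<delta>) \<longrightarrow> \<bar>Phi u x - Phi v x\<bar> \<le> \<eta>"
proof -
  define K where "K = riesz a (indicator (ball (0::'a) 1)) 0"
  \<comment> \<open>Makes twice \<omega> K / \<epsilon> equal to \<eta> K / (K + 1), which is at
    most \<eta>; adding 1 to K avoids a case distinction at K = 0.\<close>
  define \<omega> where "\<omega> = \<eta> * \<epsilon> / (2 * (K + 1))"
  have ind: "\<bar>indicator (ball 0 1) y\<bar> \<le> (1 + \<bar>1\<bar>) powr DIM('a) * (1 + norm (y::'a)) powr (- real DIM('a))" for y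
    using ball_decay[of 1 y] by simp
  have [measurable]: "(indicator (ball (0::'a) 1) :: 'a \<Rightarrow> real) \<in> borel_measurable borel"
    by (rule borel_measurable_indicator) auto
  have K0: "K \<ge> 0" unfolding K_def riesz_def by (intro integral_nonneg_AE AE_I2) simp
  have \<omega>: "\<omega> > 0" using assms \<epsilon> K0 by (simp add: \<omega>_def)
  have "uniformly_continuous_on {0..1} (\<lambda>t::real. t powr p)"
    by (intro compact_uniformly_continuous continuous_on_powr' continuous_intros) (use p in auto)
  then obtain \<delta> where \<delta>: "\<delta> > 0" "\<And>s t. s \<in> {0..1} \<Longrightarrow> t \<in> {0..1} \<Longrightarrow> dist t s < \<delta> \<Longrightarrow> dist (t powr p) (s powr p) < \<omega>"
    using \<omega> unfolding uniformly_continuous_on_def by meson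
  have half: "riesz a (src 1 u) x \<le> riesz a (src 1 v) x + \<omega> * K"
    if uv: "admissible u" "admissible v" "\<And>y. norm y < 1 \<Longrightarrow> \<bar>u y - v y\<bar> \<le> \<delta> / 2" for u v x
  proof -
    have i1: "integrable lborel (\<lambda>y. norm (x - y) powr (-a) * src 1 v y)"
      by (rule riesz_integrable[OF exponents src_measurable[OF uv(2)] src_bounds(3)[OF uv(2)]])
    have i2: "integrable lborel (\<lambda>y. \<omega> * (norm (x - y) powr (-a) * indicator (ball 0 1) y))"
      by (rule integrable_mult_right) (rule riesz_integrable[OF exponents _ ind], measurable)
    have "riesz a (src 1 u) x \<le> (\<integral>y. norm (x - y) powr (-a) * src 1 v y + \<omega> * (norm (x - y) powr (-a) * indicator (ball 0 1) y) \<partial>lborel)"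
      unfolding riesz_def
    proof (rule integral_mono[OF riesz_integrable[OF exponents src_measurable[OF uv(1)] src_bounds(3)[OF uv(1)]]])
      show "integrable lborel (\<lambda>y. norm (x - y) powr (-a) * src 1 v y + \<omega> * (norm (x - y) powr (-a) * indicator (ball 0 1) y))"
        by (rule Bochner_Integration.integrable_add[OF i1 i2])
      fix y
      have "src 1 u y \<le> src 1 v y + \<omega> * indicator (ball 0 1) y"
      proof (cases "norm y < 1")
        case True
        then have "dist (u y) (v y) < \<delta>" using uv(3)[OF True] \<delta>(1) by (simp add: dist_real_def)
        then have "dist (u y powr p) (v y powr p) < \<omega>"
          using uv by (intro \<delta>(2)) (auto simp: admissible_def)
        then show ?thesis using True by (simp add: src_def dist_real_def)
      qed (simp add: src_def)
      then have "norm (x - y) powr (-a) * src 1 u y \<le> norm (x - y) powr (-a) * (src 1 v y + \<omega> * indicator (ball 0 1) y)"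
        by (rule mult_left_mono) simp
      then show "norm (x - y) powr (-a) * src 1 u y \<le> norm (x - y) powr (-a) * src 1 v y + \<omega> * (norm (x - y) powr (-a) * indicator (ball 0 1) y)"
        by (simp add: algebra_simps)
    qed
    also have "\<dots> = riesz a (src 1 v) x + \<omega> * riesz a (indicator (ball 0 1)) x"
      unfolding Bochner_Integration.integral_add[OF i1 i2] by (simp add: riesz_def)
    also have "riesz a (indicator (ball 0 1)) x \<le> K"
      unfolding K_def by (rule radially_decreasingD[OF radially_decreasing_riesz[OF exponents ind radially_decreasing_indicator]]) simp
    finally show ?thesis using \<omega> by (simp add: mult_left_mono)
  qed
  show ?thesis
  proof (rule that[of "\<delta> / 2"], goal_cases)
    case 1
    show "\<delta> / 2 > 0" using \<delta>(1) by simp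
  next
    case 2
    show ?case
    proof (intro allI impI)
      fix u v x assume uv: "admissible u" "admissible v" "\<forall>y. norm y < 1 \<longrightarrow> \<bar>u y - v y\<bar> \<le> \<delta> / 2"
      define A B A' B' where AB: "A = \<epsilon> + riesz a (src 1 u) x" "B = \<epsilon> + riesz a (src 1 u) 0"
        "A' = \<epsilon> + riesz a (src 1 v) x" "B' = \<epsilon> + riesz a (src 1 v) 0"
      have d: "\<bar>riesz a (src 1 u) y - riesz a (src 1 v) y\<bar> \<le> \<omega> * K" for y
        using half[of u v y] half[of v u y] uv by (simp add: abs_minus_commute abs_le_iff)
      have B: "B \<ge> \<epsilon>" "B' \<ge> \<epsilon>" "A' \<ge> 0" using riesz_src_nonneg \<epsilon> by (auto simp: AB add_nonneg_nonneg)
      have q: "0 \<le> A' / B'" "A' / B' \<le> 1"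
        using Phi_pos[of v x] Phi_admissible[OF uv(2)] by (auto simp: AB Phi_def admissible_def)
      have "Phi u x - Phi v x = (A - A') / B + A' / B' * ((B' - B) / B)"
        using B \<epsilon> by (simp add: Phi_def AB[symmetric] field_simps)
      also have "\<bar>\<dots>\<bar> \<le> \<bar>A - A'\<bar> / B + A' / B' * (\<bar>B' - B\<bar> / B)"
        using B q \<epsilon> by (intro order_trans[OF abs_triangle_ineq]) (simp add: abs_mult)
      also have "\<dots> \<le> \<omega> * K / \<epsilon> + 1 * (\<omega> * K / \<epsilon>)"
        using d[of x] d[of 0] B q \<epsilon> K0 \<omega>
        by (intro add_mono mult_mono frac_le) (auto simp: AB abs_minus_commute)
      also have "\<omega> * K / \<epsilon> = \<eta> * (K / (K + 1)) / 2"
      proof -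
        have "\<eta> * \<epsilon> / (2 * L) * K / \<epsilon> = \<eta> * (K / L) / 2" if "L > 0" for L :: real
          using that \<epsilon> by (simp add: field_simps)
        then show ?thesis unfolding \<omega>_def using K0 \<epsilon> by simp
      qed
      also have "\<eta> * (K / (K + 1)) / 2 + 1 * (\<eta> * (K / (K + 1)) / 2) = \<eta> * (K / (K + 1))" by linarith
      also have "\<dots> \<le> \<eta> * 1" using assms K0 by (intro mult_left_mono) auto
      finally show "\<bar>Phi u x - Phi v x\<bar> \<le> \<eta>" by simp
    qed
  qed
qed

text \<open>The coefficients are an approximate fixed point for the values at the inner radii i/N of
  the shells. A point of a shell lies up to 1/N further out, hence the shift in the upper estimate;
  the lower one holds at the same point by monotonicity.\<close>

lemma Phi_approx_fixed_point:
  assumes N: "N > 0"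
  obtains u where "admissible u" "\<And>e r. norm e = 1 \<Longrightarrow> 0 \<le> r \<Longrightarrow> continuous (at_right r) (\<lambda>r. u (r *\<^sub>R e))"
    "\<And>x. norm x < 1 \<Longrightarrow> Phi u x - 1 / real N \<le> u x"
    "\<And>x y. norm x < 1 \<Longrightarrow> norm y \<le> norm x - 1 / real N \<Longrightarrow> u x \<le> Phi u y + 1 / real N"
proof -
  obtain e :: 'a where e: "norm e = 1" using vector_choose_size[of 1] by auto
  define F where "F c i = Phi (step_profile N c) ((real i / real N) *\<^sub>R e)" for c i
  let ?Q = "{c :: nat \<Rightarrow> real. \<forall>i<N. 0 \<le> c i \<and> c i \<le> 1}"
  have adm: "admissible (step_profile N c)" if "c \<in> ?Q" for c
    using that by (intro admissible_step_profile[OF N]) auto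
  have "\<exists>c\<in>?Q. \<forall>i<N. \<bar>F c i - c i\<bar> \<le> 1 / real N"
  proof (rule cube_approx_fixed_point)
    show "F c \<in> ?Q" if "c \<in> ?Q" for c
      using Phi_admissible[OF adm[OF that]] by (auto simp: F_def admissible_def)
    fix \<eta> :: real assume "\<eta> > 0"
    then obtain \<delta> where \<delta>: "\<delta> > 0" "\<forall>u v x. admissible u \<longrightarrow> admissible v \<longrightarrow>
        (\<forall>y. norm y < 1 \<longrightarrow> \<bar>u y - v y\<bar> \<le> \<delta>) \<longrightarrow> \<bar>Phi u x - Phi v x\<bar> \<le> \<eta>"
      by (rule Phi_uniformly_continuous)
    show "\<exists>\<delta>>0. \<forall>c\<in>?Q. \<forall>d\<in>?Q. (\<forall>j<N. \<bar>c j - d j\<bar> \<le> \<delta>) \<longrightarrow> (\<forall>i<N. \<bar>F c i - F d i\<bar> \<le> \<eta>)"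
    proof (intro exI[of _ \<delta>] conjI ballI impI allI \<delta>(1))
      fix c d i assume cd: "c \<in> ?Q" "d \<in> ?Q" "\<forall>j<N. \<bar>c j - d j\<bar> \<le> \<delta>"
      show "\<bar>F c i - F d i\<bar> \<le> \<eta>" unfolding F_def
      proof (rule \<delta>(2)[rule_format, OF adm adm])
        fix y :: 'a assume y: "norm y < 1"
        then show "\<bar>step_profile N c y - step_profile N d y\<bar> \<le> \<delta>"
          using cd(3) step_index(1)[OF N norm_ge_zero y]
          by (auto simp: step_profile_def intro!: abs_Min_diff_le)
      qed (use cd in auto)
    qed
  qed (use N in simp)
  then obtain c where c: "c \<in> ?Q" "\<And>i. i < N \<Longrightarrow> \<bar>F c i - c i\<bar> \<le> 1 / real N" by blast
  let ?u = "step_profile N c"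
  note dec = radially_decreasingD[OF Phi_radially_decreasing[OF adm[OF c(1)]]]
  show ?thesis
  proof (rule that[of ?u])
    show "admissible ?u" by (rule adm[OF c(1)])
    show "continuous (at_right r) (\<lambda>r. ?u (r *\<^sub>R e))" if "norm e = 1" "0 \<le> r" for e :: 'a and r
      by (rule step_profile_rcont[OF that])
    fix x :: 'a assume x: "norm x < 1"
    define i where "i = nat \<lfloor>real N * norm x\<rfloor>"
    have i: "i < N" "real i \<le> real N * norm x" "real N * norm x < real i + 1"
      unfolding i_def by (rule step_index[OF N norm_ge_zero x])+
    have ux: "?u x = Min (c ` {..i})" using x by (simp add: step_profile_def i_def)
    \<comment> \<open>The bound holds for all coefficients further inside as well, because
      \<open>Phi ?u\<close> decreases; thus it survives the running minimum.\<close>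
    have "Phi ?u x - 1 / real N \<le> c j" if "j \<le> i" for j
    proof -
      have "real j \<le> real N * norm x" using that i(2) by simp
      then have "Phi ?u x \<le> F c j"
        unfolding F_def using N by (intro dec) (simp add: e field_simps)
      with c(2)[of j] that i(1) show ?thesis by (simp add: abs_le_iff)
    qed
    then show "Phi ?u x - 1 / real N \<le> ?u x" unfolding ux by (subst Min_ge_iff) auto
    fix y :: 'a assume y: "norm y \<le> norm x - 1 / real N"
    have "?u x \<le> c i" unfolding ux by (rule Min_le) auto
    also have "c i \<le> F c i + 1 / real N" using c(2)[OF i(1)] by (simp add: abs_le_iff)
    also have "F c i \<le> Phi ?u y"
      unfolding F_def
    proof (rule dec)
      have "norm x \<le> (real i + 1) / real N" using i(3) N by (simp add: field_simps)
      with y show "norm y \<le> norm ((real i / real N) *\<^sub>R e)" by (simp add: e add_divide_distrib)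
    qed
    finally show "?u x \<le> Phi ?u y + 1 / real N" by simp
  qed
qed

text \<open>The Helly limit G is a fixed point only almost everywhere in the ball. Since sources
  ignore null sets, \<open>Phi G\<close> is a fixed point everywhere.\<close>

lemma Phi_fixed_point:
  obtains u where "admissible u" "\<And>x. u x = Phi u x"
proof -
  let ?P = "\<lambda>N u. admissible u \<and> (\<forall>e r. norm e = 1 \<longrightarrow> 0 \<le> r \<longrightarrow> continuous (at_right r) (\<lambda>r. u (r *\<^sub>R e)))
    \<and> (\<forall>x. norm x < 1 \<longrightarrow> Phi u x - 1 / real (Suc N) \<le> u x)
    \<and> (\<forall>x y. norm x < 1 \<longrightarrow> norm y \<le> norm x - 1 / real (Suc N) \<longrightarrow> u x \<le> Phi u y + 1 / real (Suc N))"
  have "\<forall>N. \<exists>u. ?P N u"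
  proof
    fix N :: nat
    show "\<exists>u. ?P N u" by (rule Phi_approx_fixed_point[OF zero_less_Suc[of N]]) blast
  qed
  then have "\<exists>u. \<forall>N. ?P N (u N)" by (rule choice)
  then obtain u where adm: "\<And>N. admissible (u N)"
    and rc: "\<And>N e r. norm e = 1 \<Longrightarrow> 0 \<le> r \<Longrightarrow> continuous (at_right r) (\<lambda>r. u N (r *\<^sub>R e))"
    and lower: "\<And>N x. norm x < 1 \<Longrightarrow> Phi (u N) x - 1 / real (Suc N) \<le> u N x"
    and upper: "\<And>N x y. norm x < 1 \<Longrightarrow> norm y \<le> norm x - 1 / real (Suc N) \<Longrightarrow> u N x \<le> Phi (u N) y + 1 / real (Suc N)"
    by metis
  have adm': "radially_decreasing (u N)" "0 \<le> u N x" "u N x \<le> 1" for N x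
    using adm[of N] by (auto simp: admissible_def)
  obtain s G where s: "strict_mono s" and G: "radially_decreasing G" "\<And>x. 0 \<le> G x" "\<And>x. G x \<le> 1"
    and lim: "AE x in lborel. (\<lambda>k. u (s k) x) \<longlonglongrightarrow> G x"
    by (rule radial_Helly_selection[of u, OF adm' rc]) (assumption, assumption, rule that)
  have admG: "admissible G" using G by (simp add: admissible_def)
  have Philim: "(\<lambda>k. Phi (u (s k)) x) \<longlonglongrightarrow> Phi G x" for x
    by (rule Phi_tendsto[OF adm admG lim])
  have inv0: "(\<lambda>k. 1 / real (Suc (s k))) \<longlonglongrightarrow> 0"
    using LIMSEQ_subseq_LIMSEQ[OF lim_1_over_real_power[of 0] s] LIMSEQ_subseq_LIMSEQ[OF LIMSEQ_inverse_real_of_nat s]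
    by (simp add: o_def inverse_eq_divide)
  have GPhi: "G x = Phi G x" if x: "norm x < 1" "x \<noteq> 0" and l: "(\<lambda>k. u (s k) x) \<longlonglongrightarrow> G x" for x
  proof (rule antisym)
    have "(\<lambda>k. Phi (u (s k)) x - 1 / real (Suc (s k))) \<longlonglongrightarrow> Phi G x - 0"
      by (intro tendsto_diff Philim inv0)
    then show "Phi G x \<le> G x"
      using LIMSEQ_le[OF _ l] lower[OF x(1)] by auto
    \<comment> \<open>For t < 1 the shift by the mesh width is eventually smaller than (1 - t) |x|,
      so the upper estimate applies at t x; continuity of \<open>Phi G\<close> then lets t tend to
      1.\<close>
    have le: "G x \<le> Phi G (t *\<^sub>R x)" if t: "0 < t" "t < 1" for t
    proof -
      have "(\<lambda>k. Phi (u (s k)) (t *\<^sub>R x) + 1 / real (Suc (s k))) \<longlonglongrightarrow> Phi G (t *\<^sub>R x) + 0"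
        by (intro tendsto_add Philim inv0)
      moreover have "\<forall>\<^sub>F k in sequentially. u (s k) x \<le> Phi (u (s k)) (t *\<^sub>R x) + 1 / real (Suc (s k))"
      proof -
        have "0 < (1 - t) * norm x" using t x by simp
        from order_tendstoD(2)[OF inv0 this] show ?thesis
        proof eventually_elim
          fix k assume "1 / real (Suc (s k)) < (1 - t) * norm x"
          then have "norm (t *\<^sub>R x) \<le> norm x - 1 / real (Suc (s k))" using t by (simp add: algebra_simps)
          then show "u (s k) x \<le> Phi (u (s k)) (t *\<^sub>R x) + 1 / real (Suc (s k))" by (rule upper[OF x(1)])
        qed
      qed
      ultimately show ?thesis using tendsto_le[OF sequentially_bot _ l] by auto
    qed
    have "((\<lambda>t. Phi G (t *\<^sub>R x)) \<longlongrightarrow> Phi G (1 *\<^sub>R x)) (at_left 1)"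
      by (rule isCont_tendsto_compose[OF isCont_Phi[OF admG]]) (intro tendsto_intros)
    then have "((\<lambda>t. Phi G (t *\<^sub>R x)) \<longlongrightarrow> Phi G x) (at_left 1)" by simp
    then show "G x \<le> Phi G x"
    proof (rule tendsto_lowerbound)
      show "\<forall>\<^sub>F t in at_left 1. G x \<le> Phi G (t *\<^sub>R x)"
        using eventually_at_left_real[of 0 1] by (auto elim!: eventually_mono intro: le)
    qed simp
  qed
  have "AE x in lborel. x \<in> ball 0 1 \<longrightarrow> Phi G x = G x"
    using lim AE_lborel_singleton[of 0] by eventually_elim (use GPhi in auto)
  then have "riesz a (src 1 (Phi G)) x = riesz a (src 1 G) x" for x
    by (rule riesz_src_cong_AE[OF Phi_admissible[OF admG] admG])
  then have "Phi G x = Phi (Phi G) x" for x by (simp add: Phi_def[of "Phi G"] Phi_def[of G])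
  with Phi_admissible[OF admG] show ?thesis by (rule that)
qed

end

end

section \<open>A dilation form of the Pohozaev identity\<close>

text \<open>Convexity gives the tangent only on the open half-line; the cases where x or y is 0 are
  direct, with \<open>0 powr q = 0\<close>.\<close>

lemma powr_above_tangent:
  fixes x y q :: real
  assumes q: "1 \<le> q" and "0 \<le> x" "0 \<le> y"
  shows "x powr q + q * x powr (q - 1) * (y - x) \<le> y powr q"
proof -
  consider "x = 0" | "y = 0" "x > 0" | "x > 0" "y > 0" using assms by linarith
  then show ?thesis
  proof cases
    case 2
    then have "x powr (q - 1) * x = x powr q" by (simp add: powr_diff)
    moreover have "x powr q \<le> q * x powr q" using q by (simp add: mult_le_cancel_right1)
    ultimately show ?thesis using 2 by (simp add: mult.assoc)
  next
    case 3
    have "y powr q - x powr q \<ge> q * x powr (q - 1) * (y - x)"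
      by (rule convex_on_imp_above_tangent[OF powr_convex[OF q]])
         (use 3 in \<open>auto simp: interior_open intro!: derivative_eq_intros\<close>)
    then show ?thesis by simp
  qed simp
qed

lemma lborel_Fubini:
  fixes F :: "'a::euclidean_space \<Rightarrow> 'a \<Rightarrow> real"
  assumes [measurable]: "case_prod F \<in> borel_measurable (borel \<Otimes>\<^sub>M borel)"
    and "\<And>x. integrable lborel (F x)" "integrable lborel (\<lambda>x. \<integral>y. \<bar>F x y\<bar> \<partial>lborel)"
  shows "integrable lborel (\<lambda>y. \<integral>x. F x y \<partial>lborel)"
    and "(\<integral>x. (\<integral>y. F x y \<partial>lborel) \<partial>lborel) = (\<integral>y. (\<integral>x. F x y \<partial>lborel) \<partial>lborel)"
proof -
  have int: "integrable (lborel \<Otimes>\<^sub>M lborel) (case_prod F)"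
    using assms(2,3) by (intro lborel_pair.Fubini_integrable) auto
  show "integrable lborel (\<lambda>y. \<integral>x. F x y \<partial>lborel)" by (rule lborel_pair.integrable_snd[OF int])
  show "(\<integral>x. (\<integral>y. F x y \<partial>lborel) \<partial>lborel) = (\<integral>y. (\<integral>x. F x y \<partial>lborel) \<partial>lborel)"
    using lborel_pair.Fubini_integral[OF int] by simp
qed

context lane_emden
begin

text \<open>Pohozaev's identity by dilation: with \<open>\<phi> t = \<integral> u\<^sup>p(x) u(t x) dx\<close> over the ball, symmetry of the
  kernel gives \<open>\<phi> (1/t) = t\<^sup>a \<phi> t\<close>, and convexity of the power bounds the one-sided difference
  quotients of \<open>\<phi>\<close> at \<open>1\<close>; no differentiability of \<open>u\<close> is needed.\<close>

context
  fixes u :: "'a \<Rightarrow> real" and c :: real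
  assumes adm: "admissible u" and c: "c > 0" and eq: "\<And>x. u x = c * riesz a (src 1 u) x" and u0: "u 0 > 0"
begin

lemma isCont_u: "isCont u x"
proof -
  have "isCont (\<lambda>x. c * riesz a (src 1 u) x) x"
    by (intro isCont_mult continuous_const isCont_riesz_src adm)
  moreover have "(\<lambda>x. c * riesz a (src 1 u) x) = u" using eq by (intro ext) (rule sym)
  ultimately show ?thesis by (simp only:)
qed

lemma u_measurable: "u \<in> borel_measurable borel"
  using adm by (auto simp: admissible_def intro: radially_decreasing_measurable)

lemma u_bounds: "0 \<le> u x" "u x \<le> 1"
  using adm by (auto simp: admissible_def)

lemma integrable_ball_times:
  fixes h :: "'a \<Rightarrow> real"
  assumes [measurable]: "h \<in> borel_measurable borel" and bd: "\<And>x::'a. \<bar>h x\<bar> \<le> K"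
  shows "integrable lborel (\<lambda>x. indicator (ball (0::'a) 1) x * h x)"
proof (rule Bochner_Integration.integrable_bound)
  show "integrable lborel (\<lambda>x::'a. indicator (ball (0::'a) 1) x * K)"
    by (intro integrable_mult_left) (auto simp: emeasure_ball)
  show "AE x in lborel. norm (indicator (ball (0::'a) 1) x * h x) \<le> norm (indicator (ball (0::'a) 1) x * K)"
    using bd by (intro AE_I2) (auto simp: indicator_def intro: order_trans[OF bd abs_ge_self])
  show "(\<lambda>x. indicator (ball (0::'a) 1) x * h x) \<in> borel_measurable lborel"
    by (intro borel_measurable_times borel_measurable_indicator) auto
qed

definition phi :: "real \<Rightarrow> real" where
  "phi t = (\<integral>x. src 1 u x * u (t *\<^sub>R x) \<partial>lborel)"

text \<open>This is \<open>phi 1\<close>, by \<open>u_powr_Suc\<close>.\<close>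

definition E :: real where
  "E = (\<integral>x. indicator (ball 0 1) x * u x powr (p + 1) \<partial>lborel)"

lemma u_powr_Suc: "u x powr p * u x = u x powr (p + 1)"
  using u_bounds[of x] by (cases "u x = 0") (auto simp: powr_add)

text \<open>If E were 0, the source would vanish almost everywhere, and so would the potential at
  the origin, against \<open>u 0 > 0\<close>.\<close>

lemma E_pos: "E > 0"
proof -
  note [measurable] = u_measurable
  have i: "integrable lborel (\<lambda>x. indicator (ball 0 1) x * u x powr (p + 1))"
    using u_bounds p by (intro integrable_ball_times[where K=1]) (auto intro: powr_le1)
  have "E \<noteq> 0"
  proof
    assume "E = 0"
    then have "AE x in lborel. indicator (ball 0 1) x * u x powr (p + 1) = 0"
      unfolding E_def using integral_nonneg_eq_0_iff_AE[OF i] by simp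
    then have "AE x in lborel. norm (0 - x) powr (-a) * src 1 u x = 0"
      by eventually_elim (auto simp: src_def indicator_def split: if_splits)
    then have "riesz a (src 1 u) 0 = 0" unfolding riesz_def by (intro integral_eq_zero_AE)
    with u0 eq[of 0] show False by simp
  qed
  moreover have "E \<ge> 0" unfolding E_def by (intro integral_nonneg_AE AE_I2) simp
  ultimately show ?thesis by simp
qed

text \<open>Exchange x and y by Fubini and use |t x - y| = t |y/t - x|. Differentiating at 1 would
  give formally phi' 1 = -(a/2) E, one half of Pohozaev's identity.\<close>

lemma phi_reflection:
  assumes t: "t > 0"
  shows "phi (1 / t) = t powr a * phi t"
proof -
  note [measurable] = u_measurable src_measurable[OF adm]
  let ?H = "\<lambda>t x y. norm (t *\<^sub>R x - y) powr (-a) * (src 1 u x * src 1 u y)"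
  have m: "(\<lambda>(x, y). norm (t *\<^sub>R x - y) powr (-a) * (src 1 u x * src 1 u y)) \<in> borel_measurable (borel \<Otimes>\<^sub>M borel)"
    by measurable
  have inner: "(\<integral>y. ?H s x y \<partial>lborel) = src 1 u x * riesz a (src 1 u) (s *\<^sub>R x)" for s and x :: 'a
  proof -
    have "(\<integral>y. ?H s x y \<partial>lborel)
      = (\<integral>y. src 1 u x * (norm (s *\<^sub>R x - y) powr (-a) * src 1 u y) \<partial>lborel)"
      by (intro Bochner_Integration.integral_cong) auto
    then show ?thesis by (simp add: riesz_def)
  qed
  have phi_eq: "phi s = c * (\<integral>x. src 1 u x * riesz a (src 1 u) (s *\<^sub>R x) \<partial>lborel)" for s
  proof -
    have "phi s = (\<integral>x. c * (src 1 u x * riesz a (src 1 u) (s *\<^sub>R x)) \<partial>lborel)"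
      unfolding phi_def by (intro Bochner_Integration.integral_cong refl) (subst eq, simp)
    then show ?thesis by simp
  qed
  have nn: "0 \<le> src 1 u x" for x by (rule src_bounds(1)[OF adm])
  have "(\<integral>x. (\<integral>y. ?H t x y \<partial>lborel) \<partial>lborel)
      = (\<integral>y. (\<integral>x. ?H t x y \<partial>lborel) \<partial>lborel)"
  proof (rule lborel_Fubini(2)[OF m])
    fix x
    have "integrable lborel (\<lambda>y. src 1 u x * (norm (t *\<^sub>R x - y) powr (-a) * src 1 u y))"
      by (rule integrable_mult_right[OF riesz_integrable[OF exponents src_measurable[OF adm] src_bounds(3)[OF adm]]])
    then show "integrable lborel (\<lambda>y. norm (t *\<^sub>R x - y) powr (-a) * (src 1 u x * src 1 u y))"
      by (simp add: mult.left_commute)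
  next
    have "integrable lborel (\<lambda>x. indicator (ball (0::'a) 1) x * (u x powr p * riesz a (src 1 u) (t *\<^sub>R x)))"
    proof (rule integrable_ball_times)
      show "\<bar>u x powr p * riesz a (src 1 u) (t *\<^sub>R x)\<bar> \<le> 1 * riesz a (src 1 u) 0" for x
        using u_bounds[of x] p riesz_src_nonneg[of 1 u] riesz_src_le_origin[OF adm]
        by (simp only: abs_mult) (intro mult_mono, auto intro: powr_le1)
      have "radially_decreasing (riesz a (src 1 u))" by (rule radially_decreasing_riesz_src[OF adm])
      note [measurable] = radially_decreasing_measurable[OF this]
      show "(\<lambda>x. u x powr p * riesz a (src 1 u) (t *\<^sub>R x)) \<in> borel_measurable borel" by measurable
    qed
    then have "integrable lborel (\<lambda>x. src 1 u x * riesz a (src 1 u) (t *\<^sub>R x))"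
      by (simp add: src_def[of 1 u] mult.assoc)
    then show "integrable lborel (\<lambda>x. \<integral>y. \<bar>?H t x y\<bar> \<partial>lborel)"
      using nn by (simp add: abs_mult inner)
  qed
  also have "\<dots> = (\<integral>y. t powr (-a) * (src 1 u y * riesz a (src 1 u) ((1 / t) *\<^sub>R y)) \<partial>lborel)"
  proof (intro Bochner_Integration.integral_cong refl)
    fix y :: 'a
    have k: "norm (t *\<^sub>R x - y) powr (-a) = t powr (-a) * norm ((1 / t) *\<^sub>R y - x) powr (-a)" for x
    proof -
      have "t *\<^sub>R x - y = - (t *\<^sub>R ((1 / t) *\<^sub>R y - x))" using t by (simp add: scaleR_right_diff_distrib)
      then have "norm (t *\<^sub>R x - y) = t * norm ((1 / t) *\<^sub>R y - x)"
        using t by (metis abs_of_pos norm_minus_cancel norm_scaleR)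
      then show ?thesis using t by (simp add: powr_mult)
    qed
    have "(\<integral>x. ?H t x y \<partial>lborel)
      = (\<integral>x. t powr (-a) * (norm ((1 / t) *\<^sub>R y - x) powr (-a) * (src 1 u y * src 1 u x)) \<partial>lborel)"
      unfolding k by (intro Bochner_Integration.integral_cong) auto
    also have "\<dots> = t powr (-a) * (src 1 u y * riesz a (src 1 u) ((1 / t) *\<^sub>R y))"
      unfolding inner[symmetric] by simp
    finally show "(\<integral>x. ?H t x y \<partial>lborel)
      = t powr (-a) * (src 1 u y * riesz a (src 1 u) ((1 / t) *\<^sub>R y))" .
  qed
  finally have "phi t = t powr (-a) * phi (1 / t)"
    unfolding inner by (simp add: phi_eq)
  then show ?thesis using t by (simp add: powr_minus field_simps)
qed

text \<open>Young's inequality, here a tangent inequality, separates u(x) from u(t x). To first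
  order the bound says phi' 1 is at least -(n/(p+1)) E.\<close>

lemma phi_le:
  assumes t: "0 < t" "t < 1"
  shows "phi t \<le> E + E * (t powr (- real DIM('a)) - 1) / (p + 1)"
proof -
  note [measurable] = u_measurable src_measurable[OF adm]
  let ?B = "ball (0::'a) 1"
  let ?h = "\<lambda>x. indicator ?B x * u (t *\<^sub>R x) powr (p + 1)"
  have i1: "integrable lborel (\<lambda>x. indicator ?B x * u x powr (p + 1))"
    using u_bounds p by (intro integrable_ball_times[where K=1]) (auto intro: powr_le1)
  have i2: "integrable lborel ?h"
    using u_bounds p by (intro integrable_ball_times[where K=1]) (auto intro: powr_le1)
  have "phi t \<le> (\<integral>x. p / (p + 1) * (indicator ?B x * u x powr (p + 1)) + 1 / (p + 1) * ?h x \<partial>lborel)"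
    unfolding phi_def
  proof (rule integral_mono)
    have "integrable lborel (\<lambda>x. indicator ?B x * (u x powr p * u (t *\<^sub>R x)))"
      using u_bounds p by (intro integrable_ball_times[where K=1]) (auto simp: abs_mult intro!: mult_le_one powr_le1)
    then show "integrable lborel (\<lambda>x. src 1 u x * u (t *\<^sub>R x))" by (simp add: src_def[of 1 u] mult.assoc)
    show "integrable lborel (\<lambda>x. p / (p + 1) * (indicator ?B x * u x powr (p + 1)) + 1 / (p + 1) * ?h x)"
      by (intro Bochner_Integration.integrable_add integrable_mult_right i1 i2)
    fix x
    have "u x powr (p + 1) + (p + 1) * u x powr p * (u (t *\<^sub>R x) - u x) \<le> u (t *\<^sub>R x) powr (p + 1)"
      using powr_above_tangent[of "p + 1" "u x" "u (t *\<^sub>R x)"] u_bounds p by simp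
    moreover have "(p + 1) * u x powr p * (u (t *\<^sub>R x) - u x) = (p + 1) * (u x powr p * u (t *\<^sub>R x)) - (p + 1) * u x powr (p + 1)"
      by (simp only: u_powr_Suc[symmetric] right_diff_distrib mult.assoc)
    moreover have "(p + 1) * u x powr (p + 1) = p * u x powr (p + 1) + u x powr (p + 1)"
      by (simp add: distrib_right)
    ultimately have "(p + 1) * (u x powr p * u (t *\<^sub>R x)) \<le> p * u x powr (p + 1) + u (t *\<^sub>R x) powr (p + 1)"
      by linarith
    then have "u x powr p * u (t *\<^sub>R x) \<le> (p * u x powr (p + 1) + u (t *\<^sub>R x) powr (p + 1)) / (p + 1)"
      using p by (simp add: pos_le_divide_eq mult.commute)
    then have "u x powr p * u (t *\<^sub>R x) \<le> p / (p + 1) * u x powr (p + 1) + 1 / (p + 1) * u (t *\<^sub>R x) powr (p + 1)"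
      by (simp add: add_divide_distrib)
    then show "src 1 u x * u (t *\<^sub>R x) \<le> p / (p + 1) * (indicator ?B x * u x powr (p + 1)) + 1 / (p + 1) * ?h x"
      by (auto simp: src_def indicator_def)
  qed
  also have "\<dots> = p / (p + 1) * E + 1 / (p + 1) * (\<integral>x. ?h x \<partial>lborel)"
    by (subst Bochner_Integration.integral_add) (auto simp: E_def intro!: integrable_mult_right i1 i2)
  \<comment> \<open>Rescaling turns the integral into one over the ball of radius t < 1; enlarging
    it to the unit ball discards the boundary term of Pohozaev's identity, with the right
    sign.\<close>
  also have "(\<integral>x. ?h x \<partial>lborel) \<le> t powr (- real DIM('a)) * E"
  proof -
    have "(\<integral>x. ?h x \<partial>lborel) = \<bar>1 / t\<bar> ^ DIM('a) * (\<integral>x. ?h (0 + (1 / t) *\<^sub>R x) \<partial>lborel)"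
      using t by (intro integral_lborel_affine) simp
    also have "(\<integral>x. ?h (0 + (1 / t) *\<^sub>R x) \<partial>lborel) \<le> E"
      unfolding E_def
    proof (rule integral_mono[OF _ i1])
      show "integrable lborel (\<lambda>x. ?h (0 + (1 / t) *\<^sub>R x))" using t by (intro integrable_lborel_affine i2) simp
      fix x :: 'a
      have "norm x < 1" if "\<bar>1 / t\<bar> * norm x < 1"
      proof -
        have "norm x < t" using that t by (simp add: field_simps)
        with t show ?thesis by simp
      qed
      then show "?h (0 + (1 / t) *\<^sub>R x) \<le> indicator ?B x * u x powr (p + 1)"
        using t by (auto simp: indicator_def)
    qed
    also have "\<bar>1 / t\<bar> ^ DIM('a) = t powr (- real DIM('a))"
      using t by (simp add: powr_minus powr_realpow power_one_over field_simps)
    finally show ?thesis by (simp add: mult_left_mono)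
  qed
  finally have "phi t \<le> p / (p + 1) * E + 1 / (p + 1) * (t powr (- real DIM('a)) * E)"
    using p by (simp add: divide_right_mono)
  also have "p / (p + 1) = 1 - 1 / (p + 1)" using p by (simp add: field_simps)
  also have "(1 - 1 / (p + 1)) * E + 1 / (p + 1) * (t powr (- real DIM('a)) * E)
      = E + E * (t powr (- real DIM('a)) - 1) / (p + 1)"
    by (simp add: left_diff_distrib right_diff_distrib diff_divide_distrib mult.commute)
  finally show ?thesis .
qed

text \<open>Young's inequality points the wrong way here, so the tangent is taken at v = u(x/t).
  Replacing v^p by u^p costs at most \<omega> (u - v), and the integral of u - v is itself of order
  1 - t, so the cost is negligible to first order as \<omega> tends to 0.\<close>

lemma phi_ge:
  assumes t: "0 < t" "t < 1"
    and \<omega>: "\<And>x. norm x < 1 \<Longrightarrow> u x powr p - u ((1 / t) *\<^sub>R x) powr p \<le> \<omega>"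
  shows "E - phi (1 / t) \<le> (E / (p + 1) + \<omega> * (\<integral>x. indicator (ball 0 1) x * u x \<partial>lborel)) * (1 - t powr DIM('a))"
proof -
  note [measurable] = u_measurable src_measurable[OF adm]
  let ?B = "ball (0::'a) 1" and ?v = "\<lambda>x. u ((1 / t) *\<^sub>R x)"
  define I where "I = (\<integral>x. indicator ?B x * u x \<partial>lborel)"
  have \<omega>0: "0 \<le> \<omega>" using \<omega>[of 0] by simp
  have i1: "integrable lborel (\<lambda>x. indicator ?B x * u x powr (p + 1))"
    and i2: "integrable lborel (\<lambda>x. indicator ?B x * ?v x powr (p + 1))"
    and i3: "integrable lborel (\<lambda>x. indicator ?B x * u x)"
    and i4: "integrable lborel (\<lambda>x. indicator ?B x * ?v x)"
    and i5: "integrable lborel (\<lambda>x. indicator ?B x * (u x powr p * ?v x))"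
    using u_bounds p by (auto intro!: integrable_ball_times[where K=1] powr_le1 mult_le_one simp: abs_mult)
  \<comment> \<open>Rescaling produces the ball of radius 1/t > 1, which contains the unit ball;
    nonnegativity of g gives the inequality.\<close>
  have dil: "t powr DIM('a) * (\<integral>x. indicator ?B x * g x \<partial>lborel) \<le> (\<integral>x. indicator ?B x * g ((1 / t) *\<^sub>R x) \<partial>lborel)"
    if g: "\<And>x. 0 \<le> g x" and ig: "integrable lborel (\<lambda>x. indicator ?B x * g x)"
      "integrable lborel (\<lambda>x. indicator ?B x * g ((1 / t) *\<^sub>R x))" for g :: "'a \<Rightarrow> real"
  proof -
    have eq: "(\<integral>x. indicator ?B x * g ((1 / t) *\<^sub>R x) \<partial>lborel)
      = \<bar>t\<bar> ^ DIM('a) * (\<integral>x. indicator ?B (0 + t *\<^sub>R x) * g ((1 / t) *\<^sub>R (0 + t *\<^sub>R x)) \<partial>lborel)"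
      using t by (intro integral_lborel_affine) simp
    have le: "(\<integral>x. indicator ?B x * g x \<partial>lborel) \<le> (\<integral>x. indicator ?B (0 + t *\<^sub>R x) * g ((1 / t) *\<^sub>R (0 + t *\<^sub>R x)) \<partial>lborel)"
    proof (rule integral_mono[OF ig(1)])
      show "integrable lborel (\<lambda>x. indicator ?B (0 + t *\<^sub>R x) * g ((1 / t) *\<^sub>R (0 + t *\<^sub>R x)))"
        using integrable_lborel_affine[OF ig(2), of t 0] t by simp
      fix x :: 'a
      have "t * norm x < 1" if "norm x < 1"
        using mult_right_mono[of t 1 "norm x"] t that by simp
      then show "indicator ?B x * g x \<le> indicator ?B (0 + t *\<^sub>R x) * g ((1 / t) *\<^sub>R (0 + t *\<^sub>R x))"
        using t g by (auto simp: indicator_def)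
    qed
    show ?thesis unfolding eq using mult_left_mono[OF le, of "t ^ DIM('a)"] t by (simp only: powr_realpow abs_of_pos) simp
  qed
  have "E - phi (1 / t) = (\<integral>x. indicator ?B x * u x powr (p + 1) - indicator ?B x * (u x powr p * ?v x) \<partial>lborel)"
    using i1 i5 by (simp add: E_def phi_def src_def mult.assoc)
  also have "\<dots> \<le> (\<integral>x. 1 / (p + 1) * (indicator ?B x * u x powr (p + 1) - indicator ?B x * ?v x powr (p + 1))
      + \<omega> * (indicator ?B x * u x - indicator ?B x * ?v x) \<partial>lborel)"
  proof (rule integral_mono)
    show "integrable lborel (\<lambda>x. indicator ?B x * u x powr (p + 1) - indicator ?B x * (u x powr p * ?v x))"
      by (intro Bochner_Integration.integrable_diff i1 i5)
    show "integrable lborel (\<lambda>x. 1 / (p + 1) * (indicator ?B x * u x powr (p + 1) - indicator ?B x * ?v x powr (p + 1))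
      + \<omega> * (indicator ?B x * u x - indicator ?B x * ?v x))"
      by (intro Bochner_Integration.integrable_add integrable_mult_right Bochner_Integration.integrable_diff i1 i2 i3 i4)
    fix x :: 'a
    have vu: "?v x \<le> u x"
    proof (rule radially_decreasingD[of u])
      show "radially_decreasing u" using adm by (simp add: admissible_def)
      have "t * norm x \<le> 1 * norm x" using t by (intro mult_right_mono) auto
      then show "norm x \<le> norm ((1 / t) *\<^sub>R x)" using t by (simp add: field_simps)
    qed
    have tan: "?v x powr (p + 1) + (p + 1) * ?v x powr p * (u x - ?v x) \<le> u x powr (p + 1)"
      using powr_above_tangent[of "p + 1" "?v x" "u x"] u_bounds p by simp
    then have f1: "?v x powr p * (u x - ?v x) \<le> 1 / (p + 1) * (u x powr (p + 1) - ?v x powr (p + 1))"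
      using p by (simp add: field_simps)
    have f2: "(u x powr p - ?v x powr p) * (u x - ?v x) \<le> \<omega> * (u x - ?v x)" if "norm x < 1"
      using \<omega>[OF that] vu by (intro mult_right_mono) auto
    have f3: "u x powr (p + 1) - u x powr p * ?v x
       = ?v x powr p * (u x - ?v x) + (u x powr p - ?v x powr p) * (u x - ?v x)"
      by (simp only: u_powr_Suc[symmetric] left_diff_distrib right_diff_distrib)
    show "indicator ?B x * u x powr (p + 1) - indicator ?B x * (u x powr p * ?v x)
       \<le> 1 / (p + 1) * (indicator ?B x * u x powr (p + 1) - indicator ?B x * ?v x powr (p + 1))
      + \<omega> * (indicator ?B x * u x - indicator ?B x * ?v x)"
    proof (cases "norm x < 1")
      case True
      then have "indicator ?B x = (1::real)" by simp
      with f1 f2[OF True] f3 show ?thesis by (simp only: mult_1_left)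
    qed simp
  qed
  also have "\<dots> = 1 / (p + 1) * (E - (\<integral>x. indicator ?B x * ?v x powr (p + 1) \<partial>lborel))
      + \<omega> * (I - (\<integral>x. indicator ?B x * ?v x \<partial>lborel))"
    unfolding E_def I_def Bochner_Integration.integral_diff[OF i1 i2, symmetric]
      Bochner_Integration.integral_diff[OF i3 i4, symmetric] integral_mult_right_zero[symmetric]
    by (intro Bochner_Integration.integral_add integrable_mult_right Bochner_Integration.integrable_diff i1 i2 i3 i4)
  also have "\<dots> \<le> 1 / (p + 1) * (E - t powr DIM('a) * E) + \<omega> * (I - t powr DIM('a) * I)"
  proof (intro add_mono mult_left_mono diff_left_mono)
    show "t powr DIM('a) * E \<le> (\<integral>x. indicator ?B x * ?v x powr (p + 1) \<partial>lborel)"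
      unfolding E_def using dil[of "\<lambda>x. u x powr (p + 1)", OF _ i1 i2] by simp
    show "t powr DIM('a) * I \<le> (\<integral>x. indicator ?B x * ?v x \<partial>lborel)"
      unfolding I_def by (rule dil[of u, OF u_bounds(1) i3 i4])
  qed (use p \<omega>0 in auto)
  also have "\<dots> = (E / (p + 1) + \<omega> * I) * (1 - t powr DIM('a))"
    by (simp add: algebra_simps diff_divide_distrib)
  finally show ?thesis by (simp add: I_def)
qed

text \<open>The two estimates for \<open>phi (1 / t)\<close> are joined by
  \<open>phi_reflection\<close>. Both sides agree at t = 1, so their derivatives there must be
  ordered, and this is the inequality between a and 2n/(p+1).\<close>

lemma ball_solution_subcritical: "a \<le> 2 * real DIM('a) / (p + 1)"
proof (rule ccontr)
  assume "\<not> a \<le> 2 * real DIM('a) / (p + 1)"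
  then have super: "2 * real DIM('a) / (p + 1) < a" by simp
  define I where "I = (\<integral>x. indicator (ball 0 1) x * u x \<partial>lborel)"
  have I0: "I \<ge> 0" unfolding I_def using u_bounds by (intro integral_nonneg_AE AE_I2) simp
  define n where "n = real DIM('a)"
  have n: "n > 0" by (simp add: n_def)
  define gap where "gap = (a - 2 * n / (p + 1)) * E"
  have gap: "gap > 0" using super E_pos by (simp add: gap_def n_def)
  define L where "L = n * I + 1"
  \<comment> \<open>Keeps the error \<omega> n I at no more than half of \<open>gap\<close>; the 1
    in L rules out division by 0.\<close>
  define \<omega> where "\<omega> = gap / (2 * L)"
  have nI: "n * I \<ge> 0" using n I0 by simp
  have \<omega>: "\<omega> > 0" using gap nI by (simp add: \<omega>_def L_def)
  have "\<omega> * n * I = gap * (n * I / L) / 2"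
    by (simp add: \<omega>_def)
  also have "\<dots> \<le> gap * 1 / 2" using gap nI by (intro divide_right_mono mult_left_mono) (auto simp: L_def)
  finally have \<omega>gap: "\<omega> * n * I < gap" using gap by simp
  have "uniformly_continuous_on (cball (0::'a) 2) (\<lambda>x. u x powr p)"
    by (intro compact_uniformly_continuous continuous_on_powr' continuous_intros continuous_at_imp_continuous_on ballI isCont_u)
       (use p u_bounds in auto)
  then obtain \<delta> where \<delta>: "\<delta> > 0" "\<And>x y. x \<in> cball 0 2 \<Longrightarrow> y \<in> cball (0::'a) 2 \<Longrightarrow> dist y x < \<delta> \<Longrightarrow> dist (u y powr p) (u x powr p) < \<omega>"
    using \<omega> unfolding uniformly_continuous_on_def by meson
  define c1 c2 where "c1 = E / (p + 1) + \<omega> * I" and "c2 = E / (p + 1)"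
  \<comment> \<open>Upper minus lower estimate: nonnegative for t slightly below 1 and 0 at t = 1.
    In the supercritical case its derivative at 1 is positive, which forces negative values to the
    left.\<close>
  define G where "G t = c1 * (1 - t powr n) + t powr a * (c2 * (t powr (-n) - 1)) - E * (1 - t powr a)" for t
  have "DERIV G 1 :> c1 * (- n) + c2 * (- n) + E * a"
    unfolding G_def by (auto intro!: derivative_eq_intros simp: algebra_simps)
  moreover have "c1 * (- n) + c2 * (- n) + E * a = gap - \<omega> * n * I"
    by (simp add: gap_def c1_def c2_def algebra_simps)
  ultimately have "DERIV G 1 :> gap - \<omega> * n * I" by simp
  from DERIV_pos_inc_left[OF this] \<omega>gap obtain d where d: "d > 0" "\<And>h. h > 0 \<Longrightarrow> h < d \<Longrightarrow> G (1 - h) < G 1"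
    by auto
  \<comment> \<open>The three bounds put t in the range where G is increasing towards 1, keep x/t
    inside the ball of radius 2, and make |x - x/t| at most 2h < \<delta>.\<close>
  define h where "h = min (d / 2) (min (1 / 2) (\<delta> / 4))"
  define t where "t = 1 - h"
  have h: "0 < h" "h < d" "h \<le> 1 / 2" "h \<le> \<delta> / 4" using d(1) \<delta>(1) by (auto simp: h_def)
  have t: "0 < t" "t < 1" "1 / 2 \<le> t" using h by (auto simp: t_def)
  have inv: "1 / t \<le> 2" "1 / t - 1 \<le> 2 * h" "1 / t - 1 \<ge> 0" using t h by (auto simp: field_simps t_def)
  have "E - phi (1 / t) \<le> c1 * (1 - t powr n)"
    unfolding c1_def I_def n_def
  proof (rule phi_ge[OF t(1,2)])
    fix x :: 'a assume x: "norm x < 1"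
    have "dist x ((1 / t) *\<^sub>R x) = norm ((1 - 1 / t) *\<^sub>R x)" by (simp add: dist_norm scaleR_left_diff_distrib)
    also have "\<dots> = (1 / t - 1) * norm x" using inv(3) by simp
    also have "\<dots> \<le> (1 / t - 1) * 1" using inv(3) x by (intro mult_left_mono) auto
    also have "(1 / t - 1) * 1 \<le> 2 * h" using inv(2) by simp
    also have "2 * h < \<delta>" using h(4) \<delta>(1) by linarith
    finally have "dist (u x powr p) (u ((1 / t) *\<^sub>R x) powr p) < \<omega>"
    proof (intro \<delta>(2))
      have "1 / t * norm x \<le> 2 * 1" using inv x t by (intro mult_mono) auto
      then show "(1 / t) *\<^sub>R x \<in> cball 0 2" using t by simp
    qed (use x in auto)
    then show "u x powr p - u ((1 / t) *\<^sub>R x) powr p \<le> \<omega>" by (simp add: dist_real_def)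
  qed
  moreover have "phi (1 / t) \<le> t powr a * (E + c2 * (t powr (- n) - 1))"
    unfolding phi_reflection[OF t(1)] n_def c2_def using phi_le[OF t(1,2)] by (intro mult_left_mono) auto
  moreover have "t powr a * (E + c2 * (t powr (- n) - 1)) = E * t powr a + t powr a * (c2 * (t powr (- n) - 1))"
    by (simp add: distrib_left)
  moreover have "E * (1 - t powr a) = E - E * t powr a" by (simp add: right_diff_distrib)
  ultimately have "G t \<ge> 0" unfolding G_def by linarith
  moreover have "G t < G 1" using d(2)[OF h(1,2)] by (simp add: t_def)
  moreover have "G 1 = 0" by (simp add: G_def)
  ultimately show False by simp
qed

end

end

section \<open>From large balls to an entire solution\<close>

context lane_emden
begin

text \<open>If the divisors stayed above \<delta> as \<epsilon> tends to 0, a limit would solve v =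
  c T v in the ball with finite c and v(0) = 1, which \<open>ball_solution_subcritical\<close>
  forbids.\<close>

lemma small_denominator:
  assumes super: "2 * real DIM('a) / (p + 1) < a" and \<delta>: "\<delta> > 0"
  obtains \<epsilon> u where "0 < \<epsilon>" "admissible u" "\<And>x. u x = Phi \<epsilon> u x" "\<epsilon> + riesz a (src 1 u) 0 < \<delta>"
proof (rule ccontr)
  assume neg: "\<not> thesis"
  define \<epsilon> where "\<epsilon> k = 1 / real (Suc k)" for k
  have \<epsilon>: "\<epsilon> k > 0" for k by (simp add: \<epsilon>_def)
  have "\<forall>k. \<exists>u. admissible u \<and> (\<forall>x. u x = Phi (\<epsilon> k) u x)" (is "\<forall>k. ?P k")
  proof
    fix k
    show "?P k" by (rule Phi_fixed_point[OF \<epsilon>[of k]]) blast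
  qed
  then have "\<exists>u. \<forall>k. admissible (u k) \<and> (\<forall>x. u k x = Phi (\<epsilon> k) (u k) x)" by (rule choice)
  then obtain u where adm: "\<And>k. admissible (u k)" and fix_u: "\<And>k x. u k x = Phi (\<epsilon> k) (u k) x"
    by blast
  have large: "\<delta> \<le> \<epsilon> k + riesz a (src 1 (u k)) 0" for k
    using neg that[OF \<epsilon> adm fix_u] not_less by blast
  have adm': "radially_decreasing (u k)" "0 \<le> u k x" "u k x \<le> 1" for k x
    using adm[of k] by (auto simp: admissible_def)
  have cont: "isCont (u k) x" for k x
  proof -
    have "u k = Phi (\<epsilon> k) (u k)" using fix_u by (intro ext)
    then show ?thesis using isCont_Phi[OF \<epsilon>[of k] adm[of k], of x] by (simp only:)
  qed
  obtain s G where s: "strict_mono s" and G: "radially_decreasing G" "\<And>x. 0 \<le> G x" "\<And>x. G x \<le> 1"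
    and lim: "AE x in lborel. (\<lambda>k. u (s k) x) \<longlonglongrightarrow> G x"
    by (rule radial_Helly_selection[of u, OF adm' continuous_at_right_ray[OF cont]]) (rule that)
  have admG: "admissible G" using G by (simp add: admissible_def)
  have Tlim: "(\<lambda>k. riesz a (src 1 (u (s k))) x) \<longlonglongrightarrow> riesz a (src 1 G) x" for x
    by (rule riesz_src_tendsto[OF adm admG lim])
  have \<epsilon>lim: "(\<lambda>k. \<epsilon> (s k)) \<longlonglongrightarrow> 0"
    using LIMSEQ_subseq_LIMSEQ[OF LIMSEQ_inverse_real_of_nat s]
    by (simp add: o_def inverse_eq_divide \<epsilon>_def)
  have den: "(\<lambda>k. \<epsilon> (s k) + riesz a (src 1 (u (s k))) x) \<longlonglongrightarrow> 0 + riesz a (src 1 G) x" for x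
    by (intro tendsto_add \<epsilon>lim Tlim)
  have pos: "riesz a (src 1 G) 0 > 0"
    using LIMSEQ_le_const[OF den[of 0], of \<delta>] large \<delta> by auto
  \<comment> \<open>Potentials converge at every point although the profiles converge only almost
    everywhere; the equation therefore supplies a representative of G that is a limit
    everywhere.\<close>
  define v where "v x = riesz a (src 1 G) x / riesz a (src 1 G) 0" for x
  have vlim: "(\<lambda>k. u (s k) x) \<longlonglongrightarrow> v x" for x
  proof -
    have "(\<lambda>k. Phi (\<epsilon> (s k)) (u (s k)) x) \<longlonglongrightarrow> (0 + riesz a (src 1 G) x) / (0 + riesz a (src 1 G) 0)"
      unfolding Phi_def[OF \<epsilon>] using pos by (intro tendsto_divide den) simp
    then show ?thesis by (simp add: v_def fix_u[symmetric])
  qed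
  have "radially_decreasing v"
    using radially_decreasing_riesz_src[OF admG, of 1] pos by (auto simp: v_def radially_decreasing_def divide_right_mono)
  moreover have "0 \<le> v x" "v x \<le> 1" for x
    using LIMSEQ_le_const[OF vlim[of x], of 0] LIMSEQ_le_const2[OF vlim[of x], of 1] adm' by auto
  ultimately have admv: "admissible v" by (simp add: admissible_def)
  have "AE x in lborel. x \<in> ball 0 1 \<longrightarrow> G x = v x"
    using lim by eventually_elim (use vlim LIMSEQ_unique in blast)
  then have "riesz a (src 1 G) x = riesz a (src 1 v) x" for x
    by (rule riesz_src_cong_AE[OF admG admv])
  then have "v x = 1 / riesz a (src 1 G) 0 * riesz a (src 1 v) x" for x by (simp add: v_def)
  from ball_solution_subcritical[OF admv _ this] pos have "a \<le> 2 * real DIM('a) / (p + 1)"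
    by (simp add: v_def)
  with super show False by simp
qed

lemma riesz_src_dilate:
  assumes "R > 0"
  shows "riesz a (src R u) x = R powr (DIM('a) - a) * riesz a (src 1 (\<lambda>y. u (R *\<^sub>R y))) ((1 / R) *\<^sub>R x)"
proof -
  have "riesz a (src R u) x = \<bar>R\<bar> ^ DIM('a) * (\<integral>y. norm (x - (0 + R *\<^sub>R y)) powr (-a) * src R u (0 + R *\<^sub>R y) \<partial>lborel)"
    unfolding riesz_def using assms by (intro integral_lborel_affine) simp
  also have "(\<integral>y. norm (x - (0 + R *\<^sub>R y)) powr (-a) * src R u (0 + R *\<^sub>R y) \<partial>lborel)
    = (\<integral>y. R powr (-a) * (norm ((1 / R) *\<^sub>R x - y) powr (-a) * src 1 (\<lambda>y. u (R *\<^sub>R y)) y) \<partial>lborel)"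
  proof (intro Bochner_Integration.integral_cong refl)
    fix y :: 'a
    have "x - (0 + R *\<^sub>R y) = R *\<^sub>R ((1 / R) *\<^sub>R x - y)" using assms by (simp add: scaleR_right_diff_distrib)
    then have "norm (x - (0 + R *\<^sub>R y)) powr (-a) = R powr (-a) * norm ((1 / R) *\<^sub>R x - y) powr (-a)"
      using assms by (simp only: norm_scaleR) (simp add: powr_mult)
    moreover have "src R u (0 + R *\<^sub>R y) = src 1 (\<lambda>y. u (R *\<^sub>R y)) y"
      using assms by (auto simp: src_def indicator_def)
    ultimately show "norm (x - (0 + R *\<^sub>R y)) powr (-a) * src R u (0 + R *\<^sub>R y)
      = R powr (-a) * (norm ((1 / R) *\<^sub>R x - y) powr (-a) * src 1 (\<lambda>y. u (R *\<^sub>R y)) y)" by simp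
  qed
  also have "\<dots> = R powr (-a) * riesz a (src 1 (\<lambda>y. u (R *\<^sub>R y))) ((1 / R) *\<^sub>R x)"
    by (simp add: riesz_def)
  also have "\<bar>R\<bar> ^ DIM('a) * (R powr (-a) * riesz a (src 1 (\<lambda>y. u (R *\<^sub>R y))) ((1 / R) *\<^sub>R x))
    = R powr (DIM('a) - a) * riesz a (src 1 (\<lambda>y. u (R *\<^sub>R y))) ((1 / R) *\<^sub>R x)"
    using assms by (simp add: powr_diff powr_minus powr_realpow divide_simps)
  finally show ?thesis .
qed

lemma large_ball_solution:
  assumes super: "2 * real DIM('a) / (p + 1) < a" and M: "M > 0"
  obtains R \<eta> v where "R > M" "0 \<le> \<eta>" "admissible v" "v 0 = 1" "\<And>x. isCont v x"
    "\<And>x. v x = \<eta> + riesz a (src R v) x"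
proof -
  have d: "real DIM('a) - a > 0" using a by simp
  obtain \<epsilon> u where \<epsilon>: "0 < \<epsilon>" and adm: "admissible u" and fix_u: "\<And>x. u x = Phi \<epsilon> u x"
    and small: "\<epsilon> + riesz a (src 1 u) 0 < M powr (- (DIM('a) - a))"
    by (rule small_denominator[OF super, of "M powr (- (DIM('a) - a))"]) (use M in auto)
  define D where "D = \<epsilon> + riesz a (src 1 u) 0"
  have D: "D > 0" unfolding D_def by (rule denominator_pos[OF \<epsilon>])
  \<comment> \<open>With R^(n-a) = 1/D the dilation absorbs the normalising divisor, so the rescaled
    equation has coefficient 1; a small D means a large R.\<close>
  define R where "R = D powr (- 1 / (DIM('a) - a))"
  have R: "R > 0" using D by (simp add: R_def)
  have RD: "R powr (DIM('a) - a) = 1 / D" 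
  proof -
    have "- 1 / (DIM('a) - a) * (DIM('a) - a) = - 1" using d by simp
    then show ?thesis using D by (simp only: R_def powr_powr) (simp add: powr_minus_divide)
  qed
  have "M powr (DIM('a) - a) < R powr (DIM('a) - a)"
    using small M D unfolding RD D_def[symmetric] powr_minus by (simp add: field_simps)
  then have RM: "R > M" using d R M by (meson not_less powr_mono2 less_imp_le)
  define v where "v x = u ((1 / R) *\<^sub>R x)" for x
  have u_eq: "u x = (\<epsilon> + riesz a (src 1 u) x) / D" for x
    by (subst fix_u) (simp add: Phi_def[OF \<epsilon>] D_def)
  have cu: "isCont u x" for x
  proof -
    have "u = Phi \<epsilon> u" using fix_u by (intro ext)
    then show ?thesis using isCont_Phi[OF \<epsilon> adm, of x] by (simp only:)
  qed
  show ?thesis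
  proof (rule that[of R "\<epsilon> / D" v])
    show "R > M" by (rule RM)
    show "0 \<le> \<epsilon> / D" using \<epsilon> D by simp
    show "admissible v" using adm R by (auto simp: admissible_def v_def radially_decreasing_def divide_right_mono)
    show "v 0 = 1" using fix_u[of 0] by (simp add: v_def Phi_origin[OF \<epsilon>])
    show "isCont v x" for x
      unfolding v_def by (intro continuous_at_compose[of x "\<lambda>x. (1 / R) *\<^sub>R x" u, unfolded o_def] cu continuous_intros)
    show "v x = \<epsilon> / D + riesz a (src R v) x" for x
      unfolding riesz_src_dilate[OF R] RD using R by (simp add: v_def u_eq[of "(1 / R) *\<^sub>R x"] add_divide_distrib)
  qed
qed

definition decay_rate :: real where "decay_rate = (DIM('a) - a) / (p - 1)"

text \<open>Obtained by solving v^(p-1) |B| 2^(-a) r^(n-a) <= 1 for v, where |B| is the volume of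
  the unit ball.\<close>

definition decay_const :: real where
  "decay_const = (2 powr a / unit_ball_vol DIM('a)) powr (1 / (p - 1))"

lemma decay_rate_pos: "decay_rate > 0"
  using a p by (simp add: decay_rate_def)

text \<open>On the ball of radius |x| the profile is at least v(x) and the kernel at least
  (2|x|)^(-a), so v(x) bounds v(x)^p times a multiple of |x|^(n-a). A general f covers both the
  truncated sources and the entire one, with the same constant.\<close>

lemma radial_decay:
  assumes adm: "admissible v" and x: "x \<noteq> 0" and f: "\<And>y. 0 \<le> f y" "\<And>y. norm y < norm x \<Longrightarrow> v y powr p \<le> f y"
    and int: "integrable lborel (\<lambda>y. norm (x - y) powr (-a) * f y)" and ge: "riesz a f x \<le> v x"
  shows "v x \<le> decay_const * norm x powr (- decay_rate)"
proof (cases "v x = 0")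
  case False
  with adm have vx: "v x > 0" by (auto simp: admissible_def less_le)
  define r where "r = norm x"
  have r: "r > 0" using x by (simp add: r_def)
  define w where "w = unit_ball_vol (real DIM('a))"
  have w: "w > 0" by (simp add: w_def)
  let ?K = "v x powr p * (2 * r) powr (-a)"
  have "?K * (w * r ^ DIM('a)) = (\<integral>y. ?K * indicator (ball (0::'a) r) y \<partial>lborel)"
    using r by (simp add: measure_def emeasure_ball w_def)
  also have "\<dots> \<le> riesz a f x"
    unfolding riesz_def
  proof (rule integral_mono_AE[OF _ int])
    show "integrable lborel (\<lambda>y. ?K * indicator (ball (0::'a) r) y)"
      by (intro integrable_mult_right) (auto simp: emeasure_ball r less_imp_le)
    show "AE y in lborel. ?K * indicator (ball 0 r) y \<le> norm (x - y) powr (-a) * f y"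
      using AE_lborel_singleton[of x]
    proof eventually_elim
      fix y assume yx: "y \<noteq> x"
      show "?K * indicator (ball 0 r) y \<le> norm (x - y) powr (-a) * f y"
      proof (cases "norm y < r")
        case True
        have "v x \<le> v y" using adm True by (auto simp: admissible_def r_def intro: radially_decreasingD)
        then have "v x powr p \<le> v y powr p" using p vx by (intro powr_mono2) auto
        also have "v y powr p \<le> f y" using True by (intro f(2)) (simp add: r_def)
        finally have "v x powr p \<le> f y" .
        moreover have "norm (x - y) \<le> 2 * r" using norm_triangle_ineq4[of x y] True by (simp add: r_def)
        then have "(2 * r) powr (-a) \<le> norm (x - y) powr (-a)" using a yx by (intro powr_mono2') auto
        ultimately have "v x powr p * (2 * r) powr (-a) \<le> f y * norm (x - y) powr (-a)"
          by (intro mult_mono) (use f in auto)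
        then show ?thesis using True by (simp add: mult.commute)
      qed (use f in simp)
    qed
  qed
  also note ge
  finally have "v x powr p * ((2 * r) powr (-a) * (w * r ^ DIM('a))) \<le> v x" by (simp add: mult.assoc)
  moreover have "(2 * r) powr (-a) * (w * r ^ DIM('a)) = w * 2 powr (-a) * r powr (DIM('a) - a)"
    using r by (simp add: powr_mult powr_diff powr_realpow powr_minus field_simps)
  moreover have "v x powr p = v x * v x powr (p - 1)" using vx by (simp add: powr_diff)
  ultimately have "v x * (v x powr (p - 1) * (w * 2 powr (-a) * r powr (DIM('a) - a))) \<le> v x * 1"
    by (simp add: mult.assoc)
  then have "v x powr (p - 1) * (w * 2 powr (-a) * r powr (DIM('a) - a)) \<le> 1"
    using vx by (simp only: mult_le_cancel_left_pos)
  have "v x powr (p - 1) \<le> 2 powr a / w * r powr (- (DIM('a) - a))"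
  proof -
    have "X \<le> c / w * inverse Y" if "X * (w * inverse c * Y) \<le> 1" "c > 0" "Y > 0" for X Y c :: real
      using that w by (simp add: field_simps)
    from this[of "v x powr (p - 1)" "2 powr a" "r powr (DIM('a) - a)"]
      \<open>v x powr (p - 1) * (w * 2 powr (-a) * r powr (DIM('a) - a)) \<le> 1\<close> r
    show ?thesis by (simp only: powr_minus) simp
  qed
  then have "(v x powr (p - 1)) powr (1 / (p - 1)) \<le> (2 powr a / w * r powr (- (DIM('a) - a))) powr (1 / (p - 1))"
    using p by (intro powr_mono2) auto
  also have "(v x powr (p - 1)) powr (1 / (p - 1)) = v x" using p vx by (simp add: powr_powr)
  also have "(2 powr a / w * r powr (- (DIM('a) - a))) powr (1 / (p - 1)) = decay_const * r powr (- decay_rate)"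
    using w by (subst powr_mult) (auto simp: decay_const_def decay_rate_def w_def powr_powr minus_divide_left)
  finally show ?thesis by (simp add: r_def)
qed (simp add: decay_const_def)

definition src_const :: real where
  "src_const = 2 powr (p * decay_rate) * max 1 (decay_const powr p)"

text \<open>Since p times the rate equals (n - a) plus the rate, sources decay fast enough for their
  potentials to converge on the whole space.\<close>

lemma src_exponents: "0 \<le> a" "a < DIM('a)" "DIM('a) < a + p * decay_rate"
proof -
  have "p * decay_rate = (DIM('a) - a) + decay_rate"
    using p by (simp add: decay_rate_def field_simps)
  then show "DIM('a) < a + p * decay_rate" using decay_rate_pos by simp
qed (use a in auto)

text \<open>Removes the singularity of the decay estimate at the origin: inside the unit ball t <= 1
  and 1 + |y| <= 2 are used, outside 1 + |y| <= 2 |y|.\<close>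

lemma decayed_power_bound:
  assumes "0 \<le> t" "t \<le> 1" "y \<noteq> 0 \<Longrightarrow> t \<le> decay_const * norm (y::'a) powr (- decay_rate)"
  shows "t powr p \<le> src_const * (1 + norm y) powr (- (p * decay_rate))"
proof -
  let ?b = "p * decay_rate"
  have b: "?b > 0" using p decay_rate_pos by simp
  have pos: "1 + norm y > 0" by (simp add: add_pos_nonneg)
  show ?thesis
  proof (cases "norm y \<le> 1")
    case True
    have "t powr p \<le> 1" using assms p by (intro powr_le1) auto
    also have "\<dots> \<le> 2 powr ?b * (1 + norm y) powr (- ?b)"
    proof -
      have "(1 + norm y) powr ?b \<le> 2 powr ?b" using True b by (intro powr_mono2) auto
      then show ?thesis using pos by (simp add: powr_minus field_simps)
    qed
    also have "\<dots> \<le> src_const * (1 + norm y) powr (- ?b)"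
      unfolding src_const_def by (intro mult_right_mono) auto
    finally show ?thesis .
  next
    case False
    then have y: "y \<noteq> 0" "norm y > 0" by auto
    have "t powr p \<le> (decay_const * norm y powr (- decay_rate)) powr p"
      using assms y p by (intro powr_mono2) auto
    also have "\<dots> = decay_const powr p * norm y powr (- ?b)"
      by (subst powr_mult) (auto simp: decay_const_def powr_powr mult.commute)
    also have "\<dots> \<le> decay_const powr p * (2 powr ?b * (1 + norm y) powr (- ?b))"
    proof (intro mult_left_mono)
      have "(1 + norm y) powr ?b \<le> (2 * norm y) powr ?b" using False b by (intro powr_mono2) auto
      then have "(1 + norm y) powr ?b \<le> 2 powr ?b * norm y powr ?b" by (simp add: powr_mult)
      moreover have "(1 + norm y) powr ?b > 0" "norm y powr ?b > 0"
        using y pos by (auto simp: order.strict_implies_not_eq)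
      moreover have "inverse N \<le> c * inverse A" if "A \<le> c * N" "A > 0" "N > 0" for A N c :: real
        using that by (simp add: field_simps)
      ultimately show "norm y powr (- ?b) \<le> 2 powr ?b * (1 + norm y) powr (- ?b)"
        unfolding powr_minus by blast
    qed simp
    also have "\<dots> \<le> max 1 (decay_const powr p) * (2 powr ?b * (1 + norm y) powr (- ?b))"
      by (intro mult_right_mono) auto
    also have "\<dots> = src_const * (1 + norm y) powr (- ?b)"
      by (simp only: src_const_def mult_ac)
    finally show ?thesis .
  qed
qed

lemma entire_solution:
  assumes super: "2 * real DIM('a) / (p + 1) < a"
  obtains V where "admissible V" "V 0 = 1" "\<And>x. V x = riesz a (\<lambda>y. V y powr p) x"
    "\<And>x. x \<noteq> 0 \<Longrightarrow> V x \<le> decay_const * norm x powr (- decay_rate)"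
    "\<And>y. V y powr p \<le> src_const * (1 + norm y) powr (- (p * decay_rate))"
proof -
  have "\<forall>k. \<exists>R \<eta> v. R > real (Suc k) \<and> 0 \<le> \<eta> \<and> admissible v \<and> v 0 = 1 \<and> (\<forall>x. isCont v x)
    \<and> (\<forall>x. v x = \<eta> + riesz a (src R v) x)"
    (is "\<forall>k. ?P k")
  proof
    fix k
    show "?P k" by (rule large_ball_solution[OF super, of "real (Suc k)"]) (simp, blast)
  qed
  then obtain R \<eta> v where R: "\<And>k. R k > real (Suc k)" and \<eta>: "\<And>k. 0 \<le> \<eta> k" and adm: "\<And>k. admissible (v k)"
    and v0: "\<And>k. v k 0 = 1" and cont: "\<And>k x. isCont (v k) x" and eq: "\<And>k x. v k x = \<eta> k + riesz a (src (R k) (v k)) x"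
    by metis
  have adm': "radially_decreasing (v k)" "0 \<le> v k x" "v k x \<le> 1" for k x
    using adm[of k] by (auto simp: admissible_def)
  obtain s G where s: "strict_mono s" and G: "radially_decreasing G" "\<And>x. 0 \<le> G x" "\<And>x. G x \<le> 1"
    and lim: "AE x in lborel. (\<lambda>k. v (s k) x) \<longlonglongrightarrow> G x"
    by (rule radial_Helly_selection[of v, OF adm' continuous_at_right_ray[OF cont]]) (rule that)
  note [measurable] = src_measurable[OF adm] radially_decreasing_measurable[OF G(1)]
  \<comment> \<open>The majorant is the same for all radii; this permits dominated convergence while
    the balls exhaust the space.\<close>
  have bound: "\<bar>src (R k) (v k) y\<bar> \<le> src_const * (1 + norm y) powr (- (p * decay_rate))" for k y
  proof (cases "norm y < R k")
    case True
    have "v k y powr p \<le> src_const * (1 + norm y) powr (- (p * decay_rate))"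
    proof (rule decayed_power_bound[OF adm'(2,3)])
      assume "y \<noteq> 0"
      then show "v k y \<le> decay_const * norm y powr (- decay_rate)"
      proof (rule radial_decay[OF adm _ src_bounds(1)[OF adm]])
        show "v k z powr p \<le> src (R k) (v k) z" if "norm z < norm y" for z
          using that True by (simp add: src_def)
        show "integrable lborel (\<lambda>z. norm (y - z) powr (-a) * src (R k) (v k) z)"
          by (rule riesz_integrable[OF exponents src_measurable[OF adm] src_bounds(3)[OF adm]])
        show "riesz a (src (R k) (v k)) y \<le> v k y" using eq[of k y] \<eta>[of k] by simp
      qed
    qed
    then show ?thesis using True by (simp add: src_def)
  next
    case False
    then show ?thesis by (simp add: src_def src_const_def)
  qed
  have Tlim: "(\<lambda>k. riesz a (src (R (s k)) (v (s k))) x) \<longlonglongrightarrow> riesz a (\<lambda>y. G y powr p) x" for x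
  proof (rule riesz_dominated_convergence[OF src_exponents _ _ bound])
    show "AE y in lborel. (\<lambda>k. src (R (s k)) (v (s k)) y) \<longlonglongrightarrow> G y powr p"
      using lim
    proof eventually_elim
      fix y assume "(\<lambda>k. v (s k) y) \<longlonglongrightarrow> G y"
      then have "(\<lambda>k. v (s k) y powr p) \<longlonglongrightarrow> G y powr p"
        by (rule tendsto_powr'[OF _ tendsto_const]) (use p adm' in auto)
      moreover have "\<forall>\<^sub>F k in sequentially. v (s k) y powr p = src (R (s k)) (v (s k)) y"
      proof -
        have "\<forall>\<^sub>F k in sequentially. norm y < real k"
          using filterlim_at_top_dense[THEN iffD1, OF filterlim_real_sequentially] by blast
        then show ?thesis
        proof eventually_elim
          fix k assume "norm y < real k"
          moreover have "real k \<le> real (s k)" using seq_suble[OF s] by simp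
          ultimately have "norm y < R (s k)" using R[of "s k"] by simp
          then show "v (s k) y powr p = src (R (s k)) (v (s k)) y" by (simp add: src_def)
        qed
      qed
      ultimately show "(\<lambda>k. src (R (s k)) (v (s k)) y) \<longlonglongrightarrow> G y powr p"
        by (rule Lim_transform_eventually)
    qed
  qed auto
  \<comment> \<open>At the origin every profile equals 1, so the additive constants are determined
    by the potentials and converge with them.\<close>
  define \<eta>0 where "\<eta>0 = 1 - riesz a (\<lambda>y. G y powr p) 0"
  have "\<eta> k = 1 - riesz a (src (R k) (v k)) 0" for k using eq[of k 0] v0 by simp
  then have \<eta>lim: "(\<lambda>k. \<eta> (s k)) \<longlonglongrightarrow> \<eta>0"
    unfolding \<eta>0_def by (simp only:) (intro tendsto_diff tendsto_const Tlim)
  \<comment> \<open>G is known only up to null sets. V is the pointwise limit everywhere and agrees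
    with G almost everywhere, hence has the same potential.\<close>
  define V where "V x = \<eta>0 + riesz a (\<lambda>y. G y powr p) x" for x
  have vlim: "(\<lambda>k. v (s k) x) \<longlonglongrightarrow> V x" for x
    unfolding V_def by (subst eq) (intro tendsto_add \<eta>lim Tlim)
  have "radially_decreasing V"
    unfolding radially_decreasing_def
    using LIMSEQ_le[OF vlim vlim] adm'(1) by (meson radially_decreasingD)
  moreover have V01: "0 \<le> V x" "V x \<le> 1" for x
    using LIMSEQ_le_const[OF vlim[of x], of 0] LIMSEQ_le_const2[OF vlim[of x], of 1] adm' by auto
  ultimately have admV: "admissible V" by (simp add: admissible_def)
  then have [measurable]: "V \<in> borel_measurable borel"
    by (auto simp: admissible_def intro: radially_decreasing_measurable)
  have GV: "AE x in lborel. G x = V x"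
    using lim by eventually_elim (use vlim LIMSEQ_unique in blast)
  have VeqG: "riesz a (\<lambda>y. G y powr p) x = riesz a (\<lambda>y. V y powr p) x" for x
    using GV by (intro riesz_cong_AE) auto
  have \<eta>0: "\<eta>0 \<ge> 0" using LIMSEQ_le_const[OF \<eta>lim] \<eta> by auto
  have bV: "V y powr p \<le> src_const * (1 + norm y) powr (- (p * decay_rate))" for y
  proof -
    have "(\<lambda>k. v (s k) y powr p) \<longlonglongrightarrow> V y powr p"
      by (rule tendsto_powr'[OF vlim tendsto_const]) (use p adm' in auto)
    moreover have "\<exists>N. \<forall>k\<ge>N. v (s k) y powr p \<le> src_const * (1 + norm y) powr (- (p * decay_rate))"
    proof -
      obtain N where N: "norm y < real N" using reals_Archimedean2 by blast
      have "v (s k) y powr p \<le> src_const * (1 + norm y) powr (- (p * decay_rate))" if "k \<ge> N" for k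
      proof -
        have "real k \<le> real (s k)" using seq_suble[OF s] by simp
        then have "norm y < R (s k)" using R[of "s k"] N that by simp
        then show ?thesis using bound[of "s k" y] by (simp add: src_def)
      qed
      then show ?thesis by blast
    qed
    ultimately show ?thesis by (rule LIMSEQ_le_const2)
  qed
  have decV: "V x \<le> decay_const * norm x powr (- decay_rate)" if "x \<noteq> 0" for x
  proof (rule radial_decay[OF admV that])
    show "integrable lborel (\<lambda>y. norm (x - y) powr (-a) * V y powr p)"
      by (rule riesz_integrable[OF src_exponents]) (use bV in auto)
    show "riesz a (\<lambda>y. V y powr p) x \<le> V x" using VeqG[of x] \<eta>0 by (simp add: V_def[of x])
  qed auto
  \<comment> \<open>A positive constant would be a lower bound for V at every point, against decay
    to 0 along a ray.\<close>
  have "\<eta>0 \<le> 0"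
  proof (rule ccontr)
    assume "\<not> \<eta>0 \<le> 0"
    then have pos: "\<eta>0 > 0" by simp
    obtain e :: 'a where e: "norm e = 1" using vector_choose_size[of 1] by auto
    have "((\<lambda>r. decay_const * r powr (- decay_rate)) \<longlongrightarrow> decay_const * 0) at_top"
      using decay_rate_pos by (intro tendsto_mult_left tendsto_neg_powr filterlim_ident) auto
    then have "\<forall>\<^sub>F r in at_top. decay_const * r powr (- decay_rate) < \<eta>0"
      using order_tendstoD(2) pos by fastforce
    then have "\<forall>\<^sub>F r in at_top. decay_const * r powr (- decay_rate) < \<eta>0 \<and> r > 0"
      using eventually_gt_at_top[of 0] by (rule eventually_conj)
    then obtain r where r: "decay_const * r powr (- decay_rate) < \<eta>0" "r > 0"
      using eventually_happens'[OF trivial_limit_at_top_linorder] by blast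
    have "0 \<le> riesz a (\<lambda>y. G y powr p) (r *\<^sub>R e)"
      unfolding riesz_def by (intro integral_nonneg_AE AE_I2) simp
    then have "\<eta>0 \<le> V (r *\<^sub>R e)" by (simp add: V_def)
    also have "\<dots> \<le> decay_const * norm (r *\<^sub>R e) powr (- decay_rate)"
      using r e by (intro decV) auto
    finally show False using r e by simp
  qed
  with \<eta>0 have "\<eta>0 = 0" by simp
  show ?thesis
  proof (rule that[of V])
    show "admissible V" by (rule admV)
    show "V 0 = 1" by (simp add: V_def \<eta>0_def)
    show "V x = riesz a (\<lambda>y. V y powr p) x" for x
      using VeqG[of x] \<open>\<eta>0 = 0\<close> by (simp add: V_def[of x])
  qed (fact decV bV)+
qed

end

section \<open>The fractional Laplacian of a Riesz potential\<close>

lemma integral_pos_open: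
  fixes f :: "'a::euclidean_space \<Rightarrow> real"
  assumes f: "integrable lborel f" "\<And>x. 0 \<le> f x" and U: "open U" "U \<noteq> {}" "\<And>x. x \<in> U \<Longrightarrow> 0 < f x"
  shows "0 < (\<integral>x. f x \<partial>lborel)"
proof (rule ccontr)
  assume "\<not> 0 < (\<integral>x. f x \<partial>lborel)"
  moreover have "0 \<le> (\<integral>x. f x \<partial>lborel)" using f(2) by (intro integral_nonneg_AE AE_I2)
  ultimately have "(\<integral>x. f x \<partial>lborel) = 0" by simp
  then have "AE x in lborel. f x = 0" using integral_nonneg_eq_0_iff_AE[OF f(1)] f(2) by simp
  then have "AE x in lborel. x \<notin> U" by eventually_elim (use U(3) in fastforce)
  then have "U \<in> null_sets lborel" using U(1) by (subst (asm) AE_iff_null_sets[symmetric]) auto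
  then have "negligible U" unfolding negligible_iff_null_sets by (rule null_sets_completionI)
  with open_not_negligible[OF U(1,2)] show False by blast
qed

text \<open>Quadratic vanishing lowers the singularity from n + d to n + d - 2 < n, and boundedness
  serves infinity. Used for the normalising constant and for the potential of the ball.\<close>

lemma integrable_quadratic_kernel:
  fixes q :: "'a::euclidean_space \<Rightarrow> real"
  assumes d: "0 < d" "d < 2" and [measurable]: "q \<in> borel_measurable borel"
    and q: "\<And>y. \<bar>q y\<bar> \<le> K" "\<And>y. \<bar>q y\<bar> \<le> K * (norm y)\<^sup>2"
  shows "integrable lborel (\<lambda>y. q y * norm y powr (- (real DIM('a) + d)))"
proof (rule Bochner_Integration.integrable_bound)
  \<comment> \<open>For n = 1 and d < 1 the exponent n + d - 2 is negative, while
    \<open>integrable_powr_near_0\<close> expects a nonnegative one.\<close>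
  let ?e = "max 0 (real DIM('a) + d - 2)"
  have K: "K \<ge> 0" using q(1)[of 0] by linarith
  show "integrable lborel (\<lambda>y::'a. K * (indicator (cball 0 1) y * norm y powr (- ?e))
      + K * (indicator (- cball 0 1) y * norm y powr (- (real DIM('a) + d))))"
    using d by (intro Bochner_Integration.integrable_add integrable_mult_right integrable_powr_near_0 integrable_powr_outside) auto
  show "AE y in lborel. norm (q y * norm y powr (- (real DIM('a) + d))) \<le> norm (K * (indicator (cball 0 1) y * norm y powr (- ?e))
      + K * (indicator (- cball 0 1) y * norm y powr (- (real DIM('a) + d))))"
  proof (rule AE_I2)
    fix y :: 'a
    show "norm (q y * norm y powr (- (real DIM('a) + d))) \<le> norm (K * (indicator (cball 0 1) y * norm y powr (- ?e))
      + K * (indicator (- cball 0 1) y * norm y powr (- (real DIM('a) + d))))"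
    proof (cases "y = 0 \<or> norm y > 1")
      case True
      then show ?thesis using q(1)[of y] K by (auto simp: abs_mult mult_right_mono)
    next
      case False
      then have y: "norm y > 0" "norm y \<le> 1" by auto
      have "\<bar>q y\<bar> * norm y powr (- (real DIM('a) + d)) \<le> K * (norm y)\<^sup>2 * norm y powr (- (real DIM('a) + d))"
        by (intro mult_right_mono q) auto
      also have "\<dots> = K * norm y powr (2 - (real DIM('a) + d))"
      proof -
        have "(norm y)\<^sup>2 = norm y powr 2" using y by (simp add: powr_numeral)
        then show ?thesis by (simp only: mult.assoc powr_add[symmetric] diff_conv_add_uminus)
      qed
      also have "\<dots> \<le> K * norm y powr (- ?e)"
        using y K by (intro mult_left_mono powr_mono') auto
      finally show ?thesis using y K by (simp add: abs_mult)
    qed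
  qed
qed auto

text \<open>Meant for \<open>tail\<close>, which vanishes in the unit ball and so is radial but not
  decreasing. Points of equal norm are exchanged by a hyperplane through the origin, which leaves f
  invariant.\<close>

lemma riesz_radial:
  fixes f :: "'a::euclidean_space \<Rightarrow> real" and a b C :: real
  assumes a: "0 \<le> a" "a < DIM('a)" "DIM('a) < a + b"
    and f: "f \<in> borel_measurable borel" "\<And>y. \<bar>f y\<bar> \<le> C * (1 + norm y) powr (-b)"
    and rad: "\<And>x y. norm x = norm y \<Longrightarrow> f x = f y" and eq: "norm x = norm x'"
  shows "riesz a f x = riesz a f x'"
proof (cases "x = x'")
  case False
  then obtain e m where em: "norm e = 1" "x' = reflect e m x"
    and m: "m = ((norm x')\<^sup>2 - (norm x)\<^sup>2) / (2 * norm (x' - x))"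
    by (rule obtain_reflection)
  have m0: "m = 0" using eq m by simp
  have "(norm (reflect e m y))\<^sup>2 = (norm y)\<^sup>2" for y
    using norm_reflect_squared[OF em(1), of m y 0] m0 by simp
  then have "f (reflect e m y) = f y" for y by (intro rad) simp
  then show ?thesis using riesz_diff_reflect(2)[OF a f em(1), of x m] em(2) by simp
qed simp

text \<open>Bounds, up to a factor, the volume of the shell between 1 - \<rho> and 1 + \<rho>. The
  constant is the one for which the induction closes: 2 * 2 (2^n - 1) + 2 = 2 (2^(n+1) - 1).\<close>

lemma power_gap_bound:
  fixes \<rho> :: real
  assumes "0 \<le> \<rho>" "\<rho> \<le> 1"
  shows "(1 + \<rho>) ^ n - (1 - \<rho>) ^ n \<le> 2 * (2 ^ n - 1) * \<rho>"
proof (induction n)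
  case (Suc n)
  have "(1 + \<rho>) ^ Suc n - (1 - \<rho>) ^ Suc n = (1 + \<rho>) * ((1 + \<rho>) ^ n - (1 - \<rho>) ^ n) + 2 * \<rho> * (1 - \<rho>) ^ n"
    by (simp add: algebra_simps)
  also have "\<dots> \<le> 2 * (2 * (2 ^ n - 1) * \<rho>) + 2 * \<rho> * 1"
  proof (intro add_mono mult_mono Suc.IH)
    show "(1 - \<rho>) ^ n \<le> 1" using assms by (intro power_le_one) auto
    have "(1 - \<rho>) ^ n \<le> (1 + \<rho>) ^ n" using assms by (intro power_mono) auto
    then show "0 \<le> (1 + \<rho>) ^ n - (1 - \<rho>) ^ n" by simp
  qed (use assms in auto)
  also have "\<dots> = 2 * (2 ^ Suc n - 1) * \<rho>" by (simp add: algebra_simps)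
  finally show ?case .
qed simp

lemma powr_near_1_bound:
  fixes a t \<rho> :: real
  assumes a: "0 \<le> a" and t: "\<bar>t - 1\<bar> \<le> \<rho>" and \<rho>: "\<rho> \<le> 1 / 2"
  shows "\<bar>t powr (-a) - 1\<bar> \<le> a * 2 powr (a + 1) * \<rho>"
proof -
  have "norm (t powr (-a) - 1 powr (-a)) \<le> (a * 2 powr (a + 1)) * norm (t - 1)"
  proof (rule field_differentiable_bound[of "{1/2..3/2}"])
    fix z :: real assume z: "z \<in> {1/2..3/2}"
    then show "((\<lambda>t. t powr (-a)) has_field_derivative (- a * z powr (- a - 1))) (at z within {1/2..3/2})"
      by (auto intro!: derivative_eq_intros)
    have "z powr (- (a + 1)) \<le> (1 / 2) powr (- (a + 1))" using z a by (intro powr_mono2') auto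
    also have "\<dots> = 2 powr (a + 1)" by (simp only: powr_minus) (simp add: powr_divide)
    finally have "z powr (- a - 1) \<le> 2 powr (a + 1)" by simp
    then show "norm (- a * z powr (- a - 1)) \<le> a * 2 powr (a + 1)"
      using a by (simp add: abs_mult mult_left_mono)
  qed (use t \<rho> in \<open>auto simp: abs_le_iff\<close>)
  also have "\<dots> \<le> a * 2 powr (a + 1) * \<rho>" using a t by (intro mult_left_mono) auto
  finally show ?thesis by simp
qed

section \<open>The truncated singular integral and its profile \<open>Psi\<close>\<close>

locale riesz_inverse =
  fixes a :: real and ty :: "'a::euclidean_space itself"
  assumes a: "0 < a" "a < DIM('a)" "DIM('a) - a < 2"
begin

text \<open>For a = n - 2s this is n + 2s, the exponent of the singular kernel.\<close>

definition ord :: real where "ord = real DIM('a) + (real DIM('a) - a)"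

definition tail :: "'a \<Rightarrow> real" where
  "tail y = indicator (- ball 0 1) y * norm y powr (- ord)"

text \<open>The singular integral, truncated at radius 1, of the kernel |x|^(-a) itself. At the
  origin \<open>0 powr (-a)\<close> is 0 rather than infinite, so sign statements about
  \<open>Psi\<close> exclude that point.\<close>

definition Psi :: "'a \<Rightarrow> real" where
  "Psi x = (\<integral>y. tail y \<partial>lborel) * norm x powr (-a) - riesz a tail x"

lemma ord: "ord > DIM('a)" "0 \<le> a" "a < DIM('a)" "DIM('a) < a + ord"
  using a by (auto simp: ord_def)

lemma tail_nonneg: "0 \<le> tail y" by (simp add: tail_def)

lemma tail_measurable [measurable]: "tail \<in> borel_measurable borel"
  unfolding tail_def by (intro borel_measurable_times borel_measurable_indicator) auto

lemma tail_bound: "\<bar>tail y\<bar> \<le> 2 powr ord * (1 + norm y) powr (- ord)"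
proof (cases "norm y < 1")
  case False
  then have y: "norm y \<ge> 1" by simp
  have o: "ord > 0" using ord a by simp
  have "(1 + norm y) powr ord \<le> (2 * norm y) powr ord" using y o by (intro powr_mono2) auto
  then have le: "(1 + norm y) powr ord \<le> 2 powr ord * norm y powr ord" by (simp add: powr_mult)
  have "inverse N \<le> c * inverse A" if "A \<le> c * N" "A > 0" "N > 0" for A N c :: real
    using that by (simp add: field_simps)
  from this[OF le] y have "inverse (norm y powr ord) \<le> 2 powr ord * inverse ((1 + norm y) powr ord)"
    by (smt (verit) norm_ge_zero powr_gt_zero)
  then show ?thesis using y by (simp add: tail_def powr_minus)
qed (simp add: tail_def)

lemma integrable_tail: "integrable lborel tail"
proof (rule Bochner_Integration.integrable_bound)
  show "integrable lborel (\<lambda>z::'a. 2 powr ord * (norm z powr (-0) * (1 + norm z) powr (- ord)))"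
    using ord a by (intro integrable_mult_right integrable_powr_weight) auto
  show "AE y in lborel. norm (tail y) \<le> norm (2 powr ord * (norm y powr (-0) * (1 + norm y) powr (- ord)))"
    using AE_lborel_singleton[of 0] by eventually_elim (use tail_bound in auto)
qed auto

lemma integrable_tail_times:
  fixes h :: "'a \<Rightarrow> real"
  assumes [measurable]: "h \<in> borel_measurable borel" and "\<And>y. \<bar>h y\<bar> \<le> K"
  shows "integrable lborel (\<lambda>y. tail y * h y)"
proof (rule Bochner_Integration.integrable_bound)
  show "integrable lborel (\<lambda>y. tail y * K)" by (intro integrable_mult_left integrable_tail)
  show "AE y in lborel. norm (tail y * h y) \<le> norm (tail y * K)"
    using assms(2) by (intro AE_I2) (auto simp: abs_mult intro!: mult_left_mono order_trans[OF assms(2) abs_ge_self])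
qed auto

lemma isCont_tail: "norm y \<noteq> 1 \<Longrightarrow> isCont tail y"
proof -
  assume y: "norm y \<noteq> 1"
  show "isCont tail y"
  proof (cases "norm y < 1")
    case True
    have "\<forall>\<^sub>F z in nhds y. z \<in> ball 0 1" using True by (intro eventually_nhds_in_open) auto
    then have "\<forall>\<^sub>F z in nhds y. tail z = 0" by eventually_elim (simp add: tail_def)
    then show ?thesis by (subst isCont_cong[where g="\<lambda>_. 0"]) auto
  next
    case False
    have "\<forall>\<^sub>F z in nhds y. z \<in> - cball 0 1" using False y by (intro eventually_nhds_in_open) auto
    then have "\<forall>\<^sub>F z in nhds y. tail z = norm z powr (- ord)"
      by eventually_elim (auto simp: tail_def)
    then show ?thesis
      using False by (subst isCont_cong[where g="\<lambda>z. norm z powr (- ord)"]) (auto intro!: continuous_intros)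
  qed
qed

lemma isCont_Psi: "x \<noteq> 0 \<Longrightarrow> isCont Psi x"
  unfolding Psi_def
  by (intro continuous_intros isCont_riesz[OF ord(2-4) tail_measurable tail_bound, of "{1}"])
     (auto intro: isCont_tail)

lemma Psi_radial: "norm x = norm y \<Longrightarrow> Psi x = Psi y"
proof -
  have "tail x = tail y" if "norm x = norm y" for x y
    using that by (simp add: tail_def indicator_def)
  from riesz_radial[OF ord(2-4) tail_measurable tail_bound this, of x y]
  show "norm x = norm y \<Longrightarrow> Psi x = Psi y" by (simp add: Psi_def)
qed

context
  fixes F :: "'a \<Rightarrow> real" and b C :: real
  assumes F [measurable]: "F \<in> borel_measurable borel"
    and b: "DIM('a) < a + b" and bound: "\<And>y. \<bar>F y\<bar> \<le> C * (1 + norm y) powr (-b)"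
begin

lemma riesz_measurable: "riesz a F \<in> borel_measurable borel"
  unfolding riesz_def by measurable

text \<open>The weight that dominates F is radially decreasing, so its potential is largest at the
  origin.\<close>

lemma riesz_bounded: "\<bar>riesz a F x\<bar> \<le> riesz a (\<lambda>y::'a. C * (1 + norm y) powr (-b)) 0"
  and riesz_abs_bounded: "(\<integral>y. norm (x - y) powr (-a) * \<bar>F y\<bar> \<partial>lborel) \<le> riesz a (\<lambda>y::'a. C * (1 + norm y) powr (-b)) 0"
proof -
  let ?W = "\<lambda>y::'a. C * (1 + norm y) powr (-b)"
  have C: "C \<ge> 0" using bound[of 0] by (simp add: order.trans[OF abs_ge_zero])
  have W: "\<bar>?W y\<bar> \<le> C * (1 + norm y) powr (-b)" for y using C by (simp add: abs_mult)
  have b0: "b > 0" using b a by simp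
  have "radially_decreasing ?W"
    unfolding radially_decreasing_def using C b0 by (auto intro!: mult_left_mono powr_mono2' add_pos_nonneg)
  from radially_decreasing_riesz[OF ord(2,3) b W this]
  have le: "riesz a ?W x \<le> riesz a ?W 0" by (rule radially_decreasingD) simp
  have "(\<integral>y. norm (x - y) powr (-a) * \<bar>F y\<bar> \<partial>lborel) = riesz a (\<lambda>y. \<bar>F y\<bar>) x" by (simp add: riesz_def)
  also have "\<dots> \<le> riesz a ?W x"
    by (rule riesz_mono[OF ord(2,3) b]) (use bound W in auto)
  also note le
  finally show 1: "(\<integral>y. norm (x - y) powr (-a) * \<bar>F y\<bar> \<partial>lborel) \<le> riesz a ?W 0" .
  have "\<bar>riesz a F x\<bar> \<le> (\<integral>y. \<bar>norm (x - y) powr (-a) * F y\<bar> \<partial>lborel)"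
    unfolding riesz_def by (rule integral_abs_bound)
  with 1 show "\<bar>riesz a F x\<bar> \<le> riesz a ?W 0" by (simp add: abs_mult)
qed

text \<open>Fubini moves the truncated operator from the kernel to the potential: the right-hand
  side is the singular integral of \<open>riesz a F\<close> at 0, truncated at radius 1. At this
  stage \<open>Psi\<close> is integrated only against decaying F.\<close>

lemma Psi_duality:
  shows "integrable lborel (\<lambda>z. Psi z * F z)"
    and "(\<integral>z. Psi z * F z \<partial>lborel) = (\<integral>w. tail w * (riesz a F 0 - riesz a F w) \<partial>lborel)"
proof -
  let ?H = "\<lambda>w z. tail w * (norm (w - z) powr (-a) * F z)"
  have m: "case_prod ?H \<in> borel_measurable (borel \<Otimes>\<^sub>M borel)" by measurable
  have i1: "integrable lborel (?H w)" for w
    by (intro integrable_mult_right riesz_integrable[OF ord(2,3) b F bound])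
  have i2: "integrable lborel (\<lambda>w. \<integral>z. \<bar>?H w z\<bar> \<partial>lborel)"
  proof -
    have "integrable lborel (\<lambda>w. tail w * (\<integral>z. norm (w - z) powr (-a) * \<bar>F z\<bar> \<partial>lborel))"
    proof (rule integrable_tail_times)
      show "\<bar>\<integral>z. norm (w - z) powr (-a) * \<bar>F z\<bar> \<partial>lborel\<bar> \<le> riesz a (\<lambda>y::'a. C * (1 + norm y) powr (-b)) 0" for w
        using riesz_abs_bounded[of w] by (subst abs_of_nonneg) (auto intro!: integral_nonneg_AE)
    qed measurable
    then show ?thesis by (simp add: abs_mult abs_of_nonneg[OF tail_nonneg])
  qed
  have swap: "(\<integral>w. ?H w z \<partial>lborel) = F z * riesz a tail z" for z
  proof -
    have "(\<integral>w. ?H w z \<partial>lborel) = (\<integral>w. F z * (norm (z - w) powr (-a) * tail w) \<partial>lborel)"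
      by (intro Bochner_Integration.integral_cong) (auto simp: norm_minus_commute)
    then show ?thesis by (simp add: riesz_def)
  qed
  have j1: "integrable lborel (\<lambda>z. F z * riesz a tail z)"
    using lborel_Fubini(1)[OF m i1 i2] by (simp only: swap)
  have v1: "(\<integral>z. F z * riesz a tail z \<partial>lborel) = (\<integral>w. tail w * riesz a F w \<partial>lborel)"
    using lborel_Fubini(2)[OF m i1 i2] by (simp only: swap integral_mult_right_zero riesz_def)
  let ?A = "\<integral>y. tail y \<partial>lborel"
  have j2: "integrable lborel (\<lambda>z. ?A * (norm (0 - z) powr (-a) * F z))"
    by (intro integrable_mult_right riesz_integrable[OF ord(2,3) b F bound])
  have split: "Psi z * F z = ?A * (norm (0 - z) powr (-a) * F z) - F z * riesz a tail z" for z
    by (simp add: Psi_def algebra_simps)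
  show "integrable lborel (\<lambda>z. Psi z * F z)"
    unfolding split by (intro Bochner_Integration.integrable_diff j1 j2)
  have "(\<integral>z. Psi z * F z \<partial>lborel) = ?A * riesz a F 0 - (\<integral>w. tail w * riesz a F w \<partial>lborel)"
    unfolding split Bochner_Integration.integral_diff[OF j2 j1] v1 by (simp add: riesz_def)
  also have "\<dots> = (\<integral>w. tail w * riesz a F 0 - tail w * riesz a F w \<partial>lborel)"
    by (subst Bochner_Integration.integral_diff)
       (auto intro!: integrable_mult_left integrable_tail integrable_tail_times[OF riesz_measurable riesz_bounded])
  finally show "(\<integral>z. Psi z * F z \<partial>lborel) = (\<integral>w. tail w * (riesz a F 0 - riesz a F w) \<partial>lborel)"
    by (simp add: right_diff_distrib)
qed

lemma riesz_affine:
  assumes "\<epsilon> > 0"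
  shows "riesz a F (x - \<epsilon> *\<^sub>R w) = \<epsilon> powr (DIM('a) - a) * riesz a (\<lambda>z. F (x - \<epsilon> *\<^sub>R z)) w"
proof -
  have "riesz a F (x - \<epsilon> *\<^sub>R w) = \<bar>- \<epsilon>\<bar> ^ DIM('a) *
    (\<integral>z. norm (x - \<epsilon> *\<^sub>R w - (x + (- \<epsilon>) *\<^sub>R z)) powr (-a) * F (x + (- \<epsilon>) *\<^sub>R z) \<partial>lborel)"
    unfolding riesz_def using assms by (intro integral_lborel_affine) simp
  also have "(\<integral>z. norm (x - \<epsilon> *\<^sub>R w - (x + (- \<epsilon>) *\<^sub>R z)) powr (-a) * F (x + (- \<epsilon>) *\<^sub>R z) \<partial>lborel)
    = (\<integral>z. \<epsilon> powr (-a) * (norm (w - z) powr (-a) * F (x - \<epsilon> *\<^sub>R z)) \<partial>lborel)"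
  proof (intro Bochner_Integration.integral_cong refl)
    fix z :: 'a
    have "x - \<epsilon> *\<^sub>R w - (x + (- \<epsilon>) *\<^sub>R z) = (- \<epsilon>) *\<^sub>R (w - z)" by (simp add: algebra_simps)
    then have "norm (x - \<epsilon> *\<^sub>R w - (x + (- \<epsilon>) *\<^sub>R z)) = \<epsilon> * norm (w - z)"
      using assms by (simp only: norm_scaleR abs_minus_cancel abs_of_pos)
    then show "norm (x - \<epsilon> *\<^sub>R w - (x + (- \<epsilon>) *\<^sub>R z)) powr (-a) * F (x + (- \<epsilon>) *\<^sub>R z)
      = \<epsilon> powr (-a) * (norm (w - z) powr (-a) * F (x - \<epsilon> *\<^sub>R z))"
      using assms by (simp add: powr_mult)
  qed
  also have "\<dots> = \<epsilon> powr (-a) * riesz a (\<lambda>z. F (x - \<epsilon> *\<^sub>R z)) w" by (simp add: riesz_def)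
  also have "\<bar>- \<epsilon>\<bar> ^ DIM('a) * (\<epsilon> powr (-a) * riesz a (\<lambda>z. F (x - \<epsilon> *\<^sub>R z)) w)
     = \<epsilon> powr (DIM('a) - a) * riesz a (\<lambda>z. F (x - \<epsilon> *\<^sub>R z)) w"
    using assms by (simp add: powr_diff powr_minus powr_realpow divide_simps)
  finally show ?thesis .
qed

text \<open>The constant blows up as \<epsilon> tends to 0; it only certifies convergence for a
  fixed \<epsilon> and never enters a limit.\<close>

lemma affine_decay:
  assumes "\<epsilon> > 0"
  shows "\<bar>F (x - \<epsilon> *\<^sub>R z)\<bar> \<le> (C * (1 + norm x) powr b * (min 1 \<epsilon>) powr (-b)) * (1 + norm z) powr (-b)"
proof -
  have C: "C \<ge> 0" using bound[of 0] by (simp add: order.trans[OF abs_ge_zero])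
  have b0: "b \<ge> 0" using b a by simp
  have "min 1 \<epsilon> * (1 + norm z) \<le> 1 + norm (\<epsilon> *\<^sub>R z)"
    using assms mult_right_mono[of 1 \<epsilon> "norm z"] by (simp add: min_def distrib_left)
  then have "(1 + norm (\<epsilon> *\<^sub>R z)) powr (-b) \<le> (min 1 \<epsilon> * (1 + norm z)) powr (-b)"
    using assms b0 by (intro powr_mono2') (auto intro!: mult_pos_pos add_pos_nonneg)
  also have "\<dots> = (min 1 \<epsilon>) powr (-b) * (1 + norm z) powr (-b)"
    using assms by (subst powr_mult) auto
  finally have le: "(1 + norm (\<epsilon> *\<^sub>R z)) powr (-b) \<le> (min 1 \<epsilon>) powr (-b) * (1 + norm z) powr (-b)" .
  have "\<bar>F (x - \<epsilon> *\<^sub>R z)\<bar> \<le> C * (1 + norm (x - \<epsilon> *\<^sub>R z)) powr (-b)" by (rule bound)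
  also have "\<dots> \<le> C * ((1 + norm x) powr b * (1 + norm (\<epsilon> *\<^sub>R z)) powr (-b))"
    using C b0 by (intro mult_left_mono weight_shift) auto
  also have "\<dots> \<le> C * ((1 + norm x) powr b * ((min 1 \<epsilon>) powr (-b) * (1 + norm z) powr (-b)))"
    using C le by (intro mult_left_mono) auto
  finally show ?thesis by (simp add: mult.assoc)
qed

end

text \<open>Rescaling around x reduces truncation at \<epsilon> to truncation at 1 for z -> f(x -
  \<epsilon> z). The powers of \<epsilon> from the Jacobian, the kernel and the potential cancel
  because \<open>ord\<close> = n + (n - a), and \<open>Psi_duality\<close> finishes.\<close>

lemma truncated_riesz:
  fixes f :: "'a \<Rightarrow> real"
  assumes f [measurable]: "f \<in> borel_measurable borel"
    and b: "DIM('a) < a + b" and bound: "\<And>y. \<bar>f y\<bar> \<le> C * (1 + norm y) powr (-b)" and \<epsilon>: "\<epsilon> > 0"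
  shows "set_integrable lborel (- ball x \<epsilon>) (\<lambda>y. (riesz a f x - riesz a f y) / norm (x - y) powr ord)"
    and "(LINT y:(- ball x \<epsilon>)|lborel. (riesz a f x - riesz a f y) / norm (x - y) powr ord)
      = (\<integral>z. Psi z * f (x - \<epsilon> *\<^sub>R z) \<partial>lborel)"
proof -
  let ?F = "\<lambda>z. f (x - \<epsilon> *\<^sub>R z)" and ?V = "riesz a f"
  note [measurable] = riesz_measurable[OF f b bound]
  define B where "B = riesz a (\<lambda>y::'a. C * (1 + norm y) powr (-b)) 0"
  have VB: "\<bar>?V y\<bar> \<le> B" for y unfolding B_def by (rule riesz_bounded[OF f b bound])
  let ?k = "\<lambda>w. tail w * (?V x - ?V (x - \<epsilon> *\<^sub>R w))"
  have ik: "integrable lborel ?k"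
  proof (rule integrable_tail_times)
    show "\<bar>?V x - ?V (x - \<epsilon> *\<^sub>R w)\<bar> \<le> B + B" for w
      using VB[of x] VB[of "x - \<epsilon> *\<^sub>R w"] by linarith
  qed measurable
  have o: "ord > 0" using ord a by simp
  have pt: "?k ((1 / \<epsilon>) *\<^sub>R x + (- (1 / \<epsilon>)) *\<^sub>R y)
     = \<epsilon> powr ord * (indicator (- ball x \<epsilon>) y * ((?V x - ?V y) / norm (x - y) powr ord))" for y
  proof -
    have w: "(1 / \<epsilon>) *\<^sub>R x + (- (1 / \<epsilon>)) *\<^sub>R y = (1 / \<epsilon>) *\<^sub>R (x - y)" by (simp add: scaleR_right_diff_distrib)
    have "tail ((1 / \<epsilon>) *\<^sub>R (x - y)) = \<epsilon> powr ord * (indicator (- ball x \<epsilon>) y / norm (x - y) powr ord)"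
    proof -
      define v where "v = (1 / \<epsilon>) *\<^sub>R (x - y)"
      have nv: "norm v = norm (x - y) / \<epsilon>" using \<epsilon> unfolding v_def by (simp only: norm_scaleR) simp
      have "tail v = \<epsilon> powr ord * (indicator (- ball x \<epsilon>) y / norm (x - y) powr ord)"
      proof (cases "norm (x - y) < \<epsilon>")
        case True
        then have "norm v < 1" using \<epsilon> by (simp add: nv)
        with True show ?thesis by (simp add: tail_def dist_norm)
      next
        case False
        then have "\<not> norm v < 1" using \<epsilon> by (simp add: nv)
        with False show ?thesis using \<epsilon> by (simp add: tail_def nv powr_divide powr_minus_divide dist_norm)
      qed
      then show ?thesis by (simp only: v_def)
    qed
    moreover have "x - \<epsilon> *\<^sub>R ((1 / \<epsilon>) *\<^sub>R (x - y)) = y" using \<epsilon> by simp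
    ultimately show ?thesis unfolding w by simp
  qed
  have "integrable lborel (\<lambda>y. 1 / \<epsilon> powr ord * ?k ((1 / \<epsilon>) *\<^sub>R x + (- (1 / \<epsilon>)) *\<^sub>R y))"
    using \<epsilon> by (intro integrable_mult_right integrable_lborel_affine[OF ik]) simp
  then show int: "set_integrable lborel (- ball x \<epsilon>) (\<lambda>y. (?V x - ?V y) / norm (x - y) powr ord)"
    unfolding pt set_integrable_def
    using \<epsilon> by simp
  have "(\<integral>w. ?k w \<partial>lborel) = \<bar>- (1 / \<epsilon>)\<bar> ^ DIM('a) * (\<integral>y. ?k ((1 / \<epsilon>) *\<^sub>R x + (- (1 / \<epsilon>)) *\<^sub>R y) \<partial>lborel)"
    using \<epsilon> by (intro integral_lborel_affine) simp
  also have "\<dots> = \<epsilon> powr (- real DIM('a)) * (\<epsilon> powr ord * (LINT y:(- ball x \<epsilon>)|lborel. (?V x - ?V y) / norm (x - y) powr ord))"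
    unfolding pt set_lebesgue_integral_def using \<epsilon> by (simp add: power_one_over powr_minus powr_realpow divide_inverse power_inverse)
  also have "\<dots> = \<epsilon> powr (DIM('a) - a) * (LINT y:(- ball x \<epsilon>)|lborel. (?V x - ?V y) / norm (x - y) powr ord)"
    by (simp add: mult.assoc[symmetric] powr_add[symmetric] ord_def)
  finally have L: "(\<integral>w. ?k w \<partial>lborel) = \<epsilon> powr (DIM('a) - a) * (LINT y:(- ball x \<epsilon>)|lborel. (?V x - ?V y) / norm (x - y) powr ord)" .
  have "?k w = \<epsilon> powr (DIM('a) - a) * (tail w * (riesz a ?F 0 - riesz a ?F w))" for w
    using riesz_affine[OF f b bound \<epsilon>, of x 0] riesz_affine[OF f b bound \<epsilon>, of x w]
    by (simp add: right_diff_distrib mult.left_commute)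
  then have "(\<integral>w. ?k w \<partial>lborel) = \<epsilon> powr (DIM('a) - a) * (\<integral>w. tail w * (riesz a ?F 0 - riesz a ?F w) \<partial>lborel)"
    by (simp only: integral_mult_right_zero)
  also have "(\<integral>w. tail w * (riesz a ?F 0 - riesz a ?F w) \<partial>lborel) = (\<integral>z. Psi z * ?F z \<partial>lborel)"
    by (rule Psi_duality(2)[symmetric, OF _ b affine_decay[OF f b bound \<epsilon>]]) measurable
  finally show "(LINT y:(- ball x \<epsilon>)|lborel. (?V x - ?V y) / norm (x - y) powr ord)
      = (\<integral>z. Psi z * f (x - \<epsilon> *\<^sub>R z) \<partial>lborel)"
    using L \<epsilon> by simp
qed

end

section \<open>Sign and total mass of \<open>Psi\<close>\<close>

context riesz_inverse
begin

definition ball_potential :: "'a \<Rightarrow> real" where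
  "ball_potential = riesz a (indicator (ball 0 1))"

lemma indicator_ball_measurable [measurable]: "(indicator (ball (0::'a) R) :: 'a \<Rightarrow> real) \<in> borel_measurable borel"
  by (rule borel_measurable_indicator) auto

lemma indicator_ball_bound:
  "\<bar>indicator (ball 0 R) y :: real\<bar> \<le> (1 + \<bar>R\<bar>) powr DIM('a) * (1 + norm (y::'a)) powr (- real DIM('a))"
  using ball_decay[of R y] by simp

lemma exponents: "0 \<le> a" "a < DIM('a)" "DIM('a) < a + DIM('a)"
  using a by auto

lemma ball_potential_decreasing: "radially_decreasing ball_potential"
  unfolding ball_potential_def
  by (rule radially_decreasing_riesz[OF exponents indicator_ball_bound radially_decreasing_indicator])

lemma ball_potential_nonneg: "0 \<le> ball_potential x"
  unfolding ball_potential_def riesz_def by (intro integral_nonneg_AE AE_I2) simp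

text \<open>The sharp indicator still gives a quadratic bound: the two balls have equal volume, and on their
  symmetric difference the kernel differs from \<open>1\<close> by a multiple of the shift.\<close>

lemma ball_potential_quadratic_near_0:
  fixes z :: 'a
  assumes z: "norm z \<le> 1 / 2"
  shows "ball_potential 0 - ball_potential z
    \<le> a * 2 powr (a + 1) * unit_ball_vol DIM('a) * (2 * (2 ^ DIM('a) - 1)) * (norm z)\<^sup>2"
proof -
  define \<rho> where "\<rho> = norm z"
  define c where "c = a * 2 powr (a + 1) * \<rho>"
  have \<rho>: "0 \<le> \<rho>" "\<rho> \<le> 1 / 2" using z by (auto simp: \<rho>_def)
  have c: "c \<ge> 0" using a \<rho> by (simp add: c_def)
  let ?I = "indicator (ball (0::'a) 1) :: 'a \<Rightarrow> real"
  let ?D = "\<lambda>y. ?I (0 - y) - ?I (z - y)"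
  let ?S = "\<lambda>y. indicator (cball (0::'a) (1 + \<rho>)) y - indicator (ball (0::'a) (1 - \<rho>)) y :: real"
  have i0: "integrable lborel ?I" by (auto simp: emeasure_ball)
  have iD: "integrable lborel ?D"
    by (intro Bochner_Integration.integrable_diff integrable_lborel_reflect_at i0)
  have D0: "(\<integral>y. ?D y \<partial>lborel) = 0"
    by (subst Bochner_Integration.integral_diff)
       (auto simp only: integral_lborel_reflect_at diff_self intro!: integrable_lborel_reflect_at i0)
  have ih: "integrable lborel (\<lambda>y. norm y powr (-a) * ?I (x - y))" for x
    by (rule riesz_integrable_translate[OF exponents _ indicator_ball_bound]) measurable
  have ikD: "integrable lborel (\<lambda>y. norm y powr (-a) * ?D y)"
    unfolding right_diff_distrib by (intro Bochner_Integration.integrable_diff ih)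
  have "ball_potential 0 - ball_potential z = (\<integral>y. norm y powr (-a) * ?D y \<partial>lborel)"
    unfolding ball_potential_def riesz_translate right_diff_distrib
    by (intro Bochner_Integration.integral_diff[symmetric] ih)
  also have "\<dots> = (\<integral>y. norm y powr (-a) * ?D y - ?D y \<partial>lborel)"
    unfolding Bochner_Integration.integral_diff[OF ikD iD] D0 by simp
  also have "\<dots> \<le> (\<integral>y. c * ?S y \<partial>lborel)"
  proof (rule integral_mono)
    show "integrable lborel (\<lambda>y. norm y powr (-a) * ?D y - ?D y)"
      by (intro Bochner_Integration.integrable_diff ikD iD)
    show "integrable lborel (\<lambda>y. c * ?S y)"
      using \<rho> by (intro integrable_mult_right Bochner_Integration.integrable_diff) (auto simp: emeasure_ball emeasure_cball)
    fix y :: 'a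
    consider "norm y < 1 - \<rho>" | "norm y > 1 + \<rho>" | "\<bar>norm y - 1\<bar> \<le> \<rho>" by linarith
    then show "norm y powr (-a) * ?D y - ?D y \<le> c * ?S y"
    proof cases
      case 1
      have "norm (z - y) < 1" using 1 norm_triangle_ineq4[of z y] by (simp add: \<rho>_def)
      moreover have "norm y < 1" using 1 \<rho> by linarith
      ultimately have "?D y = 0" by simp
      moreover have "0 \<le> c * ?S y" using c 1 \<rho> by (auto simp: indicator_def)
      ultimately show ?thesis by simp
    next
      case 2
      have "norm (z - y) > 1" using 2 norm_triangle_ineq2[of y z] by (simp add: \<rho>_def norm_minus_commute)
      moreover have "norm y > 1" using 2 \<rho> by linarith
      ultimately have "?D y = 0" by simp
      moreover have "0 \<le> c * ?S y" using c 2 \<rho> by (auto simp: indicator_def)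
      ultimately show ?thesis by simp
    next
      case 3
      have "norm y powr (-a) * ?D y - ?D y = (norm y powr (-a) - 1) * ?D y" by (simp add: left_diff_distrib)
      also have "\<dots> \<le> \<bar>norm y powr (-a) - 1\<bar> * \<bar>?D y\<bar>" by (simp add: abs_mult[symmetric])
      also have "\<dots> \<le> c * 1"
      proof (intro mult_mono)
        show "\<bar>norm y powr (-a) - 1\<bar> \<le> c"
          unfolding c_def using powr_near_1_bound[of a "norm y" \<rho>] 3 \<rho> a by simp
      qed (use c in \<open>auto simp: indicator_def\<close>)
      also have "c * 1 = c * ?S y" using 3 by (simp add: indicator_def abs_le_iff)
      finally show ?thesis .
    qed
  qed
  also have "\<dots> = c * (unit_ball_vol DIM('a) * ((1 + \<rho>) ^ DIM('a) - (1 - \<rho>) ^ DIM('a)))"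
  proof -
    have "(\<integral>y. ?S y \<partial>lborel) = unit_ball_vol DIM('a) * (1 + \<rho>) ^ DIM('a) - unit_ball_vol DIM('a) * (1 - \<rho>) ^ DIM('a)"
      using \<rho> by (subst Bochner_Integration.integral_diff)
        (auto simp: emeasure_ball emeasure_cball measure_def)
    then show ?thesis by (simp only: integral_mult_right_zero right_diff_distrib[of "unit_ball_vol DIM('a)"])
  qed
  also have "\<dots> \<le> c * (unit_ball_vol DIM('a) * (2 * (2 ^ DIM('a) - 1) * \<rho>))"
    using c \<rho> by (intro mult_left_mono power_gap_bound) auto
  also have "\<dots> = a * 2 powr (a + 1) * unit_ball_vol DIM('a) * (2 * (2 ^ DIM('a) - 1)) * (norm z)\<^sup>2"
    by (simp only: c_def \<rho>_def power2_eq_square mult_ac)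
  finally show ?thesis .
qed

text \<open>The integrand of the singular integral of the ball potential at its maximum. Its finite
  total integral will bound the mass of \<open>Psi\<close>.\<close>

definition gap :: "'a \<Rightarrow> real" where
  "gap z = (ball_potential 0 - ball_potential z) * norm z powr (- ord)"

lemma gap_nonneg: "0 \<le> gap z"
  unfolding gap_def by (intro mult_nonneg_nonneg) (auto intro!: radially_decreasingD[OF ball_potential_decreasing])

lemma integrable_gap: "integrable lborel gap"
proof -
  \<comment> \<open>The second summand handles |z| > 1/2, where 1 <= 4 |z|^2 turns the trivial bound
    into a quadratic one.\<close>
  define K where "K = a * 2 powr (a + 1) * unit_ball_vol DIM('a) * (2 * (2 ^ DIM('a) - 1)) + 4 * ball_potential 0"
  have pw: "(1::real) \<le> 2 ^ DIM('a)" by simp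
  have K1: "0 \<le> a * 2 powr (a + 1) * unit_ball_vol DIM('a) * (2 * (2 ^ DIM('a) - 1))"
    using a pw by (intro mult_nonneg_nonneg) auto
  have h0: "0 \<le> ball_potential 0" by (rule ball_potential_nonneg)
  have q: "\<bar>ball_potential 0 - ball_potential z\<bar> \<le> K" "\<bar>ball_potential 0 - ball_potential z\<bar> \<le> K * (norm z)\<^sup>2" for z :: 'a
  proof -
    have abs: "\<bar>ball_potential 0 - ball_potential z\<bar> = ball_potential 0 - ball_potential z"
      using radially_decreasingD[OF ball_potential_decreasing, of 0 z] by simp
    have le: "ball_potential 0 - ball_potential z \<le> ball_potential 0" using ball_potential_nonneg[of z] by simp
    show "\<bar>ball_potential 0 - ball_potential z\<bar> \<le> K" unfolding abs using le K1 h0 by (simp add: K_def)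
    show "\<bar>ball_potential 0 - ball_potential z\<bar> \<le> K * (norm z)\<^sup>2"
    proof (cases "norm z \<le> 1 / 2")
      case True
      have "0 \<le> 4 * ball_potential 0 * (norm z)\<^sup>2" using h0 by simp
      with ball_potential_quadratic_near_0[OF True] show ?thesis
        unfolding abs K_def distrib_right by linarith
    next
      case False
      then have "(1 / 2)\<^sup>2 \<le> (norm z)\<^sup>2" by (intro power_mono) auto
      then have "1 \<le> 4 * (norm z)\<^sup>2" by (simp add: power2_eq_square)
      then have "ball_potential 0 * 1 \<le> ball_potential 0 * (4 * (norm z)\<^sup>2)" using h0 by (intro mult_left_mono)
      also have "\<dots> \<le> K * (norm z)\<^sup>2"
        using mult_right_mono[OF K1, of "(norm z)\<^sup>2"] by (simp add: K_def distrib_right)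
      finally show ?thesis unfolding abs using le by simp
    qed
  qed
  have "ball_potential \<in> borel_measurable borel" by (rule radially_decreasing_measurable[OF ball_potential_decreasing])
  then have "(\<lambda>z. ball_potential 0 - ball_potential z) \<in> borel_measurable borel" by simp
  from integrable_quadratic_kernel[OF _ _ this q, of "real DIM('a) - a"] a show ?thesis
    unfolding gap_def ord_def by simp
qed

text \<open>Duality with the indicator of the ball of radius R, whose potential is a dilate of
  \<open>ball_potential\<close>. Scaling by R moves the cut-off of \<open>tail\<close> from 1 to
  1/R, so the domain on the right grows with R.\<close>

lemma Psi_ball_integral:
  assumes R: "R > 0"
  shows "(\<integral>z. Psi z * indicator (ball 0 R) z \<partial>lborel) = (\<integral>z. indicator (- ball 0 (1 / R)) z * gap z \<partial>lborel)"
proof -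
  let ?F = "indicator (ball (0::'a) R) :: 'a \<Rightarrow> real"
  note b = indicator_ball_bound[of R]
  have pot: "riesz a ?F (0 - R *\<^sub>R w) = R powr (DIM('a) - a) * ball_potential w" for w :: 'a
  proof -
    have "(\<lambda>z. ?F (0 - R *\<^sub>R z)) = indicator (ball 0 1)"
      using R by (auto simp: indicator_def fun_eq_iff)
    then show ?thesis
      using riesz_affine[OF indicator_ball_measurable exponents(3) b R, of 0 w] by (simp add: ball_potential_def)
  qed
  have "(\<integral>z. Psi z * ?F z \<partial>lborel) = (\<integral>w. tail w * (riesz a ?F 0 - riesz a ?F w) \<partial>lborel)"
    by (rule Psi_duality(2)[OF indicator_ball_measurable exponents(3) b])
  also have "\<dots> = \<bar>- R\<bar> ^ DIM('a) * (\<integral>w. tail (0 + (- R) *\<^sub>R w) * (riesz a ?F 0 - riesz a ?F (0 + (- R) *\<^sub>R w)) \<partial>lborel)"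
    using R by (intro integral_lborel_affine) simp
  also have "(\<integral>w. tail (0 + (- R) *\<^sub>R w) * (riesz a ?F 0 - riesz a ?F (0 + (- R) *\<^sub>R w)) \<partial>lborel)
    = (\<integral>w. R powr (- real DIM('a)) * (indicator (- ball 0 (1 / R)) w * gap w) \<partial>lborel)"
  proof (intro Bochner_Integration.integral_cong refl)
    fix w :: 'a
    have t: "tail (0 + (- R) *\<^sub>R w) = R powr (- ord) * (indicator (- ball 0 (1 / R)) w * norm w powr (- ord))"
    proof (cases "norm w < 1 / R")
      case True
      then have "R * norm w < 1" using R by (simp add: field_simps)
      with True R show ?thesis by (simp add: tail_def)
    next
      case False
      then have "\<not> R * norm w < 1" using R by (simp add: field_simps)
      with False R show ?thesis by (simp add: tail_def powr_mult)
    qed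
    have p: "riesz a ?F 0 - riesz a ?F (0 + (- R) *\<^sub>R w) = R powr (DIM('a) - a) * (ball_potential 0 - ball_potential w)"
      using pot[of 0] pot[of w] by (simp add: right_diff_distrib)
    have e: "R powr (- ord) * R powr (DIM('a) - a) = R powr (- real DIM('a))"
      by (simp add: powr_add[symmetric] ord_def)
    have "A * (I * N) * (B * D) = A * B * (I * (D * N))" for A B D I N :: real by simp
    then show "tail (0 + (- R) *\<^sub>R w) * (riesz a ?F 0 - riesz a ?F (0 + (- R) *\<^sub>R w))
      = R powr (- real DIM('a)) * (indicator (- ball 0 (1 / R)) w * gap w)"
      unfolding t p gap_def e[symmetric] .
  qed
  finally show ?thesis using R by (simp add: powr_minus powr_realpow)
qed

lemma integrable_Psi_ball: "integrable lborel (\<lambda>z. Psi z * indicator (ball 0 R) z)"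
  by (rule Psi_duality(1)[OF indicator_ball_measurable exponents(3) indicator_ball_bound])

lemma integrable_gap_outside: "integrable lborel (\<lambda>z. indicator (- ball 0 r) z * gap z)"
proof -
  have "(\<lambda>z. indicator (- ball (0::'a) r) z * gap z) = (\<lambda>z. indicator (- ball 0 r) z *\<^sub>R gap z)" by simp
  then show ?thesis using integrable_mult_indicator[OF _ integrable_gap, of "- ball 0 r"] by simp
qed

lemma Psi_ball_integral_mono:
  assumes "0 < R" "R \<le> S"
  shows "(\<integral>z. Psi z * indicator (ball 0 R) z \<partial>lborel) \<le> (\<integral>z. Psi z * indicator (ball 0 S) z \<partial>lborel)"
proof -
  have "1 / S \<le> 1 / R" using assms by (simp add: frac_le)
  then have "indicator (- ball 0 (1 / R)) z * gap z \<le> indicator (- ball 0 (1 / S)) z * gap z" for z :: 'a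
    using gap_nonneg[of z] by (auto simp: indicator_def)
  then show ?thesis
    using assms by (simp add: Psi_ball_integral integral_mono integrable_gap_outside)
qed

text \<open>A negative value would spread, by continuity and radial symmetry, to an annulus, and the
  integrals over balls would decrease across it, against
  \<open>Psi_ball_integral_mono\<close>.\<close>

lemma Psi_nonneg:
  assumes x: "x \<noteq> 0"
  shows "0 \<le> Psi x"
proof (rule ccontr)
  assume "\<not> 0 \<le> Psi x"
  then have neg: "Psi x < 0" by simp
  define r where "r = norm x"
  have r: "r > 0" using x by (simp add: r_def)
  obtain \<delta> where \<delta>: "\<delta> > 0" "\<And>y. dist y x < \<delta> \<Longrightarrow> dist (Psi y) (Psi x) < - Psi x"
    using isCont_Psi[OF x] neg unfolding continuous_at_eps_delta by (metis neg_0_less_iff_less)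
  define d where "d = min \<delta> r / 2"
  have d: "0 < d" "d < \<delta>" "d < r" using \<delta>(1) r by (auto simp: d_def)
  have annulus: "Psi y < 0" if y: "\<bar>norm y - r\<bar> \<le> d" for y
  proof -
    let ?y = "(norm y / r) *\<^sub>R x"
    have "?y - x = ((norm y - r) / r) *\<^sub>R x" using r by (simp add: diff_divide_distrib scaleR_left_diff_distrib)
    then have "dist ?y x = \<bar>norm y - r\<bar>" using r by (simp add: dist_norm r_def)
    then have "Psi ?y < 0" using \<delta>(2)[of ?y] y d(2) by (simp add: dist_real_def)
    moreover have "Psi ?y = Psi y" using r by (intro Psi_radial) (simp add: r_def)
    ultimately show ?thesis by simp
  qed
  let ?f = "\<lambda>z. Psi z * indicator (ball 0 (r - d)) z - Psi z * indicator (ball 0 (r + d)) z"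
  have "0 < (\<integral>z. ?f z \<partial>lborel)"
  proof (rule integral_pos_open[of ?f "ball 0 (r + d) \<inter> - cball 0 (r - d)"])
    show "integrable lborel ?f" by (intro Bochner_Integration.integrable_diff integrable_Psi_ball)
    show "0 \<le> ?f z" for z
      using annulus[of z] d(1) by (auto simp: indicator_def abs_le_iff intro: less_imp_le)
    show "open (ball 0 (r + d) \<inter> - cball (0::'a) (r - d))" by auto
    have "x \<in> ball 0 (r + d) \<inter> - cball 0 (r - d)" using d(1) by (simp add: r_def)
    then show "ball 0 (r + d) \<inter> - cball (0::'a) (r - d) \<noteq> {}" by blast
    show "0 < ?f z" if "z \<in> ball 0 (r + d) \<inter> - cball 0 (r - d)" for z
      using annulus[of z] that by (auto simp: indicator_def abs_le_iff)
  qed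
  also have "(\<integral>z. ?f z \<partial>lborel) \<le> 0"
    unfolding Bochner_Integration.integral_diff[OF integrable_Psi_ball integrable_Psi_ball]
    using Psi_ball_integral_mono[of "r - d" "r + d"] d by simp
  finally show False by simp
qed

lemma Psi_measurable [measurable]: "Psi \<in> borel_measurable borel"
proof -
  note [measurable] = riesz_measurable[OF tail_measurable ord(4) tail_bound]
  show ?thesis unfolding Psi_def by measurable
qed

text \<open>Monotone convergence along growing balls; \<open>Suc\<close> keeps the radii positive,
  and the integral of \<open>gap\<close> bounds all the masses.\<close>

lemma integrable_Psi: "integrable lborel Psi"
proof -
  let ?f = "\<lambda>i z. Psi z * indicator (ball 0 (real (Suc i))) z"
  have bounded: "(\<integral>z. ?f i z \<partial>lborel) \<le> (\<integral>z. gap z \<partial>lborel)" for i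
    unfolding Psi_ball_integral[OF of_nat_0_less_iff[THEN iffD2, OF zero_less_Suc[of i]]]
    using gap_nonneg by (intro integral_mono integrable_gap integrable_gap_outside) (auto simp: indicator_def)
  have "incseq (\<lambda>i. \<integral>z. ?f i z \<partial>lborel)"
    by (intro incseq_SucI Psi_ball_integral_mono) auto
  from incseq_convergent[OF this, of "\<integral>z. gap z \<partial>lborel"] bounded
  obtain L where L: "(\<lambda>i. \<integral>z. ?f i z \<partial>lborel) \<longlonglongrightarrow> L" by blast
  show ?thesis
  proof (rule integrable_monotone_convergence)
  show "integrable lborel (?f i)" for i by (rule integrable_Psi_ball)
  show "AE z in lborel. mono (\<lambda>i. ?f i z)"
    using AE_lborel_singleton[of 0]
  proof eventually_elim
    fix z :: 'a assume "z \<noteq> 0"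
    then show "mono (\<lambda>i. ?f i z)" using Psi_nonneg[of z] by (auto simp: mono_def indicator_def)
  qed
  show "AE z in lborel. (\<lambda>i. ?f i z) \<longlonglongrightarrow> Psi z"
  proof (rule AE_I2)
    fix z :: 'a
    obtain N where "norm z < real N" using reals_Archimedean2 by blast
    then have "\<forall>\<^sub>F i in sequentially. ?f i z = Psi z"
      by (intro eventually_sequentiallyI[of N]) (auto simp: indicator_def)
    then show "(\<lambda>i. ?f i z) \<longlonglongrightarrow> Psi z" by (rule tendsto_eventually)
  qed
  show "(\<lambda>i. \<integral>z. ?f i z \<partial>lborel) \<longlonglongrightarrow> L" by (rule L)
qed measurable
qed

text \<open>The dilates of \<open>Psi\<close> act as an approximate identity up to total mass, so
  continuity of f suffices for the principal value, without any smoothness of the potential.\<close>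

lemma truncated_riesz_tendsto:
  fixes f :: "'a \<Rightarrow> real"
  assumes f: "\<And>x. isCont f x"
    and b: "DIM('a) < a + b" and bound: "\<And>y. \<bar>f y\<bar> \<le> C * (1 + norm y) powr (-b)"
  shows "((\<lambda>\<epsilon>. LINT y:(- ball x \<epsilon>)|lborel. (riesz a f x - riesz a f y) / norm (x - y) powr ord)
      \<longlongrightarrow> (\<integral>z. Psi z \<partial>lborel) * f x) (at_right 0)"
proof -
  have [measurable]: "f \<in> borel_measurable borel"
    using f by (intro borel_measurable_continuous_onI continuous_at_imp_continuous_on) auto
  have b0: "b \<ge> 0" using b a by simp
  have C: "C \<ge> 0" using bound[of 0] by (simp add: order.trans[OF abs_ge_zero])
  have fC: "\<bar>f y\<bar> \<le> C" for y
  proof -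
    have "(1 + norm y) powr (-b) \<le> 1 powr (-b)" using b0 by (intro powr_mono2') auto
    then have "C * (1 + norm y) powr (-b) \<le> C * 1" using C by (intro mult_left_mono) auto
    with bound[of y] show ?thesis by simp
  qed
  have "((\<lambda>\<epsilon>. \<integral>z. Psi z * f (x - \<epsilon> *\<^sub>R z) \<partial>lborel) \<longlongrightarrow> (\<integral>z. Psi z * f x \<partial>lborel)) (at_right 0)"
    unfolding tendsto_at_iff_sequentially
  proof (intro allI impI)
    fix X :: "nat \<Rightarrow> real" assume X: "X \<longlonglongrightarrow> 0"
    show "((\<lambda>\<epsilon>. \<integral>z. Psi z * f (x - \<epsilon> *\<^sub>R z) \<partial>lborel) \<circ> X) \<longlonglongrightarrow> (\<integral>z. Psi z * f x \<partial>lborel)"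
      unfolding o_def
    proof (rule integral_dominated_convergence[where w="\<lambda>z. \<bar>Psi z\<bar> * C"])
      show "integrable lborel (\<lambda>z. \<bar>Psi z\<bar> * C)"
        by (intro integrable_mult_left integrable_abs integrable_Psi)
      show "AE z in lborel. (\<lambda>i. Psi z * f (x - X i *\<^sub>R z)) \<longlonglongrightarrow> Psi z * f x"
      proof (intro AE_I2 tendsto_mult_left)
        fix z :: 'a
        have "(\<lambda>i. x - X i *\<^sub>R z) \<longlonglongrightarrow> x - 0 *\<^sub>R z" by (intro tendsto_intros X)
        then show "(\<lambda>i. f (x - X i *\<^sub>R z)) \<longlonglongrightarrow> f x" by (intro isCont_tendsto_compose[OF f]) simp
      qed
      show "AE z in lborel. norm (Psi z * f (x - X i *\<^sub>R z)) \<le> \<bar>Psi z\<bar> * C" for i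
        using fC by (intro AE_I2) (simp add: abs_mult mult_left_mono)
    qed measurable
  qed
  then have "((\<lambda>\<epsilon>. \<integral>z. Psi z * f (x - \<epsilon> *\<^sub>R z) \<partial>lborel) \<longlongrightarrow> (\<integral>z. Psi z \<partial>lborel) * f x) (at_right 0)"
    by simp
  then show ?thesis
  proof (rule Lim_transform_eventually)
    show "\<forall>\<^sub>F \<epsilon> in at_right 0. (\<integral>z. Psi z * f (x - \<epsilon> *\<^sub>R z) \<partial>lborel)
        = (LINT y:(- ball x \<epsilon>)|lborel. (riesz a f x - riesz a f y) / norm (x - y) powr ord)"
      using eventually_at_right_less[of 0]
    proof eventually_elim
      fix \<epsilon> :: real assume "0 < \<epsilon>"
      then show "(\<integral>z. Psi z * f (x - \<epsilon> *\<^sub>R z) \<partial>lborel)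
        = (LINT y:(- ball x \<epsilon>)|lborel. (riesz a f x - riesz a f y) / norm (x - y) powr ord)"
        by (intro truncated_riesz(2)[OF _ b bound, symmetric]) auto
    qed
  qed
qed

text \<open>If the mass were 0, \<open>Psi\<close> would vanish almost everywhere and so would its
  pairing with f. By duality that pairing is a truncated singular integral at a strict maximum,
  hence positive.\<close>

lemma integral_Psi_pos:
  fixes f :: "'a \<Rightarrow> real"
  assumes [measurable]: "f \<in> borel_measurable borel"
    and b: "DIM('a) < a + b" and bound: "\<And>y. \<bar>f y\<bar> \<le> C * (1 + norm y) powr (-b)"
    and dec: "\<And>x. x \<noteq> 0 \<Longrightarrow> riesz a f x < riesz a f 0"
  shows "0 < (\<integral>z. Psi z \<partial>lborel)"
proof (rule ccontr)
  assume "\<not> 0 < (\<integral>z. Psi z \<partial>lborel)"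
  moreover have nn: "AE z in lborel. 0 \<le> Psi z"
    using AE_lborel_singleton[of 0] by eventually_elim (rule Psi_nonneg)
  then have "0 \<le> (\<integral>z. Psi z \<partial>lborel)" by (rule integral_nonneg_AE)
  ultimately have "(\<integral>z. Psi z \<partial>lborel) = 0" by simp
  then have "AE z in lborel. Psi z = 0" using integral_nonneg_eq_0_iff_AE[OF integrable_Psi nn] by simp
  then have "(\<integral>z. Psi z * f z \<partial>lborel) = 0" by (intro integral_eq_zero_AE) auto
  moreover have "0 < (\<integral>w. tail w * (riesz a f 0 - riesz a f w) \<partial>lborel)"
  proof (rule integral_pos_open[where U="- cball 0 1"])
    define B where "B = riesz a (\<lambda>y::'a. C * (1 + norm y) powr (-b)) 0"
    have VB: "\<bar>riesz a f y\<bar> \<le> B" for y unfolding B_def by (rule riesz_bounded[OF _ b bound]) measurable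
    note [measurable] = riesz_measurable[OF assms(1) b bound]
    show "integrable lborel (\<lambda>w. tail w * (riesz a f 0 - riesz a f w))"
    proof (rule integrable_tail_times)
      show "\<bar>riesz a f 0 - riesz a f w\<bar> \<le> B + B" for w using VB[of 0] VB[of w] by linarith
    qed measurable
    have le: "riesz a f w \<le> riesz a f 0" for w using dec[of w] by (cases "w = 0") auto
    show "0 \<le> tail w * (riesz a f 0 - riesz a f w)" for w using le[of w] tail_nonneg[of w] by simp
    obtain y :: 'a where "norm y = 2" using vector_choose_size[of 2] by auto
    then have "y \<in> - cball 0 1" by simp
    then show "- cball (0::'a) 1 \<noteq> {}" by blast
    show "0 < tail w * (riesz a f 0 - riesz a f w)" if "w \<in> - cball 0 1" for w
    proof -
      have "w \<noteq> 0" using that by auto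
      then show ?thesis using that dec[of w] by (intro mult_pos_pos) (auto simp: tail_def)
    qed
  qed auto
  ultimately show False using Psi_duality(2)[OF assms(1) b bound] by simp
qed

end

text \<open>Convergence of the integral is part of the point: a divergent one would count as 0, and
  the constant would become 1 / 0 = 0.\<close>

lemma frac_laplacian_const_pos:
  assumes s: "0 < s" "s < 1"
  shows "frac_laplacian_const TYPE('a::euclidean_space) s > 0"
proof -
  define e :: 'a where "e = (SOME e. e \<in> Basis)"
  have e: "e \<in> Basis" unfolding e_def by (rule someI_ex) (use nonempty_Basis in blast)
  let ?q = "\<lambda>y. 1 - cos (e \<bullet> y)"
  have cos_bound: "1 - cos t \<le> t\<^sup>2 / 2" for t :: real
    using cos_double_sin[of "t / 2"] abs_sin_x_le_abs_x[of "t / 2"]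
      power_mono[of "\<bar>sin (t / 2)\<bar>" "\<bar>t / 2\<bar>" 2] by (simp add: power_divide)
  have q: "\<bar>?q y\<bar> \<le> 2" "\<bar>?q y\<bar> \<le> 2 * (norm y)\<^sup>2" for y
  proof -
    show "\<bar>?q y\<bar> \<le> 2" using cos_ge_minus_one[of "e \<bullet> y"] by simp
    have "\<bar>e \<bullet> y\<bar> \<le> norm y" using Cauchy_Schwarz_ineq2[of e y] e by simp
    then have "\<bar>e \<bullet> y\<bar>\<^sup>2 \<le> (norm y)\<^sup>2" by (intro power_mono) auto
    then have "(e \<bullet> y)\<^sup>2 \<le> (norm y)\<^sup>2" by simp
    moreover have "\<bar>?q y\<bar> = ?q y" by simp
    ultimately show "\<bar>?q y\<bar> \<le> 2 * (norm y)\<^sup>2"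
      using cos_bound[of "e \<bullet> y"] zero_le_power2[of "norm y"] by linarith
  qed
  have m: "?q \<in> borel_measurable borel" by measurable
  have int: "integrable lborel (\<lambda>y. ?q y * norm y powr (- (real DIM('a) + 2 * s)))"
    using s by (intro integrable_quadratic_kernel[OF _ _ m q]) auto
  have "0 < (\<integral>y. ?q y * norm y powr (- (real DIM('a) + 2 * s)) \<partial>lborel)"
  proof (rule integral_pos_open[OF int, where U="{y. 0 < e \<bullet> y} \<inter> {y. e \<bullet> y < 1}"])
    show "0 \<le> ?q y * norm y powr (- (real DIM('a) + 2 * s))" for y by simp
    show "open ({y. 0 < e \<bullet> y} \<inter> {y. e \<bullet> y < 1})"
      by (intro open_Int open_Collect_less continuous_intros)
    have "(1 / 2) *\<^sub>R e \<in> {y. 0 < e \<bullet> y} \<inter> {y. e \<bullet> y < 1}" using e by (simp add: inner_same_Basis)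
    then show "{y. 0 < e \<bullet> y} \<inter> {y. e \<bullet> y < 1} \<noteq> {}" by blast
    show "0 < ?q y * norm y powr (- (real DIM('a) + 2 * s))" if "y \<in> {y. 0 < e \<bullet> y} \<inter> {y. e \<bullet> y < 1}" for y
    proof (intro mult_pos_pos)
      have "cos (e \<bullet> y) < cos 0" using that pi_gt3 by (intro cos_monotone_0_pi) auto
      then show "0 < ?q y" by simp
      show "0 < norm y powr (- (real DIM('a) + 2 * s))" using that by auto
    qed
  qed
  then have "0 < (\<integral>y. ?q y / norm y powr (real DIM('a) + 2 * s) \<partial>lborel)"
    by (simp only: powr_minus divide_inverse)
  then show ?thesis
    unfolding frac_laplacian_const_def e_def by simp
qed

section \<open>Regularity of the limit and the final rescaling\<close>

lemma continuous_riesz_power: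
  fixes V :: "'a::euclidean_space \<Rightarrow> real" and a b C p :: real
  assumes a: "0 \<le> a" "a < DIM('a)" "DIM('a) < a + b" and p: "p > 1"
    and V: "radially_decreasing V" "\<And>x. 0 \<le> V x" "\<And>x. V x = riesz a (\<lambda>y. V y powr p) x"
    and bound: "\<And>y. V y powr p \<le> C * (1 + norm y) powr (-b)"
  shows "radially_decreasing (\<lambda>y. V y powr p)" "isCont V x" "isCont (\<lambda>y. V y powr p) x"
proof -
  show dec: "radially_decreasing (\<lambda>y. V y powr p)"
    using V(1,2) p by (auto simp: radially_decreasing_def intro!: powr_mono2)
  have bd: "\<bar>V y powr p\<bar> \<le> C * (1 + norm y) powr (-b)" for y using bound[of y] by simp
  obtain D where "countable D" "\<And>x. norm x \<notin> D \<Longrightarrow> isCont (\<lambda>y. V y powr p) x"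
    using radially_decreasing_discont[OF dec] by metis
  \<comment> \<open>Monotonicity alone gives enough continuity of the source; the equation then
    upgrades V to a continuous function.\<close>
  then have "isCont (riesz a (\<lambda>y. V y powr p)) x" for x
    by (intro isCont_riesz[OF a radially_decreasing_measurable[OF dec] bd])
  moreover have "riesz a (\<lambda>y. V y powr p) = V" by (intro ext) (rule V(3)[symmetric])
  ultimately have cV: "isCont V x" for x by simp
  then show "isCont V x" .
  show "isCont (\<lambda>y. V y powr p) x"
    unfolding isCont_def
    by (rule tendsto_powr'[OF cV[unfolded isCont_def] tendsto_const]) (use V(2) p in auto)
qed

theorem proposition2p1:
  fixes s p :: real
  assumes "0 < s" and "s < 1"
    and "real CARD('n::finite) > 2 * s"
    and "p + 1 > 2 * real CARD('n) / (real CARD('n) - 2 * s)"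
  shows "\<exists>(w :: real^'n \<Rightarrow> real) (W :: real \<Rightarrow> real).
           (\<forall>x. w x = W (norm x)) \<and>
           strict_antimono_on {0..} W \<and>
           continuous_on UNIV w \<and>
           (\<forall>x. w x > 0) \<and>
           (\<forall>x. has_frac_laplacian s w x (w x powr p)) \<and>
           (\<exists>C>0. \<forall>\<^sub>F r in at_top. W r \<le> C * r powr (- (2 * s / (p - 1))))"
proof -
  define N where "N = real DIM(real^'n)"
  have N: "N = real CARD('n)" by (simp add: N_def)
  define a where "a = N - 2 * s"
  have a: "0 < a" "a < N" "N - a < 2" using assms N by (auto simp: a_def)
  \<comment> \<open>As a < N, the critical bound on p + 1 already exceeds 2, so the problem is
    superlinear.\<close>
  have "2 < 2 * N / a" using a by (simp add: field_simps)
  then have p: "p > 1" using assms(4) by (simp add: N a_def)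
  have super: "2 * N / (p + 1) < a"
    using assms(4) a p by (simp add: a_def N field_simps)
  interpret LE: lane_emden a p "TYPE(real^'n)"
    using a p by unfold_locales (auto simp: N_def)
  interpret RI: riesz_inverse a "TYPE(real^'n)"
    using a by unfold_locales (auto simp: N_def)
  obtain V :: "real^'n \<Rightarrow> real" where adm: "LE.admissible V" and V0: "V 0 = 1"
    and Veq: "\<And>x. V x = riesz a (\<lambda>y. V y powr p) x"
    and decay: "\<And>x. x \<noteq> 0 \<Longrightarrow> V x \<le> LE.decay_const * norm x powr (- LE.decay_rate)"
    and bound: "\<And>y. V y powr p \<le> LE.src_const * (1 + norm y) powr (- (p * LE.decay_rate))"
    by (rule LE.entire_solution[OF super[unfolded N_def]]) (rule that)
  let ?f = "\<lambda>y. V y powr p"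
  have Vdec: "radially_decreasing V" and Vnn: "\<And>x. 0 \<le> V x" using adm by (auto simp: LE.admissible_def)
  note reg = continuous_riesz_power[OF LE.src_exponents p Vdec Vnn Veq bound]
  have bd: "\<bar>?f y\<bar> \<le> LE.src_const * (1 + norm y) powr (- (p * LE.decay_rate))" for y using bound[of y] by simp
  have [measurable]: "?f \<in> borel_measurable borel" by (rule radially_decreasing_measurable[OF reg(1)])
  have weight0: "((\<lambda>y::real^'n. c * (1 + norm y) powr (- e)) \<longlongrightarrow> 0) at_infinity" if "e > 0" for c e :: real
  proof -
    have "filterlim (\<lambda>y::real^'n. 1 + norm y) at_top at_infinity"
      by (intro filterlim_tendsto_add_at_top[OF tendsto_const] filterlim_norm_at_top)
    then have "((\<lambda>y::real^'n. (1 + norm y) powr (- e)) \<longlongrightarrow> 0) at_infinity"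
      using that by (intro tendsto_neg_powr) auto
    from tendsto_mult_left[OF this, of c] show ?thesis by simp
  qed
  have flim: "(?f \<longlongrightarrow> 0) at_infinity"
  proof (rule tendsto_sandwich[OF _ _ tendsto_const weight0])
    show "\<forall>\<^sub>F y in at_infinity. ?f y \<le> LE.src_const * (1 + norm y) powr (- (p * LE.decay_rate))"
      using bound by simp
    show "0 < p * LE.decay_rate" using p LE.decay_rate_pos by simp
  qed simp
  \<comment> \<open>Strictness is lost in limits and is recovered from the equation, whose source is
    continuous and tends to 0 at infinity.\<close>
  have strict: "V y < V x" if "norm x < norm y" for x y
    unfolding Veq[of x] Veq[of y]
    by (rule riesz_strictly_decreasing[OF LE.src_exponents bd reg(1) a(1) _ flim _ that])
       (use reg(3) V0 in \<open>auto intro: continuous_at_imp_continuous_on\<close>)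
  have Vpos: "V x > 0" for x
  proof -
    obtain y :: "real^'n" where "norm y = norm x + 1" using vector_choose_size[of "norm x + 1"] by auto
    then have "V y < V x" by (intro strict) simp
    with Vnn[of y] show ?thesis by linarith
  qed
  have C0: "0 < (\<integral>z. RI.Psi z \<partial>lborel)"
  proof (rule RI.integral_Psi_pos[OF _ LE.src_exponents(3) bd])
    show "riesz a ?f x < riesz a ?f 0" if "x \<noteq> 0" for x
      using strict[of 0 x] that by (simp only: Veq[symmetric]) simp
  qed measurable
  define \<gamma> where "\<gamma> = frac_laplacian_const TYPE(real^'n) s * (\<integral>z. RI.Psi z \<partial>lborel)"
  have \<gamma>: "\<gamma> > 0" unfolding \<gamma>_def using frac_laplacian_const_pos[of s] assms C0 by (intro mult_pos_pos)
  \<comment> \<open>The multiple c V has fractional Laplacian c \<gamma> V^p, so c must solve c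
    \<gamma> = c^p.\<close>
  define c where "c = \<gamma> powr (1 / (p - 1))"
  have c: "c > 0" using \<gamma> by (simp add: c_def)
  have cp: "c * \<gamma> = c powr p"
  proof -
    have "1 / (p - 1) + 1 = p * (1 / (p - 1))" using p by (simp add: field_simps)
    moreover have "c * \<gamma> = \<gamma> powr (1 / (p - 1) + 1)" using \<gamma> by (simp add: c_def powr_add)
    ultimately show ?thesis by (simp add: c_def powr_powr mult.commute)
  qed
  have ord: "real DIM(real^'n) + 2 * s = RI.ord" unfolding RI.ord_def by (simp add: a_def N_def)
  define w where "w x = c * V x" for x
  obtain e :: "real^'n" where e: "norm e = 1" using vector_choose_size[of 1] by auto
  define W where "W r = w (r *\<^sub>R e)" for r
  show ?thesis
  proof (intro exI[of _ w] exI[of _ W] conjI allI)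
    show "w x = W (norm x)" for x
      unfolding w_def W_def using radially_decreasing_eq[OF Vdec, of x "norm x *\<^sub>R e"] e by simp
    show "strict_antimono_on {0..} W"
      unfolding monotone_on_def W_def w_def using c e by (auto intro!: mult_strict_left_mono strict)
    show "continuous_on UNIV w"
      unfolding w_def using reg(2) by (intro continuous_on_mult continuous_on_const continuous_at_imp_continuous_on) auto
    show "w x > 0" for x unfolding w_def using c Vpos by simp
    show "has_frac_laplacian s w x (w x powr p)" for x
      unfolding has_frac_laplacian_def ord
    proof (intro conjI allI impI)
      have quot: "(w x - w y) / norm (x - y) powr RI.ord = c * ((riesz a ?f x - riesz a ?f y) / norm (x - y) powr RI.ord)" for y
        unfolding w_def Veq[symmetric] by (simp add: right_diff_distrib)
      show "set_integrable lborel (- ball x \<epsilon>) (\<lambda>y. (w x - w y) / norm (x - y) powr RI.ord)" if "\<epsilon> > 0" for \<epsilon>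
        unfolding quot by (intro set_integrable_mult_right RI.truncated_riesz(1)[OF _ LE.src_exponents(3) bd that]) measurable
      have "((\<lambda>\<epsilon>. frac_laplacian_const TYPE(real^'n) s * (c * (LINT y:(- ball x \<epsilon>)|lborel. (riesz a ?f x - riesz a ?f y) / norm (x - y) powr RI.ord)))
        \<longlongrightarrow> frac_laplacian_const TYPE(real^'n) s * (c * ((\<integral>z. RI.Psi z \<partial>lborel) * ?f x))) (at_right 0)"
        by (intro tendsto_mult_left RI.truncated_riesz_tendsto[OF reg(3) LE.src_exponents(3) bd])
      moreover have "frac_laplacian_const TYPE(real^'n) s * (c * ((\<integral>z. RI.Psi z \<partial>lborel) * ?f x)) = w x powr p"
      proof -
        have "frac_laplacian_const TYPE(real^'n) s * (c * ((\<integral>z. RI.Psi z \<partial>lborel) * ?f x)) = (c * \<gamma>) * ?f x"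
          by (simp add: \<gamma>_def)
        then show ?thesis using c Vnn[of x] by (simp add: cp w_def powr_mult)
      qed
      ultimately show "((\<lambda>\<epsilon>. frac_laplacian_const TYPE(real^'n) s * (LINT y:(- ball x \<epsilon>)|lborel. (w x - w y) / norm (x - y) powr RI.ord))
        \<longlongrightarrow> w x powr p) (at_right 0)"
        unfolding quot set_integral_mult_right by (simp only:)
    qed
    have rate: "LE.decay_rate = 2 * s / (p - 1)" unfolding LE.decay_rate_def by (simp add: a_def N_def)
    show "\<exists>C>0. \<forall>\<^sub>F r in at_top. W r \<le> C * r powr (- (2 * s / (p - 1)))"
    proof (intro exI[of _ "c * LE.decay_const"] conjI)
      have "unit_ball_vol (real DIM(real^'n)) \<noteq> 0"
        using unit_ball_vol_pos[of "real DIM(real^'n)"] by linarith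
      then show "c * LE.decay_const > 0" using c by (simp add: LE.decay_const_def)
      show "\<forall>\<^sub>F r in at_top. W r \<le> c * LE.decay_const * r powr (- (2 * s / (p - 1)))"
        using eventually_gt_at_top[of 0]
      proof eventually_elim
        fix r :: real assume r: "0 < r"
        have "V (r *\<^sub>R e) \<le> LE.decay_const * norm (r *\<^sub>R e) powr (- LE.decay_rate)"
          using r e by (intro decay) auto
        then have "V (r *\<^sub>R e) \<le> LE.decay_const * r powr (- (2 * s / (p - 1)))"
          using r e by (simp add: rate)
        then show "W r \<le> c * LE.decay_const * r powr (- (2 * s / (p - 1)))"
          unfolding W_def w_def using c by (simp add: mult.assoc mult_left_mono)
      qed
    qed
  qed
qed

end
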